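(* Let $n\in\mathbb N$ and let $\varPhi=\{\varphi_m\}_{m=1}^\infty\subset\mathcal A$ be a family satisfying the following conditions. (i) For each $m\in\mathbb N$ and each $A>0$ there exists a constant $C_{m,A}>0$ such that $\varphi_m(x)+A\ln(1+\Vert x\Vert)\le\varphi_{m+1}(x)+C_{m,A}$ for all $x\in\mathbb R^n$. (ii) For each $m\in\mathbb N$ there exists a constant $K_m>0$ such that $\varphi_m(x+\xi)\le\varphi_{m+1}(x)+K_m$ for all $x\in[0,\infty)^n$, $\xi\in[0,1]^n$. (iii) For each $m\in\mathbb N$ there is a constant $a_m>0$ such that $\varphi_m(2x)\le\varphi_{m+1}(x)+a_m$ for all $x\in\mathbb R^n$. (iv) For each $m\in\mathbb N$ there is a constant $l_m>0$ such that $2\varphi_m(x)\le\varphi_{m+1}(x)+l_m$ for all $x\in\mathbb R^n$. Then the Fourier transformation $\mathcal F: f\in E(\varPhi)\mapsto\hat f$, where $$\hat f(x)=\int_{\mathbb R^n}f(\xi)e^{-i\langle x,\xi\rangle}\,d\xi,\quad x\in\mathbb R^n,$$ establishes an isomorphism (of topological vector spaces) of $E(\varPhi)$ onto $G(\Psi^* )$.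
   Context: Notation: $\mathbb N=\{1,2,\dots\}$, $\mathbb Z_+=\{0,1,2,\dots\}$; $\Vert\cdot\Vert$ is the Euclidean norm on $\mathbb R^n$ or $\mathbb C^n$; $H(\mathbb C^n)$ is the space of entire functions on $\mathbb C^n$; $\langle u,v\rangle=u_1v_1+\cdots+u_nv_n$. For $\alpha\in\mathbb Z_+^n$: $|\alpha|=\alpha_1+\cdots+\alpha_n$, $\alpha!=\alpha_1!\cdots\alpha_n!$, $x^\alpha=x_1^{\alpha_1}\cdots x_n^{\alpha_n}$, $D^\alpha=\partial^{|\alpha|}/\partial x_1^{\alpha_1}\cdots\partial x_n^{\alpha_n}$. $\mathcal A$ is the set of all real-valued $g\in C(\mathbb R^n)$ such that: (1) $g(x)=g(|x_1|,\dots,|x_n|)$ for all $x=(x_1,\dots,x_n)\in\mathbb R^n$; (2) the restriction of $g$ to $[0,\infty)^n$ is nondecreasing in each variable; (3) $\lim_{x\to\infty}g(x)/\Vert x\Vert=+\infty$. The space $E(\varPhi)$: for $\nu\in\mathbb N$, $k\in\mathbb Z_+$ let $$E_k(\varphi_\nu)=\Big\{f\in H(\mathbb C^n):\ p_{\nu,k}(f)=\sup_{z\in\mathbb C^n}\frac{|f(z)|(1+\Vert z\Vert)^k}{e^{\varphi_\nu(|\mathrm{Im}\,z_1|,\dots,|\mathrm{Im}\,z_n|)}}<\infty\Big\},$$ normed by $p_{\nu,k}$; $E(\varphi_\nu)=\bigcap_{k=0}^\infty E_k(\varphi_\nu)$ with the projective limit topology of the spaces $E_k(\varphi_\nu)$;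 $E(\varPhi)=\bigcup_{\nu=1}^\infty E(\varphi_\nu)$ with the (locally convex) inductive limit topology of the spaces $E(\varphi_\nu)$. The Young–Fenchel conjugate of $g:\mathbb R^n\to[-\infty,+\infty]$ is $g^*(x)=\sup_{y\in\mathbb R^n}(\langle x,y\rangle-g(y))$, $x\in\mathbb R^n$. Put $\psi_\nu(x)=\varphi_\nu(e^{x_1},\dots,e^{x_n})$ for $x\in\mathbb R^n$, and $\Psi^*=\{\psi_\nu^*\}_{\nu=1}^\infty$. The space $G(\Psi^* )$: for $\nu\in\mathbb N$, $m\in\mathbb Z_+$ let $$G_m(\psi_\nu^* )=\Big\{f\in C^m(\mathbb R^n):\ \Vert f\Vert_{m,\psi_\nu^*}=\sup_{x\in\mathbb R^n,\ |\alpha|\le m,\ \beta\in\mathbb Z_+^n}\frac{|x^\beta(D^\alpha f)(x)|}{\beta!\,e^{-\psi_\nu^*(\beta)}}<\infty\Big\};$$ $G(\psi_\nu^* )=\bigcap_{m=0}^\infty G_m(\psi_\nu^* )$ with the topology defined by the norms $\Vert\cdot\Vert_{m,\psi_\nu^*}$, $m\in\mathbb Z_+$; $G(\Psi^* )=\bigcup_{\nu=1}^\infty G(\psi_\nu^* )$ with the (locally convex) inductive limit topology of the spaces $G(\psi_\nu^* )$. Functions are complex-valued. *)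

theory Defs
  imports "HOL-Analysis.Analysis"
begin

section \<open>Vector topologies on spaces of complex-valued functions\<close>

text \<open>
  The spaces below are sets of functions \<open>'a \<Rightarrow> complex\<close> with pointwise operations, topologised
  by abstract topologies (not by the product topology of the function type).
\<close>

definition seminorm_topology ::
  "('a \<Rightarrow> complex) set \<Rightarrow> (('a \<Rightarrow> complex) \<Rightarrow> ereal) set \<Rightarrow> ('a \<Rightarrow> complex) topology" where
  "seminorm_topology X P =
     topology_generated_by {{g \<in> X. p (\<lambda>x. g x - f x) < ereal r} | p f r. p \<in> P \<and> f \<in> X}"

text \<open>The coarsest topology on the intersection making all inclusions into the \<open>T k\<close> continuous.\<close>

definition projective_limit_topology :: "(nat \<Rightarrow> 'b topology) \<Rightarrow> 'b topology" where
  "projective_limit_topology T =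
     topology_generated_by {U \<inter> (\<Inter>k. topspace (T k)) | k U. openin (T k) U}"

definition absolutely_convex :: "('a \<Rightarrow> complex) set \<Rightarrow> bool" where
  "absolutely_convex V \<longleftrightarrow>
     (\<forall>f\<in>V. \<forall>g\<in>V. \<forall>a b. cmod a + cmod b \<le> 1 \<longrightarrow> (\<lambda>x. a * f x + b * g x) \<in> V)"

definition zero_neighbourhood :: "('a \<Rightarrow> complex) topology \<Rightarrow> ('a \<Rightarrow> complex) set \<Rightarrow> bool" where
  "zero_neighbourhood T V \<longleftrightarrow> (\<exists>W. openin T W \<and> (\<lambda>_. 0) \<in> W \<and> W \<subseteq> V)"

text \<open>
  The locally convex inductive limit of the spaces \<open>T \<nu>\<close>, \<open>\<nu> \<in> I\<close>, on the union of their carriers: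
  a base of neighbourhoods of zero consists of the absolutely convex sets whose trace on every
  \<open>T \<nu>\<close> is a neighbourhood of zero there. This is the finest locally convex topology making all
  inclusions continuous.
\<close>

definition lc_limit_nbhd ::
  "'i set \<Rightarrow> ('i \<Rightarrow> ('a \<Rightarrow> complex) topology) \<Rightarrow> ('a \<Rightarrow> complex) set \<Rightarrow> bool" where
  "lc_limit_nbhd I T V \<longleftrightarrow>
     V \<subseteq> (\<Union>\<nu>\<in>I. topspace (T \<nu>)) \<and> absolutely_convex V \<and>
     (\<forall>\<nu>\<in>I. zero_neighbourhood (T \<nu>) (V \<inter> topspace (T \<nu>)))"

definition lc_limit_open ::
  "'i set \<Rightarrow> ('i \<Rightarrow> ('a \<Rightarrow> complex) topology) \<Rightarrow> ('a \<Rightarrow> complex) set \<Rightarrow> bool" where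
  "lc_limit_open I T U \<longleftrightarrow>
     U \<subseteq> (\<Union>\<nu>\<in>I. topspace (T \<nu>)) \<and>
     (\<forall>f\<in>U. \<exists>V. lc_limit_nbhd I T V \<and> (\<forall>v\<in>V. (\<lambda>x. f x + v x) \<in> U))"

definition lc_inductive_limit ::
  "'i set \<Rightarrow> ('i \<Rightarrow> ('a \<Rightarrow> complex) topology) \<Rightarrow> ('a \<Rightarrow> complex) topology" where
  "lc_inductive_limit I T = topology (lc_limit_open I T)"

lemma zero_neighbourhood_Int:
  assumes "zero_neighbourhood T V" "zero_neighbourhood T W"
  shows "zero_neighbourhood T (V \<inter> W)"
proof -
  obtain A where A: "openin T A" "(\<lambda>_. 0) \<in> A" "A \<subseteq> V"
    using assms(1) unfolding zero_neighbourhood_def by metis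
  obtain B where B: "openin T B" "(\<lambda>_. 0) \<in> B" "B \<subseteq> W"
    using assms(2) unfolding zero_neighbourhood_def by metis
  have "openin T (A \<inter> B)" "(\<lambda>_. 0) \<in> A \<inter> B" "A \<inter> B \<subseteq> V \<inter> W"
    using A B by (simp_all add: openin_Int le_infI1 le_infI2)
  then show ?thesis
    unfolding zero_neighbourhood_def by (intro exI[of _ "A \<inter> B"] conjI)
qed

lemma lc_limit_nbhd_Int:
  assumes V: "lc_limit_nbhd I T V" and W: "lc_limit_nbhd I T W"
  shows "lc_limit_nbhd I T (V \<inter> W)"
  unfolding lc_limit_nbhd_def
proof (intro conjI ballI)
  show "V \<inter> W \<subseteq> (\<Union>\<nu>\<in>I. topspace (T \<nu>))"
    using V unfolding lc_limit_nbhd_def by (simp only: le_infI1)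
  show "absolutely_convex (V \<inter> W)"
    using V W unfolding lc_limit_nbhd_def absolutely_convex_def by simp
  fix \<nu> assume "\<nu> \<in> I"
  then have "zero_neighbourhood (T \<nu>) ((V \<inter> topspace (T \<nu>)) \<inter> (W \<inter> topspace (T \<nu>)))"
    using V W unfolding lc_limit_nbhd_def by (simp only: zero_neighbourhood_Int)
  moreover have "(V \<inter> topspace (T \<nu>)) \<inter> (W \<inter> topspace (T \<nu>)) = V \<inter> W \<inter> topspace (T \<nu>)"
    by (simp only: Int_ac Int_absorb)
  ultimately show "zero_neighbourhood (T \<nu>) (V \<inter> W \<inter> topspace (T \<nu>))"
    by simp
qed

lemma istopology_lc_limit_open: "istopology (lc_limit_open I T)"
  unfolding istopology_def
proof (intro conjI allI impI)
  fix S U assume S: "lc_limit_open I T S" and U: "lc_limit_open I T U"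
  show "lc_limit_open I T (S \<inter> U)"
    unfolding lc_limit_open_def
  proof (intro conjI ballI)
    show "S \<inter> U \<subseteq> (\<Union>\<nu>\<in>I. topspace (T \<nu>))"
      using S unfolding lc_limit_open_def by (simp only: le_infI1)
    fix f assume f: "f \<in> S \<inter> U"
    obtain V where V: "lc_limit_nbhd I T V" "\<forall>v\<in>V. (\<lambda>x. f x + v x) \<in> S"
      using S f unfolding lc_limit_open_def by (metis IntD1)
    obtain W where W: "lc_limit_nbhd I T W" "\<forall>v\<in>W. (\<lambda>x. f x + v x) \<in> U"
      using U f unfolding lc_limit_open_def by (metis IntD2)
    show "\<exists>V. lc_limit_nbhd I T V \<and> (\<forall>v\<in>V. (\<lambda>x. f x + v x) \<in> S \<inter> U)"
      by (rule exI[of _ "V \<inter> W"]) (simp add: lc_limit_nbhd_Int V W)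
  qed
next
  fix K assume K: "\<forall>U\<in>K. lc_limit_open I T U"
  show "lc_limit_open I T (\<Union>K)"
    unfolding lc_limit_open_def
  proof (intro conjI ballI)
    show "\<Union>K \<subseteq> (\<Union>\<nu>\<in>I. topspace (T \<nu>))"
      using K unfolding lc_limit_open_def by (simp only: Sup_least)
    fix f assume "f \<in> \<Union>K"
    then obtain U where U: "U \<in> K" "f \<in> U" by (rule UnionE)
    then obtain V where V: "lc_limit_nbhd I T V" "\<forall>v\<in>V. (\<lambda>x. f x + v x) \<in> U"
      using K unfolding lc_limit_open_def by metis
    then show "\<exists>V. lc_limit_nbhd I T V \<and> (\<forall>v\<in>V. (\<lambda>x. f x + v x) \<in> \<Union>K)"
      using U(1) by (metis UnionI)
  qed
qed

lemma openin_lc_inductive_limit: "openin (lc_inductive_limit I T) U \<longleftrightarrow> lc_limit_open I T U"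
  by (simp add: lc_inductive_limit_def topology_inverse' istopology_lc_limit_open)

definition tvs_isomorphism ::
  "('a \<Rightarrow> complex) set \<Rightarrow> ('a \<Rightarrow> complex) topology \<Rightarrow> ('b \<Rightarrow> complex) set \<Rightarrow> ('b \<Rightarrow> complex) topology
    \<Rightarrow> (('a \<Rightarrow> complex) \<Rightarrow> ('b \<Rightarrow> complex)) \<Rightarrow> bool" where
  "tvs_isomorphism X TX Y TY F \<longleftrightarrow>
     topspace TX = X \<and> topspace TY = Y \<and>
     (\<forall>f\<in>X. \<forall>g\<in>X. \<forall>a b. F (\<lambda>x. a * f x + b * g x) = (\<lambda>y. a * F f y + b * F g y)) \<and>
     bij_betw F X Y \<and> homeomorphic_map TX TY F"


section \<open>The weights\<close>

definition class_A :: "(real ^ 'n \<Rightarrow> real) set" where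
  "class_A = {g. continuous_on UNIV g \<and>
     (\<forall>x. g x = g (\<chi> i. \<bar>x $ i\<bar>)) \<and>
     (\<forall>x i t. (\<forall>j. 0 \<le> x $ j) \<and> x $ i \<le> t \<longrightarrow> g x \<le> g (\<chi> j. if j = i then t else x $ j)) \<and>
     filterlim (\<lambda>x. g x / norm x) at_top at_infinity}"

definition young_fenchel :: "(real ^ 'n \<Rightarrow> ereal) \<Rightarrow> real ^ 'n \<Rightarrow> ereal" where
  "young_fenchel g x = (SUP y. ereal (x \<bullet> y) - g y)"

definition exp_weight :: "(real ^ 'n \<Rightarrow> real) \<Rightarrow> real ^ 'n \<Rightarrow> real" where
  "exp_weight g x = g (\<chi> i. exp (x $ i))"

definition psi_star :: "(nat \<Rightarrow> real ^ 'n \<Rightarrow> real) \<Rightarrow> nat \<Rightarrow> real ^ 'n \<Rightarrow> ereal" where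
  "psi_star \<phi> \<nu> = young_fenchel (\<lambda>x. ereal (exp_weight (\<phi> \<nu>) x))"


section \<open>The space \<open>E(\<Phi>)\<close> of entire functions\<close>

definition entire :: "(complex ^ 'n \<Rightarrow> complex) \<Rightarrow> bool" where
  "entire f \<longleftrightarrow> (\<forall>z. \<exists>D. (f has_derivative D) (at z) \<and> (\<forall>c v. D (c *s v) = c * D v))"

definition E_norm :: "(real ^ 'n \<Rightarrow> real) \<Rightarrow> nat \<Rightarrow> (complex ^ 'n \<Rightarrow> complex) \<Rightarrow> ereal" where
  "E_norm \<phi> k f =
     (SUP z. ereal (cmod (f z) * (1 + norm z) ^ k / exp (\<phi> (\<chi> i. \<bar>Im (z $ i)\<bar>))))"

definition E_step :: "(real ^ 'n \<Rightarrow> real) \<Rightarrow> nat \<Rightarrow> (complex ^ 'n \<Rightarrow> complex) set" where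
  "E_step \<phi> k = {f. entire f \<and> E_norm \<phi> k f < \<infinity>}"

definition E_weight :: "(real ^ 'n \<Rightarrow> real) \<Rightarrow> (complex ^ 'n \<Rightarrow> complex) set" where
  "E_weight \<phi> = (\<Inter>k. E_step \<phi> k)"

definition E_weight_topology :: "(real ^ 'n \<Rightarrow> real) \<Rightarrow> (complex ^ 'n \<Rightarrow> complex) topology" where
  "E_weight_topology \<phi> =
     projective_limit_topology (\<lambda>k. seminorm_topology (E_step \<phi> k) {E_norm \<phi> k})"

text \<open>Families are indexed by the positive integers; the value at index 0 is never used.\<close>

definition E_space :: "(nat \<Rightarrow> real ^ 'n \<Rightarrow> real) \<Rightarrow> (complex ^ 'n \<Rightarrow> complex) set" where
  "E_space \<phi> = (\<Union>\<nu>\<in>{1..}. E_weight (\<phi> \<nu>))"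

definition E_topology :: "(nat \<Rightarrow> real ^ 'n \<Rightarrow> real) \<Rightarrow> (complex ^ 'n \<Rightarrow> complex) topology" where
  "E_topology \<phi> = lc_inductive_limit {1..} (\<lambda>\<nu>. E_weight_topology (\<phi> \<nu>))"


section \<open>The space \<open>G(\<Psi>\<^sup>*)\<close> of smooth functions\<close>

definition has_partial :: "'n \<Rightarrow> (real ^ 'n \<Rightarrow> complex) \<Rightarrow> real ^ 'n \<Rightarrow> bool" where
  "has_partial i f x \<longleftrightarrow> (\<lambda>t::real. f (x + t *\<^sub>R axis i 1)) differentiable (at 0)"

definition partial :: "'n \<Rightarrow> (real ^ 'n \<Rightarrow> complex) \<Rightarrow> real ^ 'n \<Rightarrow> complex" where
  "partial i f x = vector_derivative (\<lambda>t::real. f (x + t *\<^sub>R axis i 1)) (at 0)"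

primrec C_diff :: "nat \<Rightarrow> (real ^ 'n \<Rightarrow> complex) \<Rightarrow> bool" where
  "C_diff 0 f \<longleftrightarrow> continuous_on UNIV f"
| "C_diff (Suc m) f \<longleftrightarrow>
     continuous_on UNIV f \<and> (\<forall>i. (\<forall>x. has_partial i f x) \<and> C_diff m (partial i f))"

text \<open>
  The index type carries no order, so the coordinates are listed in some fixed order. The
  order does not affect \<open>multi_deriv \<alpha> f\<close> when \<open>f\<close> is of class \<open>C\<^sup>m\<close> and \<open>\<bar>\<alpha>\<bar> \<le> m\<close>, which is the only
  case used below.
\<close>

definition coordinates :: "'n::finite list" where
  "coordinates = (SOME is. distinct is \<and> set is = UNIV)"

definition multi_deriv ::
  "('n::finite \<Rightarrow> nat) \<Rightarrow> (real ^ 'n \<Rightarrow> complex) \<Rightarrow> real ^ 'n \<Rightarrow> complex" where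
  "multi_deriv \<alpha> f = foldr (\<lambda>i. partial i ^^ \<alpha> i) coordinates f"

definition multi_vec :: "('n \<Rightarrow> nat) \<Rightarrow> real ^ 'n" where
  "multi_vec \<beta> = (\<chi> i. real (\<beta> i))"

text \<open>
  If \<open>h = \<psi>\<^sup>*\<close> with \<open>\<psi>(x) = \<phi>(e\<^sup>x)\<close> and \<open>\<phi> \<in> class_A\<close>, then \<open>h\<close> is finite at every multi-index (though not
  at points with a negative coordinate), so that \<open>real_of_ereal\<close> loses nothing here.
\<close>

definition G_norm :: "(real ^ 'n \<Rightarrow> ereal) \<Rightarrow> nat \<Rightarrow> (real ^ 'n \<Rightarrow> complex) \<Rightarrow> ereal" where
  "G_norm h m f =
     (SUP (x, \<alpha>, \<beta>) \<in> UNIV \<times> {\<alpha>. (\<Sum>i\<in>UNIV. \<alpha> i) \<le> m} \<times> UNIV.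
        ereal (cmod (of_real (\<Prod>i\<in>UNIV. x $ i ^ \<beta> i) * multi_deriv \<alpha> f x) /
          ((\<Prod>i\<in>UNIV. fact (\<beta> i)) * exp (- real_of_ereal (h (multi_vec \<beta>))))))"

definition G_step :: "(real ^ 'n \<Rightarrow> ereal) \<Rightarrow> nat \<Rightarrow> (real ^ 'n \<Rightarrow> complex) set" where
  "G_step h m = {f. C_diff m f \<and> G_norm h m f < \<infinity>}"

definition G_weight :: "(real ^ 'n \<Rightarrow> ereal) \<Rightarrow> (real ^ 'n \<Rightarrow> complex) set" where
  "G_weight h = (\<Inter>m. G_step h m)"

definition G_weight_topology :: "(real ^ 'n \<Rightarrow> ereal) \<Rightarrow> (real ^ 'n \<Rightarrow> complex) topology" where
  "G_weight_topology h = seminorm_topology (G_weight h) (range (G_norm h))"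

definition G_space :: "(nat \<Rightarrow> real ^ 'n \<Rightarrow> ereal) \<Rightarrow> (real ^ 'n \<Rightarrow> complex) set" where
  "G_space h = (\<Union>\<nu>\<in>{1..}. G_weight (h \<nu>))"

definition G_topology :: "(nat \<Rightarrow> real ^ 'n \<Rightarrow> ereal) \<Rightarrow> (real ^ 'n \<Rightarrow> complex) topology" where
  "G_topology h = lc_inductive_limit {1..} (\<lambda>\<nu>. G_weight_topology (h \<nu>))"


section \<open>The Fourier transformation\<close>

definition fourier_integrand ::
  "(complex ^ 'n \<Rightarrow> complex) \<Rightarrow> real ^ 'n \<Rightarrow> real ^ 'n \<Rightarrow> complex" where
  "fourier_integrand f x \<xi> = f (\<chi> i. of_real (\<xi> $ i)) * exp (- \<i> * of_real (x \<bullet> \<xi>))"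

definition fourier :: "(complex ^ 'n \<Rightarrow> complex) \<Rightarrow> real ^ 'n \<Rightarrow> complex" where
  "fourier f x = (LINT \<xi>|lborel. fourier_integrand f x \<xi>)"

end

theory Submission
  imports Defs "HOL-Complex_Analysis.Conformal_Mappings"
begin

text \<open>
  For \<open>f \<in> E(\<phi>)\<close> the integral defining \<open>f\<close>'s transform may be moved to \<open>\<real>\<^sup>n + \<i> \<eta>\<close> for every \<open>\<eta>\<close>. With
  \<open>\<eta>\<^sub>j = - sgn (x\<^sub>j) * t\<^sub>j\<close> this bounds every derivative of the transform by a multiple of
  \<open>exp (\<phi> t - \<Sum>\<bar>x\<^sub>j\<bar> t\<^sub>j)\<close>; multiplying by \<open>x\<^sup>\<beta>\<close>, using \<open>a\<^sup>k \<le> k! exp a\<close> and minimising over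
  \<open>t = exp y\<close> produces \<open>\<beta>! exp (- \<psi>\<^sup>* \<beta>)\<close>. Conversely, the bounds defining \<open>G(\<psi>\<^sup>*)\<close> for all \<open>\<beta>\<close> add
  up to \<open>\<bar>D\<^sup>\<alpha> g x\<bar> exp (\<Sum>\<bar>x\<^sub>j\<bar> s\<^sub>j) \<le> C exp (\<phi> (2 s))\<close>. Taking \<open>s = t + 1\<close>, conditions (iii) and (ii) turn
  the right-hand side into \<open>exp (\<phi>\<^sub>\<nu>\<^sub>+\<^sub>2 t)\<close>, with \<open>exp (- \<Sum>\<bar>x\<^sub>j\<bar>)\<close> left over for integrability, so the inverse
  transform is entire and, after integrating by parts, lies in \<open>E(\<phi>\<^sub>\<nu>\<^sub>+\<^sub>2)\<close>.
\<close>

section \<open>Integrals over Euclidean space\<close>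

text \<open>Every estimate relates single steps and is linear in the norm of the argument: a bound
  \<open>P\<close> on one norm gives a bound \<open>C * P\<close> on another, with \<open>C\<close>
  independent of the function. The same inequality then yields membership in the target step and
  continuity at zero, and linearity carries continuity to the inductive limits. Moving all
  \<open>n\<close> contours simultaneously uses no iterated residues: the integral is differentiated
  with respect to the height of the contour. The constant \<open>(2 * pi) ^ n\<close> of the
  inversion formula appears as the square of the mass of a Gaussian. It is never evaluated, since
  positivity is enough to divide by it; the Gaussian's own transform is another instance of the
  contour shift. A recurring obstacle is that the conjugate takes values in \<open>ereal\<close>
  while the norms use \<open>real_of_ereal\<close>, so finiteness has to be established before the
  conjugate can be bounded in either direction. The weight \<open>decay\<close> is the fixed
  integrable majorant for all integrals over \<open>\<real>\<^sup>n\<close>.\<close>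

definition decay :: "'a::euclidean_space \<Rightarrow> real" where
  "decay x = 1 / (1 + norm x) ^ (2 * DIM('a))"

lemma decay_pos: "0 < decay x"
  by (auto simp: decay_def add_pos_nonneg)

lemma borel_measurable_decay [measurable]: "decay \<in> borel_measurable borel"
  unfolding decay_def[abs_def] by measurable

text \<open>The inequality \<open>1 + norm x \<le> (1 + norm a) * (1 + norm (x + a))\<close> makes a
  translation cost only a constant factor, so bounds that are uniform over nearby translates remain
  multiples of \<open>decay\<close>.\<close>

lemma decay_shift: "decay (x + a) \<le> (1 + norm a) ^ (2 * DIM('a)) * decay (x :: 'a::euclidean_space)"
proof -
  have "norm x \<le> norm (x + a) + norm a"
    by (metis add_diff_cancel norm_triangle_ineq4)
  moreover have "0 \<le> norm (x + a) * norm a" by simp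
  ultimately have "1 + norm x \<le> (1 + norm a) * (1 + norm (x + a))"
    unfolding distrib_left distrib_right mult_1 mult_1_right mult.commute[of "norm a"] by linarith
  then have "(1 + norm x) ^ (2 * DIM('a)) \<le> (1 + norm a) ^ (2 * DIM('a)) * (1 + norm (x + a)) ^ (2 * DIM('a))"
    unfolding power_mult_distrib[symmetric] by (rule power_mono) simp
  moreover have "0 < (1 + norm x) ^ (2 * DIM('a))" "0 < (1 + norm (x + a)) ^ (2 * DIM('a))"
    by (simp_all add: add_pos_nonneg)
  ultimately show ?thesis
    by (simp add: decay_def pos_divide_le_eq pos_le_divide_eq)
qed

lemma nn_integral_inverse_one_plus_square_finite:
  "(\<integral>\<^sup>+x. ennreal (1 / (1 + x\<^sup>2)) \<partial>lborel) < \<infinity>"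
proof -
  have half: "(\<integral>\<^sup>+x. ennreal (1 / (1 + x\<^sup>2)) * indicator {0..} x \<partial>lborel) = ennreal (pi / 2 - arctan 0)"
  proof (rule nn_integral_FTC_atLeast)
    show "DERIV arctan x :> 1 / (1 + x\<^sup>2)" for x
      using DERIV_arctan[of x] by (simp add: inverse_eq_divide)
  qed (auto intro: tendsto_arctan_at_top)
  have "(\<integral>\<^sup>+x. ennreal (1 / (1 + x\<^sup>2)) * indicator {..0} x \<partial>lborel)
      = (\<integral>\<^sup>+x. ennreal (1 / (1 + x\<^sup>2)) * indicator {0..} x \<partial>lborel)"
    by (subst lborel_distr_uminus[symmetric], subst nn_integral_distr)
       (auto intro!: nn_integral_cong simp: indicator_def)
  then have *: "(\<integral>\<^sup>+x. ennreal (1 / (1 + x\<^sup>2)) * indicator {..0} x \<partial>lborel) = ennreal (pi / 2)"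
    using half by simp
  \<comment> \<open>The point 0 lies in both half-lines, hence an inequality instead of an
    equation.\<close>
  have "(\<integral>\<^sup>+x. ennreal (1 / (1 + x\<^sup>2)) \<partial>lborel)
      \<le> (\<integral>\<^sup>+x. ennreal (1 / (1 + x\<^sup>2)) * indicator {0..} x + ennreal (1 / (1 + x\<^sup>2)) * indicator {..0} x \<partial>lborel)"
    by (intro nn_integral_mono) (auto simp: indicator_def)
  also have "\<dots> = ennreal (pi / 2) + ennreal (pi / 2)"
    using half * by (subst nn_integral_add) auto
  also have "\<dots> < \<infinity>" by simp
  finally show ?thesis .
qed

text \<open>Each of the \<open>DIM('a)\<close> factors \<open>(1 + norm x)\<^sup>2\<close> of the
  denominator dominates one factor \<open>1 + (x \<bullet> b)\<^sup>2\<close>, so the integral is at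
  most a product of one-variable arctan integrals. This is the origin of the exponent
  \<open>2 * DIM('a)\<close> in \<open>decay\<close>.\<close>

lemma integrable_decay: "integrable lborel (decay :: 'a::euclidean_space \<Rightarrow> real)"
proof (rule integrableI_nonneg)
  have "ennreal (decay x) \<le> (\<Prod>b\<in>Basis. ennreal (1 / (1 + (x \<bullet> b)\<^sup>2)))" for x :: 'a
  proof -
    have "(\<Prod>b\<in>(Basis::'a set). 1 + (x \<bullet> b)\<^sup>2) \<le> (\<Prod>b\<in>(Basis::'a set). (1 + norm x)\<^sup>2)"
    proof (intro prod_mono conjI)
      fix b :: 'a assume "b \<in> Basis"
      then have "(x \<bullet> b)\<^sup>2 \<le> (norm x)\<^sup>2"
        using Basis_le_norm[of b x] by (simp add: abs_le_square_iff[symmetric])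
      also have "\<dots> + 1 \<le> (1 + norm x)\<^sup>2"
        by (simp add: power2_eq_square algebra_simps)
      finally show "1 + (x \<bullet> b)\<^sup>2 \<le> (1 + norm x)\<^sup>2" by simp
    qed auto
    moreover have "0 < (\<Prod>b\<in>(Basis::'a set). 1 + (x \<bullet> b)\<^sup>2)"
      by (intro prod_pos) (auto simp: add_pos_nonneg)
    ultimately have "decay x \<le> 1 / (\<Prod>b\<in>(Basis::'a set). 1 + (x \<bullet> b)\<^sup>2)"
      unfolding decay_def by (intro divide_left_mono mult_pos_pos)
        (auto simp: power_mult add_pos_nonneg)
    also have "\<dots> = (\<Prod>b\<in>(Basis::'a set). 1 / (1 + (x \<bullet> b)\<^sup>2))"
      by (simp add: prod_dividef)
    finally show ?thesis by (subst prod_ennreal) (auto intro: ennreal_leI)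
  qed
  then have "(\<integral>\<^sup>+x. ennreal (decay (x::'a)) \<partial>lborel)
      \<le> (\<integral>\<^sup>+(x::'a). (\<Prod>b\<in>Basis. ennreal (1 / (1 + (x \<bullet> b)\<^sup>2))) \<partial>lborel)"
    by (rule nn_integral_mono)
  also have "\<dots> = (\<Prod>b\<in>(Basis::'a set). \<integral>\<^sup>+x. ennreal (1 / (1 + x\<^sup>2)) \<partial>lborel)"
    by (rule nn_integral_lborel_prod) auto
  also have "\<dots> < \<infinity>"
    using nn_integral_inverse_one_plus_square_finite
    by (auto simp: ennreal_prod_eq_top less_top power_less_top_ennreal)
  finally show "(\<integral>\<^sup>+x. ennreal (decay (x::'a)) \<partial>lborel) < \<infinity>" .
qed (auto intro: less_imp_le decay_pos)

lemma integrable_decay_bound: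
  fixes f :: "'a::euclidean_space \<Rightarrow> 'b::{banach, second_countable_topology}"
  assumes "f \<in> borel_measurable borel" and "\<And>x. norm (f x) \<le> C * decay x"
  shows "integrable lborel f"
  by (rule Bochner_Integration.integrable_bound[where f = "\<lambda>x. C * decay x"])
     (use assms in \<open>auto intro!: integrable_decay always_eventually simp: abs_of_nonneg order_trans[OF assms(2)]
        intro: order_trans[OF _ abs_ge_self]\<close>)

text \<open>The Bochner integral of a non-integrable function is 0, so the bound holds without any
  measurability of \<open>f\<close>.\<close>

lemma integral_decay_bound:
  fixes f :: "'a::euclidean_space \<Rightarrow> 'b::{banach, second_countable_topology}"
  assumes "\<And>x. norm (f x) \<le> C * decay x"
  shows "norm (integral\<^sup>L lborel f) \<le> C * integral\<^sup>L lborel (decay :: 'a \<Rightarrow> real)"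
proof -
  have "norm (integral\<^sup>L lborel f) \<le> (\<integral>x. norm (f x) \<partial>lborel)"
    by (rule integral_norm_bound)
  also have "\<dots> \<le> (\<integral>x. C * decay (x :: 'a) \<partial>lborel)"
    by (rule integral_mono') (use assms in \<open>auto intro!: integrable_decay intro: order_trans[OF norm_ge_zero]\<close>)
  finally show ?thesis by simp
qed

lemma power_div_fact_le_exp:
  assumes "0 \<le> (x::real)"
  shows "x ^ k / fact k \<le> exp x"
proof -
  have "(\<Sum>n\<in>{k}. x ^ n /\<^sub>R fact n) \<le> (\<Sum>n. x ^ n /\<^sub>R fact n)"
    by (rule sum_le_suminf) (use assms summable_exp_generic[of x] in auto)
  then show ?thesis by (simp add: exp_def field_simps)
qed

text \<open>The constant \<open>exp 1 * fact k\<close> is read off the term of order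
  \<open>k\<close> of the exponential series at \<open>1 + norm x\<close>.\<close>

lemma exp_neg_norm_le_decay:
  "\<exists>C>0. \<forall>x :: 'a::euclidean_space. exp (- norm x) \<le> C * decay x"
proof (intro exI conjI allI)
  define k where "k = 2 * DIM('a)"
  show "0 < exp 1 * (fact k :: real)" by simp
  fix x :: 'a
  have "(1 + norm x) ^ k / fact k \<le> exp (1 + norm x)"
    by (rule power_div_fact_le_exp) simp
  moreover have "0 < (1 + norm x) ^ k"
    by (simp add: add_pos_nonneg)
  ultimately show "exp (- norm x) \<le> exp 1 * fact k * decay x"
    unfolding decay_def k_def[symmetric] by (simp add: field_simps exp_add exp_minus)
qed

section \<open>Differentiation under the integral sign\<close>

lemma has_vector_derivative_iff_quotient:
  "(f has_vector_derivative D) (at a) \<longleftrightarrow> ((\<lambda>t. (f (a + t) - f a) /\<^sub>R t) \<longlongrightarrow> D) (at 0)"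
proof -
  have "(f has_vector_derivative D) (at a) \<longleftrightarrow>
      ((\<lambda>h. norm (f (a + h) - f a - h *\<^sub>R D) / norm h) \<longlongrightarrow> 0) (at 0)"
    by (simp add: has_vector_derivative_def has_derivative_at bounded_linear_scaleR_left)
  also have "\<dots> \<longleftrightarrow> ((\<lambda>h. norm ((f (a + h) - f a) /\<^sub>R h - D)) \<longlongrightarrow> 0) (at 0)"
  proof (rule Lim_cong_within)
    fix h :: real assume "h \<noteq> 0"
    then have "(f (a + h) - f a) /\<^sub>R h - D = (f (a + h) - f a - h *\<^sub>R D) /\<^sub>R h"
      by (simp add: scaleR_diff_right)
    then show "norm (f (a + h) - f a - h *\<^sub>R D) / norm h = norm ((f (a + h) - f a) /\<^sub>R h - D)"
      by (simp add: divide_inverse mult.commute)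
  qed auto
  finally show ?thesis
    by (simp add: tendsto_norm_zero_iff LIM_zero_iff)
qed

text \<open>Dominated convergence is applied to the difference quotients along sequences.
  Measurability of \<open>G' 0\<close> comes out as a consequence, so a derivative known only
  through a pointwise formula can be used directly.\<close>

lemma has_vector_derivative_integral:
  fixes G :: "real \<Rightarrow> 'a \<Rightarrow> complex"
  assumes d: "0 < d"
    and int: "\<And>t. \<bar>t\<bar> < d \<Longrightarrow> integrable M (G t)"
    and deriv: "\<And>x t. \<bar>t\<bar> < d \<Longrightarrow> ((\<lambda>t. G t x) has_vector_derivative G' t x) (at t)"
    and bound: "\<And>x t. \<bar>t\<bar> < d \<Longrightarrow> cmod (G' t x) \<le> B x"
    and B: "integrable M B"
  shows "((\<lambda>t. integral\<^sup>L M (G t)) has_vector_derivative integral\<^sup>L M (G' 0)) (at 0)"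
    and "integrable M (G' 0)"
proof -
  have main: "(\<lambda>n. (integral\<^sup>L M (G (X n)) - integral\<^sup>L M (G 0)) /\<^sub>R X n) \<longlonglongrightarrow> integral\<^sup>L M (G' 0)
      \<and> integrable M (G' 0)"
    if X: "\<And>n. X n \<noteq> 0" "\<And>n. \<bar>X n\<bar> < d" "X \<longlonglongrightarrow> 0" for X :: "nat \<Rightarrow> real"
  proof -
    define S where "S n x = (G (X n) x - G 0 x) /\<^sub>R X n" for n x
    have int_S: "integrable M (S n)" for n
      unfolding S_def using int X(2) d by (intro integrable_scaleR_right Bochner_Integration.integrable_diff) auto
    have lim: "(\<lambda>n. S n x) \<longlonglongrightarrow> G' 0 x" for x
    proof -
      have "((\<lambda>t. (G t x - G 0 x) /\<^sub>R t) \<longlongrightarrow> G' 0 x) (at 0)"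
        using deriv[of 0 x] d by (simp add: has_vector_derivative_iff_quotient)
      then show ?thesis
        unfolding tendsto_at_iff_sequentially S_def using X by (auto simp: o_def)
    qed
    have le: "cmod (S n x) \<le> B x" for n x
    proof -
      \<comment> \<open>The mean value inequality on the interval converts the bound on the
        derivative into a bound on the difference quotients, uniform in \<open>n\<close>.\<close>
      have "cmod (G (X n) x - G 0 x) \<le> B x * norm (X n - 0)"
      proof (rule differentiable_bound[where S = "{-d<..<d}" and f' = "\<lambda>t h. h *\<^sub>R G' t x"])
        fix t assume "t \<in> {-d<..<d}"
        then have t: "\<bar>t\<bar> < d" by auto
        show "((\<lambda>t. G t x) has_derivative (\<lambda>h. h *\<^sub>R G' t x)) (at t within {-d<..<d})"
          using deriv[OF t] by (auto simp: has_vector_derivative_def intro: has_derivative_at_withinI)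
        show "onorm (\<lambda>h. h *\<^sub>R G' t x) \<le> B x"
          using bound[OF t, of x] by (intro onorm_le) (simp add: mult.commute[of "B x"] mult_left_mono)
      qed (use X(2)[of n] d in \<open>auto simp: abs_less_iff\<close>)
      then show ?thesis using X(1)[of n] by (simp add: S_def divide_inverse[symmetric] mult.commute[of "inverse _"] pos_divide_le_eq)
    qed
    have [measurable]: "G' 0 \<in> borel_measurable M"
      by (rule borel_measurable_LIMSEQ_metric[OF _ lim]) (use int_S in auto)
    have "integrable M (G' 0)"
      by (rule integrable_dominated_convergence[of "G' 0" M S B]) (use int_S B le lim in auto)
    moreover have "(\<lambda>n. integral\<^sup>L M (S n)) \<longlonglongrightarrow> integral\<^sup>L M (G' 0)"
      by (rule integral_dominated_convergence[of "G' 0" M S B]) (use int_S B le lim in auto)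
    moreover have "integral\<^sup>L M (S n) = (integral\<^sup>L M (G (X n)) - integral\<^sup>L M (G 0)) /\<^sub>R X n" for n
      unfolding S_def using int X(2) d by simp
    ultimately show ?thesis by simp
  qed
  \<comment> \<open>Some admissible sequence has to be exhibited to extract integrability of
    \<open>G' 0\<close>; the offset 2 makes already its first term smaller than
    \<open>d\<close>.\<close>
  have "(\<lambda>n. d * inverse (real (Suc n) + 1)) \<longlonglongrightarrow> d * 0"
    using LIMSEQ_ignore_initial_segment[OF LIMSEQ_inverse_real_of_nat, of 1] by (intro tendsto_mult tendsto_const) (simp add: add.commute)
  then have "(\<lambda>n. d / (real n + 2)) \<longlonglongrightarrow> 0"
    by (simp add: divide_inverse add.commute)
  then show "integrable M (G' 0)"
    using main[of "\<lambda>n. d / (real n + 2)", THEN conjunct2] d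
    by (simp add: pos_divide_less_eq mult_less_cancel_left_pos distrib_left add_pos_nonneg)
  \<comment> \<open>Restricting the filter to the open interval makes every test sequence
    admissible; at the interior point 0 the restriction does not change the limit.\<close>
  have "((\<lambda>t. (integral\<^sup>L M (G t) - integral\<^sup>L M (G 0)) /\<^sub>R t) \<longlongrightarrow> integral\<^sup>L M (G' 0)) (at 0 within {-d<..<d})"
    unfolding tendsto_at_iff_sequentially
  proof (intro allI impI)
    fix X assume X: "\<forall>i. X i \<in> {-d<..<d} - {0}" "X \<longlonglongrightarrow> 0"
    have "X i \<in> {-d<..<d} - {0}" for i
      using X(1) by blast
    then have "X i \<noteq> 0" "\<bar>X i\<bar> < d" for i
      by (auto simp: abs_less_iff minus_less_iff)
    from main[OF this X(2)]
    show "((\<lambda>t. (integral\<^sup>L M (G t) - integral\<^sup>L M (G 0)) /\<^sub>R t) \<circ> X) \<longlonglongrightarrow> integral\<^sup>L M (G' 0)"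
      by (simp add: o_def)
  qed
  then show "((\<lambda>t. integral\<^sup>L M (G t)) has_vector_derivative integral\<^sup>L M (G' 0)) (at 0)"
    using d by (simp add: has_vector_derivative_iff_quotient at_within_open[of 0 "{-d<..<d}"])
qed

section \<open>Translations, reflections and dilations of integrals\<close>

lemma lborel_distr_translate: "distr lborel borel (\<lambda>x. x + a) = (lborel :: 'a::euclidean_space measure)"
  using lborel_affine[of 1 a] by (simp add: density_1 add.commute)

lemma lborel_distr_reflect: "distr lborel borel uminus = (lborel :: 'a::euclidean_space measure)"
  using lborel_affine[of "-1" "0 :: 'a"] by (simp add: density_1)

lemma integral_translate:
  fixes f :: "'a::euclidean_space \<Rightarrow> 'b::{banach, second_countable_topology}"
  assumes "f \<in> borel_measurable borel"
  shows "(\<integral>x. f (x + a) \<partial>lborel) = integral\<^sup>L lborel f"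
  using integral_distr[of "\<lambda>x. x + a" lborel borel f] assms by (simp add: lborel_distr_translate)

lemma integrable_translate:
  fixes f :: "'a::euclidean_space \<Rightarrow> 'b::{banach, second_countable_topology}"
  assumes "integrable lborel f"
  shows "integrable lborel (\<lambda>x. f (x + a))"
  using integrable_distr[of "\<lambda>x. x + a" lborel borel f] assms by (simp add: lborel_distr_translate)

lemma integral_reflect:
  fixes f :: "'a::euclidean_space \<Rightarrow> 'b::{banach, second_countable_topology}"
  assumes "f \<in> borel_measurable borel"
  shows "(\<integral>x. f (- x) \<partial>lborel) = integral\<^sup>L lborel f"
  using integral_distr[of uminus lborel borel f] assms by (simp add: lborel_distr_reflect)

text \<open>By translation invariance the integral of \<open>h (x + t *\<^sub>R v)\<close> over
  \<open>x\<close> does not depend on \<open>t\<close>; differentiating under the integral gives the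
  claim without boundary terms. It serves both the contour shift and the integration by
  parts.\<close>

lemma integral_directional_derivative_eq_0:
  fixes h :: "'a::euclidean_space \<Rightarrow> complex"
  assumes int: "integrable lborel h"
    and deriv: "\<And>x. ((\<lambda>t. h (x + t *\<^sub>R v)) has_vector_derivative h' x) (at 0)"
    and bound: "\<And>x t. \<bar>t\<bar> < 1 \<Longrightarrow> cmod (h' (x + t *\<^sub>R v)) \<le> B x"
    and B: "integrable lborel B"
  shows "integral\<^sup>L lborel h' = 0" and "integrable lborel h'"
proof -
  \<comment> \<open>In quotient form, the derivative at 0 from the base point
    \<open>x + t *\<^sub>R v\<close> is the derivative at \<open>t\<close> from
    \<open>x\<close>.\<close>
  have *: "((\<lambda>t. h (x + t *\<^sub>R v)) has_vector_derivative h' (x + t *\<^sub>R v)) (at t)" for x t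
    using deriv[of "x + t *\<^sub>R v"]
    by (simp add: has_vector_derivative_iff_quotient algebra_simps)
  have i: "integrable lborel (\<lambda>x. h (x + t *\<^sub>R v))" for t
    using int by (rule integrable_translate)
  note D = has_vector_derivative_integral[of 1 lborel "\<lambda>t x. h (x + t *\<^sub>R v)"
      "\<lambda>t x. h' (x + t *\<^sub>R v)" B, OF zero_less_one i * bound B]
  show "integrable lborel h'" using D(2) by simp
  have "((\<lambda>t. integral\<^sup>L lborel h) has_vector_derivative integral\<^sup>L lborel h') (at 0)"
    using D(1) int by (simp add: integral_translate)
  from vector_derivative_unique_at[OF this has_vector_derivative_const]
  show "integral\<^sup>L lborel h' = 0" .
qed

lemma integral_rescale:
  fixes f :: "'a::euclidean_space \<Rightarrow> complex"
  assumes "0 < e" and "f \<in> borel_measurable borel"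
  shows "(\<integral>x. f (a + e *\<^sub>R x) \<partial>lborel) = integral\<^sup>L lborel f /\<^sub>R e ^ DIM('a)"
proof -
  have "integral\<^sup>L lborel f = (\<integral>x. f x \<partial>density (distr lborel borel (\<lambda>x. a + e *\<^sub>R x)) (\<lambda>_. \<bar>e\<bar> ^ DIM('a)))"
    using lborel_affine[of e a] assms by simp
  also have "\<dots> = (\<integral>x. \<bar>e\<bar> ^ DIM('a) *\<^sub>R f (a + e *\<^sub>R x) \<partial>lborel)"
    using assms by (subst integral_density) (auto simp: integral_distr)
  finally show ?thesis using assms by simp
qed

lemma integrable_rescale:
  fixes f :: "'a::euclidean_space \<Rightarrow> 'b::{banach, second_countable_topology}"
  assumes "e \<noteq> 0" and "integrable lborel f"
  shows "integrable lborel (\<lambda>x. f (a + e *\<^sub>R x))"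
proof -
  have "integrable (density (distr lborel borel (\<lambda>x. a + e *\<^sub>R x)) (\<lambda>_. \<bar>e\<bar> ^ DIM('a))) f"
    using lborel_affine[of e a] assms by simp
  then have "integrable lborel (\<lambda>x. \<bar>e\<bar> ^ DIM('a) *\<^sub>R f (a + e *\<^sub>R x))"
    using assms(2) by (subst (asm) integrable_density) (auto simp: integrable_distr_eq)
  from integrable_scaleR_right[OF this, of "inverse (\<bar>e\<bar> ^ DIM('a))"] show ?thesis
    using assms(1) by simp
qed

section \<open>Entire functions on strips\<close>

definition cpoint :: "real ^ 'n \<Rightarrow> real ^ 'n \<Rightarrow> complex ^ 'n" where
  "cpoint \<xi> \<eta> = (\<chi> i. of_real (\<xi> $ i) + \<i> * of_real (\<eta> $ i))"

text \<open>Bilinear, without conjugation: it is complex linear in \<open>z\<close>, so that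
  \<open>exp (- \<i> * cdot x z)\<close> is entire.\<close>

definition cdot :: "real ^ 'n \<Rightarrow> complex ^ 'n \<Rightarrow> complex" where
  "cdot x z = (\<Sum>i\<in>UNIV. of_real (x $ i) * z $ i)"

text \<open>Decay uniform over each bounded tube around the real points, with a constant depending
  on the radius. It passes to complex derivatives and makes every horizontal slice integrable, as
  the contour shift requires.\<close>

definition strip_decay :: "(complex ^ 'n \<Rightarrow> complex) \<Rightarrow> bool" where
  "strip_decay F \<longleftrightarrow> (\<forall>R. \<exists>C. \<forall>\<xi> \<eta>. norm \<eta> \<le> R \<longrightarrow> cmod (F (cpoint \<xi> \<eta>)) \<le> C * decay \<xi>)"

lemma cpoint_Re_Im: "cpoint (\<chi> i. Re (z $ i)) (\<chi> i. Im (z $ i)) = z"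
  by (simp add: cpoint_def vec_eq_iff complex_eq_iff)

text \<open>On a complex line with real direction \<open>v\<close>, \<open>Re w\<close> moves the
  real part and \<open>Im w\<close> the imaginary part of the point. Both motions in the contour
  shift therefore live on one complex slice.\<close>

lemma cpoint_add_scale:
  "cpoint \<xi> \<eta> + w *s cpoint v 0 = cpoint (\<xi> + Re w *\<^sub>R v) (\<eta> + Im w *\<^sub>R v)"
  by (simp add: cpoint_def vec_eq_iff complex_eq_iff)

lemma continuous_on_cpoint [continuous_intros]:
  assumes "continuous_on S f" "continuous_on S g"
  shows "continuous_on S (\<lambda>x. cpoint (f x) (g x))"
  unfolding cpoint_def by (intro continuous_intros assms)

lemma cdot_cpoint: "cdot x (cpoint \<xi> \<eta>) = of_real (x \<bullet> \<xi>) + \<i> * of_real (x \<bullet> \<eta>)"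
  by (simp add: cdot_def cpoint_def inner_vec_def distrib_left sum.distrib sum_distrib_left mult.left_commute)

lemma entireI:
  assumes "\<And>z. (f has_derivative D z) (at z)" "\<And>z c v. D z (c *s v) = c * D z v"
  shows "entire f"
  using assms unfolding entire_def by blast

lemma entire_obtain_derivative:
  assumes "entire f"
  obtains D where "\<And>z. (f has_derivative D z) (at z)" "\<And>z c v. D z (c *s v) = c * D z v"
  using assms unfolding entire_def by metis

lemma entire_const: "entire (\<lambda>_. c)"
  by (rule entireI[where D = "\<lambda>_ _. 0"]) auto

lemma entire_component: "entire (\<lambda>z. z $ i)"
  by (rule entireI[where D = "\<lambda>_ v. v $ i"])
     (auto intro!: bounded_linear_imp_has_derivative bounded_linear_vec_nth)

lemma entire_add:
  assumes "entire f" "entire g"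
  shows "entire (\<lambda>z. f z + g z)"
proof -
  obtain D where D: "\<And>z. (f has_derivative D z) (at z)" "\<And>z c v. D z (c *s v) = c * D z v"
    using assms(1) by (rule entire_obtain_derivative) blast
  obtain E where E: "\<And>z. (g has_derivative E z) (at z)" "\<And>z c v. E z (c *s v) = c * E z v"
    using assms(2) by (rule entire_obtain_derivative) blast
  show ?thesis
    by (rule entireI[where D = "\<lambda>z v. D z v + E z v"])
       (auto intro!: has_derivative_add D(1) E(1) simp: D(2) E(2) distrib_left)
qed

lemma entire_mult:
  assumes "entire f" "entire g"
  shows "entire (\<lambda>z. f z * g z)"
proof -
  obtain D where D: "\<And>z. (f has_derivative D z) (at z)" "\<And>z c v. D z (c *s v) = c * D z v"
    using assms(1) by (rule entire_obtain_derivative) blast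
  obtain E where E: "\<And>z. (g has_derivative E z) (at z)" "\<And>z c v. E z (c *s v) = c * E z v"
    using assms(2) by (rule entire_obtain_derivative) blast
  show ?thesis
    by (rule entireI[where D = "\<lambda>z v. f z * E z v + D z v * g z"])
       ((rule has_derivative_mult D(1) E(1))+, simp add: D(2) E(2) algebra_simps)
qed

lemma entire_exp:
  assumes "entire f"
  shows "entire (\<lambda>z. exp (f z))"
proof -
  obtain D where D: "\<And>z. (f has_derivative D z) (at z)" "\<And>z c v. D z (c *s v) = c * D z v"
    using assms(1) by (rule entire_obtain_derivative) blast
  have "((\<lambda>z. exp (f z)) has_derivative (\<lambda>v. exp (f z) * D z v)) (at z)" for z
    using has_derivative_compose[OF D(1) DERIV_exp[unfolded has_field_derivative_def]] by simp
  then show ?thesis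
    by (rule entireI) (simp add: D(2) mult.left_commute)
qed

lemma entire_sum: "(\<And>i. i \<in> I \<Longrightarrow> entire (f i)) \<Longrightarrow> entire (\<lambda>z. \<Sum>i\<in>I. f i z)"
  by (induction I rule: infinite_finite_induct) (auto intro: entire_const entire_add)

lemma entire_cdot: "entire (cdot x)"
  unfolding cdot_def[abs_def] by (intro entire_sum entire_mult entire_const entire_component)

lemma entire_continuous: "entire f \<Longrightarrow> continuous_on UNIV f"
  by (metis continuous_at_imp_continuous_on entire_def has_derivative_continuous)

lemma entire_cpoint_continuous:
  assumes "entire f"
  shows "continuous_on UNIV (\<lambda>\<xi>. f (cpoint \<xi> \<eta>))"
  by (rule continuous_on_compose2[OF entire_continuous[OF assms]]) (auto intro!: continuous_intros)

lemma entire_cpoint_measurable: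
  assumes "entire f"
  shows "(\<lambda>\<xi>. f (cpoint \<xi> \<eta>)) \<in> borel_measurable borel"
  by (intro borel_measurable_continuous_onI entire_cpoint_continuous assms)

section \<open>Complex slices and the contour shift\<close>

definition cderiv :: "(complex ^ 'n \<Rightarrow> complex) \<Rightarrow> complex ^ 'n \<Rightarrow> complex ^ 'n \<Rightarrow> complex" where
  "cderiv f b z = deriv (\<lambda>w. f (z + w *s b)) 0"

text \<open>Complex homogeneity of the real derivative upgrades it to a complex derivative along
  every line. One-variable theory on such slices then replaces several-variable function
  theory.\<close>

lemma has_field_derivative_slice:
  assumes "entire f"
  shows "((\<lambda>w. f (z + w *s b)) has_field_derivative cderiv f b (z + w *s b)) (at w)"
proof -
  obtain D where D: "\<And>z. (f has_derivative D z) (at z)" "\<And>z c v. D z (c *s v) = c * D z v"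
    using assms by (rule entire_obtain_derivative) blast
  have *: "((\<lambda>w. f (z + w *s b)) has_field_derivative D (z + w *s b) b) (at w)" for z w
  proof -
    have "bounded_linear (\<lambda>w::complex. w *s b)"
      by (rule linear_conv_bounded_linear[THEN iffD1])
         (auto intro!: linearI simp: vec_eq_iff distrib_right)
    then have "((\<lambda>w. z + w *s b) has_derivative (\<lambda>w. w *s b)) (at w)"
      by (auto intro!: derivative_eq_intros bounded_linear_imp_has_derivative)
    from has_derivative_compose[OF this D(1)] show ?thesis
      by (simp add: has_field_derivative_def D(2) mult_commute_abs)
  qed
  have "cderiv f b (z + w *s b) = D (z + w *s b) b"
    unfolding cderiv_def using *[of "z + w *s b" 0] by (auto intro!: DERIV_imp_deriv)
  with * show ?thesis by simp
qed

text \<open>The cases of interest are \<open>c = 1\<close> and \<open>c = \<i>\<close>: derivatives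
  in the real and the imaginary direction differ by the factor \<open>\<i>\<close> only, which is
  the form of the Cauchy-Riemann equations behind the contour shift.\<close>

lemma has_vector_derivative_slice:
  assumes "entire f"
  shows "((\<lambda>t. f (z + (of_real t * c) *s b)) has_vector_derivative c * cderiv f b (z + (of_real t * c) *s b)) (at t)"
proof -
  have "((\<lambda>t. of_real t * c) has_vector_derivative c) (at t)"
    by (auto intro!: derivative_eq_intros simp: has_vector_derivative_def scaleR_conv_of_real)
  from field_vector_diff_chain_at[OF this has_field_derivative_slice[OF assms]]
  show ?thesis by (simp add: o_def)
qed

lemma slice_holomorphic: "entire f \<Longrightarrow> (\<lambda>w. f (z + w *s b)) holomorphic_on S"
  unfolding holomorphic_on_def field_differentiable_def
  by (blast intro: has_field_derivative_at_within has_field_derivative_slice)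

lemma strip_decay_integrable:
  assumes "entire F" "strip_decay F"
  shows "integrable lborel (\<lambda>\<xi>. F (cpoint \<xi> \<eta>))"
  using assms(2) integrable_decay_bound[OF entire_cpoint_measurable[OF assms(1)]]
  unfolding strip_decay_def by (metis order_refl)

text \<open>\<open>\<bar>C\<bar>\<close> appears because a constant obtained from
  \<open>strip_decay\<close> comes with no information on its sign. The right-hand side no longer
  depends on \<open>s\<close>.\<close>

lemma decay_shift_scaled:
  fixes \<xi> v :: "'a::euclidean_space"
  assumes "\<bar>s\<bar> \<le> 1"
  shows "C * decay (\<xi> + s *\<^sub>R v) \<le> \<bar>C\<bar> * (1 + norm v) ^ (2 * DIM('a)) * decay \<xi>"
proof -
  have "C * decay (\<xi> + s *\<^sub>R v) \<le> \<bar>C\<bar> * decay (\<xi> + s *\<^sub>R v)"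
    by (rule mult_right_mono) (auto intro: less_imp_le[OF decay_pos])
  also have "\<dots> \<le> \<bar>C\<bar> * ((1 + norm (s *\<^sub>R v)) ^ (2 * DIM('a)) * decay \<xi>)"
    by (intro mult_left_mono decay_shift) auto
  also have "\<dots> \<le> \<bar>C\<bar> * ((1 + norm v) ^ (2 * DIM('a)) * decay \<xi>)"
    using assms by (intro mult_left_mono mult_right_mono power_mono less_imp_le[OF decay_pos])
      (auto simp: mult_left_le_one_le)
  finally show ?thesis by (simp add: mult.assoc)
qed

text \<open>Cauchy's estimate on the unit circle of the complex line in direction \<open>v\<close>.
  The imaginary part moves by at most \<open>norm v\<close>, so the tube is enlarged by that radius;
  the real part moves as much, which \<open>decay_shift_scaled\<close> absorbs into the
  constant.\<close>

lemma strip_decay_cderiv: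
  fixes F :: "complex ^ 'n \<Rightarrow> complex"
  assumes F: "entire F" "strip_decay F"
  shows "strip_decay (cderiv F (cpoint v 0))"
  unfolding strip_decay_def
proof
  fix R
  obtain C where C: "\<And>\<xi> \<eta>. norm \<eta> \<le> R + norm v \<Longrightarrow> cmod (F (cpoint \<xi> \<eta>)) \<le> C * decay \<xi>"
    using F(2) unfolding strip_decay_def by blast
  show "\<exists>C. \<forall>\<xi> \<eta>. norm \<eta> \<le> R \<longrightarrow> cmod (cderiv F (cpoint v 0) (cpoint \<xi> \<eta>)) \<le> C * decay \<xi>"
  proof (intro exI allI impI)
    fix \<xi> \<eta> :: "real ^ 'n" assume \<eta>: "norm \<eta> \<le> R"
    let ?B = "\<bar>C\<bar> * (1 + norm v) ^ (2 * DIM(real ^ 'n)) * decay \<xi>"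
    let ?g = "\<lambda>w. F (cpoint \<xi> \<eta> + w *s cpoint v 0)"
    have "cmod ((deriv ^^ 1) ?g 0) \<le> fact 1 * ?B / 1 ^ 1"
    proof (rule Cauchy_inequality)
      fix w :: complex assume "cmod (0 - w) = 1"
      then have w: "\<bar>Re w\<bar> \<le> 1" "\<bar>Im w\<bar> \<le> 1"
        using abs_Re_le_cmod[of w] abs_Im_le_cmod[of w] by auto
      have "norm (\<eta> + Im w *\<^sub>R v) \<le> norm \<eta> + \<bar>Im w\<bar> * norm v"
        by (metis norm_scaleR norm_triangle_ineq)
      also have "\<dots> \<le> R + norm v"
        using \<eta> w by (intro add_mono mult_left_le_one_le) auto
      finally have "cmod (?g w) \<le> C * decay (\<xi> + Re w *\<^sub>R v)"
        unfolding cpoint_add_scale by (rule C)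
      also have "\<dots> \<le> ?B"
        using w by (intro decay_shift_scaled)
      finally show "cmod (?g w) \<le> ?B" .
    qed (auto intro!: slice_holomorphic F holomorphic_on_imp_continuous_on)
    then show "cmod (cderiv F (cpoint v 0) (cpoint \<xi> \<eta>))
        \<le> \<bar>C\<bar> * (1 + norm v) ^ (2 * DIM(real ^ 'n)) * decay \<xi>"
      by (simp add: cderiv_def)
  qed
qed

text \<open>Differentiating the integral along the imaginary direction \<open>v\<close> gives \<open>\<i>\<close> times the integral of
  the derivative along the real direction \<open>v\<close>, which vanishes by translation invariance.\<close>

lemma integral_strip_shift:
  fixes F :: "complex ^ 'n \<Rightarrow> complex"
  assumes F: "entire F" "strip_decay F"
  shows "(\<integral>\<xi>. F (cpoint \<xi> v) \<partial>lborel) = (\<integral>\<xi>. F (cpoint \<xi> 0) \<partial>lborel)"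
proof -
  let ?dF = "cderiv F (cpoint v 0)"
  define j where "j t = (\<integral>\<xi>. F (cpoint \<xi> (t *\<^sub>R v)) \<partial>lborel)" for t
  have "(j has_vector_derivative 0) (at t)" for t
  proof -
    \<comment> \<open>The radius \<open>(\<bar>t\<bar> + 1) * norm v\<close> covers all shifts with
      \<open>\<bar>s\<bar> < 1\<close>, so one constant \<open>C\<close> dominates the whole
      family.\<close>
    have t: "norm ((t + s) *\<^sub>R v) \<le> (\<bar>t\<bar> + 1) * norm v" if "\<bar>s\<bar> < 1" for s
      using that by (auto intro!: mult_right_mono)
    obtain C where C: "\<And>\<xi> \<eta>. norm \<eta> \<le> (\<bar>t\<bar> + 1) * norm v \<Longrightarrow> cmod (?dF (cpoint \<xi> \<eta>)) \<le> C * decay \<xi>"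
      using strip_decay_cderiv[OF F, of v] unfolding strip_decay_def by blast
    have "integral\<^sup>L lborel (\<lambda>\<xi>. ?dF (cpoint \<xi> (t *\<^sub>R v))) = 0"
    proof (rule integral_directional_derivative_eq_0(1))
      show "integrable lborel (\<lambda>\<xi>. F (cpoint \<xi> (t *\<^sub>R v)))"
        by (rule strip_decay_integrable[OF F])
      fix \<xi> :: "real ^ 'n"
      show "((\<lambda>s. F (cpoint (\<xi> + s *\<^sub>R v) (t *\<^sub>R v))) has_vector_derivative ?dF (cpoint \<xi> (t *\<^sub>R v))) (at 0)"
        using has_vector_derivative_slice[OF F(1), of "cpoint \<xi> (t *\<^sub>R v)" 1 "cpoint v 0" 0]
        by (simp add: cpoint_add_scale)
      show "cmod (?dF (cpoint (\<xi> + s *\<^sub>R v) (t *\<^sub>R v))) \<le> \<bar>C\<bar> * (1 + norm v) ^ (2 * DIM(real ^ 'n)) * decay \<xi>"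
        if s: "\<bar>s\<bar> < 1" for s
      proof -
        have "cmod (?dF (cpoint (\<xi> + s *\<^sub>R v) (t *\<^sub>R v))) \<le> C * decay (\<xi> + s *\<^sub>R v)"
          using C t[of 0] by simp
        also have "\<dots> \<le> \<bar>C\<bar> * (1 + norm v) ^ (2 * DIM(real ^ 'n)) * decay \<xi>"
          using s by (intro decay_shift_scaled) simp
        finally show ?thesis .
      qed
    qed (auto intro!: integrable_decay)
    moreover have "((\<lambda>s. \<integral>\<xi>. F (cpoint \<xi> ((t + s) *\<^sub>R v)) \<partial>lborel) has_vector_derivative
        (\<integral>\<xi>. \<i> * ?dF (cpoint \<xi> ((t + 0) *\<^sub>R v)) \<partial>lborel)) (at 0)"
    proof (rule has_vector_derivative_integral(1)[OF zero_less_one, where B = "\<lambda>\<xi>. C * decay \<xi>"])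
      fix \<xi> s assume s: "\<bar>s :: real\<bar> < 1"
      show "integrable lborel (\<lambda>\<xi>. F (cpoint \<xi> ((t + s) *\<^sub>R v)))"
        by (rule strip_decay_integrable[OF F])
      show "((\<lambda>s. F (cpoint \<xi> ((t + s) *\<^sub>R v))) has_vector_derivative \<i> * ?dF (cpoint \<xi> ((t + s) *\<^sub>R v))) (at s)"
        using has_vector_derivative_slice[OF F(1), of "cpoint \<xi> (t *\<^sub>R v)" \<i> "cpoint v 0" s]
        by (simp add: cpoint_add_scale scaleR_add_left)
      show "cmod (\<i> * ?dF (cpoint \<xi> ((t + s) *\<^sub>R v))) \<le> C * decay \<xi>"
        using C[OF t[OF s]] by (simp add: norm_mult)
    qed (auto intro!: integrable_decay)
    ultimately have "((\<lambda>s. j (t + s)) has_vector_derivative 0) (at 0)"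
      by (simp add: j_def)
    then show ?thesis by (simp add: has_vector_derivative_iff_quotient)
  qed
  then have "j constant_on UNIV"
    unfolding constant_on_def
    using has_vector_derivative_zero_constant[of UNIV j] by (metis UNIV_I convex_UNIV)
  then have "j 1 = j 0" by (metis UNIV_I constant_on_def)
  then show ?thesis by (simp add: j_def)
qed

section \<open>Gaussians and Fourier inversion\<close>

definition gaussian :: "complex ^ 'n \<Rightarrow> complex" where
  "gaussian z = exp (- (\<Sum>i\<in>UNIV. z $ i * z $ i) / 2)"

lemma entire_gaussian: "entire (gaussian :: complex ^ 'n \<Rightarrow> complex)"
proof -
  have "entire (\<lambda>z :: complex ^ 'n. exp (- 1 / 2 * (\<Sum>i\<in>UNIV. z $ i * z $ i)))"
    by (intro entire_exp entire_mult entire_const entire_sum entire_component)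
  moreover have "gaussian = (\<lambda>z :: complex ^ 'n. exp (- 1 / 2 * (\<Sum>i\<in>UNIV. z $ i * z $ i)))"
    by (simp add: gaussian_def fun_eq_iff)
  ultimately show ?thesis by simp
qed

lemma gaussian_cpoint:
  "gaussian (cpoint \<xi> \<eta>) = of_real (exp (- (\<xi> \<bullet> \<xi>) / 2)) * exp (- \<i> * of_real (\<eta> \<bullet> \<xi>)) * of_real (exp (\<eta> \<bullet> \<eta> / 2))"
proof -
  have "(\<Sum>i\<in>UNIV. cpoint \<xi> \<eta> $ i * cpoint \<xi> \<eta> $ i)
      = of_real (\<xi> \<bullet> \<xi>) + 2 * \<i> * of_real (\<eta> \<bullet> \<xi>) - of_real (\<eta> \<bullet> \<eta>)"
    by (simp add: cpoint_def inner_vec_def sum_distrib_left sum.distrib[symmetric] sum_subtractf[symmetric]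
        complex_eq_iff algebra_simps)
  then show ?thesis
    unfolding gaussian_def
    by (simp only: exp_of_real[symmetric] exp_add[symmetric]) (simp add: field_simps)
qed

lemma strip_decay_gaussian: "strip_decay (gaussian :: complex ^ 'n \<Rightarrow> complex)"
  unfolding strip_decay_def
proof
  fix R
  obtain C where C: "C > 0" "\<And>x :: real ^ 'n. exp (- norm x) \<le> C * decay x"
    using exp_neg_norm_le_decay by blast
  show "\<exists>C. \<forall>\<xi> \<eta> :: real ^ 'n. norm \<eta> \<le> R \<longrightarrow> cmod (gaussian (cpoint \<xi> \<eta>)) \<le> C * decay \<xi>"
  proof (intro exI allI impI)
    fix \<xi> \<eta> :: "real ^ 'n" assume \<eta>: "norm \<eta> \<le> R"
    \<comment> \<open>This square puts the quadratic exponent below a linear one and thereby reduces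
      the claim to \<open>exp_neg_norm_le_decay\<close>.\<close>
    have "0 \<le> (norm \<xi> - 1)\<^sup>2" by simp
    then have 1: "- (\<xi> \<bullet> \<xi>) / 2 \<le> 1 / 2 - norm \<xi>"
      by (simp add: power2_norm_eq_inner[symmetric] power2_eq_square algebra_simps)
    have 2: "\<eta> \<bullet> \<eta> \<le> R\<^sup>2"
      using \<eta> by (simp add: power2_norm_eq_inner[symmetric] power_mono)
    have "cmod (gaussian (cpoint \<xi> \<eta>)) = exp (- (\<xi> \<bullet> \<xi>) / 2 + \<eta> \<bullet> \<eta> / 2)"
      by (simp add: gaussian_cpoint norm_mult exp_add[symmetric] del: of_real_exp)
    also have "\<dots> \<le> exp (- norm \<xi> + (1 + R\<^sup>2) / 2)"
      using 1 2 by (simp add: field_simps)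
    also have "\<dots> = exp ((1 + R\<^sup>2) / 2) * exp (- norm \<xi>)"
      by (simp only: exp_add mult.commute)
    also have "\<dots> \<le> exp ((1 + R\<^sup>2) / 2) * (C * decay \<xi>)"
      by (intro mult_left_mono C) simp
    finally show "cmod (gaussian (cpoint \<xi> \<eta>)) \<le> (exp ((1 + R\<^sup>2) / 2) * C) * decay \<xi>"
      by (simp add: mult.assoc)
  qed
qed

definition rgauss :: "'a::euclidean_space \<Rightarrow> real" where
  "rgauss x = exp (- (x \<bullet> x) / 2)"

lemma rgauss_pos: "0 < rgauss x"
  by (simp add: rgauss_def)

lemma borel_measurable_rgauss [measurable]: "rgauss \<in> borel_measurable borel"
  unfolding rgauss_def[abs_def] by measurable

lemma gaussian_real: "gaussian (cpoint \<xi> 0) = of_real (rgauss \<xi>)"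
  by (simp add: gaussian_cpoint rgauss_def)

lemma integrable_rgauss: "integrable lborel (rgauss :: real ^ 'n \<Rightarrow> real)"
proof -
  have "integrable lborel (\<lambda>\<xi> :: real ^ 'n. complex_of_real (rgauss \<xi>))"
    using strip_decay_integrable[OF entire_gaussian strip_decay_gaussian, of 0]
    by (simp add: gaussian_real)
  then show ?thesis by (simp add: complex_of_real_integrable_eq)
qed

text \<open>On \<open>real ^ 'n\<close> this is \<open>(2 * pi)\<close> to the power
  \<open>n / 2\<close>, so its square is the usual constant of Fourier inversion.\<close>

definition gauss_mass :: "'a::euclidean_space itself \<Rightarrow> real" where
  "gauss_mass _ = (\<integral>x. rgauss (x :: 'a) \<partial>lborel)"

text \<open>A vanishing integral of a strictly positive function would make Lebesgue measure itself
  zero.\<close>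

lemma gauss_mass_pos: "0 < gauss_mass TYPE(real ^ 'n)"
proof -
  have "gauss_mass TYPE(real ^ 'n) \<noteq> 0"
  proof
    assume "gauss_mass TYPE(real ^ 'n) = 0"
    then have "AE x in lborel. rgauss (x :: real ^ 'n) = 0"
      using integral_nonneg_eq_0_iff_AE[OF integrable_rgauss[where 'n = 'n]]
      by (simp add: gauss_mass_def less_imp_le[OF rgauss_pos])
    then have "AE x in (lborel :: (real ^ 'n) measure). False"
      by (simp add: less_imp_neq[OF rgauss_pos, symmetric])
    then have "emeasure (lborel :: (real ^ 'n) measure) UNIV = 0"
      by (simp add: AE_iff_measurable[OF _ refl])
    then show False by (simp add: emeasure_lborel_UNIV)
  qed
  moreover have "0 \<le> gauss_mass TYPE(real ^ 'n)"
    unfolding gauss_mass_def by (intro integral_nonneg_AE) (simp add: less_imp_le[OF rgauss_pos])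
  ultimately show ?thesis by simp
qed

text \<open>The contour shift by \<open>w\<close> completes the square: on the shifted contour
  \<open>gaussian\<close> is the real Gaussian times
  \<open>exp (- \<i> * of_real (w \<bullet> \<xi>))\<close> times the constant
  \<open>exp (w \<bullet> w / 2)\<close>, while the integral keeps its value.\<close>

lemma rgauss_transform:
  fixes w :: "real ^ 'n"
  shows "(\<integral>\<xi>. of_real (rgauss \<xi>) * exp (- \<i> * of_real (w \<bullet> \<xi>)) \<partial>lborel) = of_real (gauss_mass TYPE(real ^ 'n) * rgauss w)"
proof -
  have "(\<integral>\<xi>. gaussian (cpoint \<xi> w) \<partial>lborel) = (\<integral>\<xi>. gaussian (cpoint \<xi> (0 :: real ^ 'n)) \<partial>lborel)"
    using integral_strip_shift[OF entire_gaussian strip_decay_gaussian, of w] .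
  then have "(\<integral>\<xi>. of_real (rgauss \<xi>) * exp (- \<i> * of_real (w \<bullet> \<xi>)) \<partial>lborel) * of_real (exp (w \<bullet> w / 2))
      = of_real (gauss_mass TYPE(real ^ 'n))"
    unfolding gaussian_real by (simp add: gaussian_cpoint rgauss_def gauss_mass_def)
  then show ?thesis
    by (simp add: rgauss_def exp_minus field_simps)
qed

lemma rgauss_transform_scaled:
  fixes v :: "real ^ 'n"
  assumes "0 < e"
  shows "(\<integral>\<xi>. of_real (rgauss (e *\<^sub>R \<xi>)) * exp (- \<i> * of_real (v \<bullet> \<xi>)) \<partial>lborel)
    = of_real (gauss_mass TYPE(real ^ 'n) * rgauss (v /\<^sub>R e)) /\<^sub>R e ^ CARD('n)"
  using integral_rescale[OF assms, of "\<lambda>\<xi>. of_real (rgauss \<xi>) * exp (- \<i> * of_real ((v /\<^sub>R e) \<bullet> \<xi>))" 0] assms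
  by (simp only: rgauss_transform) (simp add: mult.assoc[symmetric, of "\<i>"] mult.assoc[symmetric, of "of_real e"])

text \<open>The iterated integral need not converge absolutely as a double integral, so the factor
  \<open>rgauss (e n *\<^sub>R \<xi>)\<close> is inserted. Fubini then applies, the inner integral
  becomes a Gaussian kernel concentrating at \<open>x\<close>, and dominated convergence evaluates
  the limit on both sides.\<close>

lemma fourier_inversion:
  fixes u :: "real ^ 'n \<Rightarrow> complex"
  assumes cont: "continuous_on UNIV u" and bound: "\<And>x. cmod (u x) \<le> M"
    and int: "integrable lborel u"
    and int_hat: "integrable lborel (\<lambda>\<xi>. \<integral>y. u y * exp (- \<i> * of_real (y \<bullet> \<xi>)) \<partial>lborel)"
  shows "(\<integral>\<xi>. (\<integral>y. u y * exp (- \<i> * of_real (y \<bullet> \<xi>)) \<partial>lborel) * exp (\<i> * of_real (x \<bullet> \<xi>)) \<partial>lborel)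
    = of_real ((gauss_mass TYPE(real ^ 'n))\<^sup>2) * u x"
proof -
  define U where "U \<xi> = (\<integral>y. u y * exp (- \<i> * of_real (y \<bullet> \<xi>)) \<partial>lborel)" for \<xi>
  define c where "c = gauss_mass TYPE(real ^ 'n)"
  define e where "e n = inverse (real (Suc n))" for n
  have e: "0 < e n" for n by (simp add: e_def)
  have e_lim: "e \<longlonglongrightarrow> 0" unfolding e_def by (rule LIMSEQ_inverse_real_of_nat)
  have [measurable]: "u \<in> borel_measurable borel"
    using cont by (rule borel_measurable_continuous_onI)
  have int_U: "integrable lborel U" using int_hat by (simp add: U_def[abs_def])
  then have [measurable]: "U \<in> borel_measurable borel" by auto
  have rgauss_le_1: "rgauss y \<le> 1" for y :: "real ^ 'n" by (simp add: rgauss_def)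
  have rgauss_0: "rgauss (0 :: real ^ 'n) = 1" by (simp add: rgauss_def)
  have rgauss_cont: "isCont rgauss (y :: real ^ 'n)" for y
    unfolding rgauss_def[abs_def] by (intro continuous_intros) simp
  define J where "J n = (\<integral>\<xi>. U \<xi> * exp (\<i> * of_real (x \<bullet> \<xi>)) * of_real (rgauss (e n *\<^sub>R \<xi>)) \<partial>lborel)" for n
  have J_lim: "J \<longlonglongrightarrow> (\<integral>\<xi>. U \<xi> * exp (\<i> * of_real (x \<bullet> \<xi>)) \<partial>lborel)"
    unfolding J_def
  proof (rule integral_dominated_convergence[where w = "\<lambda>\<xi>. cmod (U \<xi>)"])
    have "(\<lambda>n. rgauss (e n *\<^sub>R \<xi>)) \<longlonglongrightarrow> rgauss (0 *\<^sub>R \<xi>)" for \<xi> :: "real ^ 'n"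
      by (intro isCont_tendsto_compose[OF rgauss_cont] tendsto_intros e_lim)
    then have "(\<lambda>n. complex_of_real (rgauss (e n *\<^sub>R \<xi>))) \<longlonglongrightarrow> of_real 1" for \<xi> :: "real ^ 'n"
      unfolding tendsto_of_real_iff by (simp add: rgauss_0)
    from tendsto_mult[OF tendsto_const this]
    show "AE \<xi> in lborel. (\<lambda>n. U \<xi> * exp (\<i> * of_real (x \<bullet> \<xi>)) * of_real (rgauss (e n *\<^sub>R \<xi>)))
        \<longlonglongrightarrow> U \<xi> * exp (\<i> * of_real (x \<bullet> \<xi>))"
      by (intro always_eventually allI) simp
  qed (use int_U rgauss_le_1 in \<open>auto simp: norm_mult less_imp_le[OF rgauss_pos] intro!: mult_left_le\<close>)
  have J_eq: "J n = of_real c * (\<integral>w. u (x + e n *\<^sub>R w) * of_real (rgauss w) \<partial>lborel)" for n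
  proof -
    let ?f = "\<lambda>\<xi> y. u y * (of_real (rgauss (e n *\<^sub>R \<xi>)) * exp (- \<i> * of_real ((y - x) \<bullet> \<xi>)))"
    have int_g: "integrable lborel (\<lambda>\<xi> :: real ^ 'n. rgauss (e n *\<^sub>R \<xi>))"
      using integrable_rescale[OF _ integrable_rgauss, of "e n" 0] e[of n] by simp
    have 1: "J n = (\<integral>\<xi>. \<integral>y. ?f \<xi> y \<partial>lborel \<partial>lborel)"
    proof -
      have "U \<xi> * exp (\<i> * of_real (x \<bullet> \<xi>)) * of_real (rgauss (e n *\<^sub>R \<xi>)) = (\<integral>y. ?f \<xi> y \<partial>lborel)" for \<xi>
      proof -
        have *: "?f \<xi> y = u y * exp (- \<i> * of_real (y \<bullet> \<xi>)) * (exp (\<i> * of_real (x \<bullet> \<xi>)) * of_real (rgauss (e n *\<^sub>R \<xi>)))" for y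
          by (simp add: inner_diff_left algebra_simps exp_diff exp_minus divide_inverse)
        show ?thesis unfolding * U_def integral_mult_left_zero by (simp add: mult.assoc)
      qed
      then show ?thesis by (simp add: J_def)
    qed
    \<comment> \<open>With the damping, the modulus of the integrand is
      \<open>cmod (u y) * rgauss (e n *\<^sub>R \<xi>)\<close>, a product of integrable functions of
      separate variables.\<close>
    have "integrable (lborel \<Otimes>\<^sub>M lborel) (\<lambda>(\<xi>, y). ?f \<xi> y)"
    proof (rule lborel_pair.Fubini_integrable)
      show "AE \<xi> in lborel. integrable lborel (\<lambda>y. case (\<xi>, y) of (\<xi>, y) \<Rightarrow> ?f \<xi> y)"
        by (intro always_eventually allI, simp only: prod.case,
            rule Bochner_Integration.integrable_bound[OF int], measurable)
           (auto simp: norm_mult less_imp_le[OF rgauss_pos] rgauss_le_1 intro!: mult_left_le)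
      have "(\<integral>y. cmod (?f \<xi> y) \<partial>lborel) = (\<integral>y. cmod (u y) \<partial>lborel) * rgauss (e n *\<^sub>R \<xi>)" for \<xi>
        by (simp add: norm_mult less_imp_le[OF rgauss_pos])
      then show "integrable lborel (\<lambda>\<xi>. \<integral>y. cmod (case (\<xi>, y) of (\<xi>, y) \<Rightarrow> ?f \<xi> y) \<partial>lborel)"
        using int_g by simp
    qed measurable
    then have 2: "(\<integral>\<xi>. \<integral>y. ?f \<xi> y \<partial>lborel \<partial>lborel) = (\<integral>y. \<integral>\<xi>. ?f \<xi> y \<partial>lborel \<partial>lborel)"
      by (rule lborel_pair.Fubini_integral[symmetric])
    have 3: "(\<integral>\<xi>. ?f \<xi> y \<partial>lborel) = u y * of_real (c * rgauss ((y - x) /\<^sub>R e n)) /\<^sub>R e n ^ CARD('n)" for y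
      using rgauss_transform_scaled[OF e, of n "y - x"] by (simp add: c_def)
    have "J n = (\<integral>y. u y * of_real (c * rgauss ((y - x) /\<^sub>R e n)) \<partial>lborel) /\<^sub>R e n ^ CARD('n)"
      unfolding 1 2 3 by simp
    \<comment> \<open>The substitution \<open>y = x + e n *\<^sub>R w\<close> has a Jacobian that
      cancels the power of \<open>e n\<close>, leaving a fixed kernel and a moving argument.\<close>
    also have "\<dots> = (\<integral>w. u (x + e n *\<^sub>R w) * of_real (c * rgauss w) \<partial>lborel)"
      using integral_rescale[OF e[of n], of "\<lambda>y. u y * of_real (c * rgauss ((y - x) /\<^sub>R e n))" x] e[of n]
      by simp
    also have "\<dots> = (\<integral>w. of_real c * (u (x + e n *\<^sub>R w) * of_real (rgauss w)) \<partial>lborel)"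
      by (simp add: mult.left_commute)
    finally show ?thesis by simp
  qed
  \<comment> \<open>Continuity of \<open>u\<close> at \<open>x\<close> gives the pointwise limit;
    boundedness of \<open>u\<close> gives the majorant \<open>M * rgauss w\<close>.\<close>
  have lim: "(\<lambda>n. of_real c * (\<integral>w. u (x + e n *\<^sub>R w) * of_real (rgauss w) \<partial>lborel))
      \<longlonglongrightarrow> of_real c * (\<integral>w. u x * of_real (rgauss (w :: real ^ 'n)) \<partial>lborel)"
  proof (rule tendsto_mult[OF tendsto_const],
      rule integral_dominated_convergence[where w = "\<lambda>w :: real ^ 'n. M * rgauss w"])
    have "isCont u x" using cont by (simp add: continuous_on_eq_continuous_at)
    then have "(\<lambda>n. u (x + e n *\<^sub>R w)) \<longlonglongrightarrow> u x" for w
      by (rule isCont_tendsto_compose) (auto intro!: tendsto_eq_intros e_lim)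
    then show "AE w in lborel. (\<lambda>n. u (x + e n *\<^sub>R w) * of_real (rgauss w)) \<longlonglongrightarrow> u x * of_real (rgauss w)"
      by (intro always_eventually allI tendsto_mult tendsto_const)
    show "AE w in lborel. cmod (u (x + e n *\<^sub>R w) * of_real (rgauss w)) \<le> M * rgauss w" for n
      using bound by (auto simp: norm_mult less_imp_le[OF rgauss_pos] intro!: mult_right_mono)
  qed (use integrable_rgauss in auto)
  have "J \<longlonglongrightarrow> of_real c * (\<integral>w. u x * of_real (rgauss (w :: real ^ 'n)) \<partial>lborel)"
    using lim unfolding J_eq[symmetric] .
  from LIMSEQ_unique[OF J_lim this]
  have "(\<integral>\<xi>. U \<xi> * exp (\<i> * of_real (x \<bullet> \<xi>)) \<partial>lborel)
      = of_real c * (\<integral>w. u x * of_real (rgauss (w :: real ^ 'n)) \<partial>lborel)" .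
  \<comment> \<open>One factor \<open>c\<close> stems from the transform of the Gaussian, the other
    is the mass of the remaining kernel.\<close>
  also have "\<dots> = of_real (c\<^sup>2) * u x"
    by (simp add: c_def gauss_mass_def power2_eq_square)
  finally show ?thesis
    unfolding U_def c_def .
qed

section \<open>From entire functions to smooth functions\<close>

abbreviation conj_weight :: "(real ^ 'n \<Rightarrow> real) \<Rightarrow> real ^ 'n \<Rightarrow> ereal" where
  "conj_weight \<phi> \<equiv> young_fenchel (\<lambda>x. ereal (exp_weight \<phi> x))"

lemma E_norm_le_iff:
  "E_norm \<phi> k f \<le> ereal P \<longleftrightarrow>
    (\<forall>z. cmod (f z) * (1 + norm z) ^ k \<le> P * exp (\<phi> (\<chi> i. \<bar>Im (z $ i)\<bar>)))"
  by (simp add: E_norm_def SUP_le_iff pos_divide_le_eq)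

lemma E_norm_nonneg: "0 \<le> E_norm \<phi> k f"
  unfolding E_norm_def by (rule SUP_upper2[of undefined]) (auto simp: add_nonneg_nonneg)

lemma E_norm_finite:
  assumes "E_norm \<phi> k f < \<infinity>"
  obtains P where "0 \<le> P" "E_norm \<phi> k f = ereal P"
  using assms E_norm_nonneg[of \<phi> k f] by (cases "E_norm \<phi> k f") auto

lemma E_weightD:
  assumes "f \<in> E_weight \<phi>"
  shows "entire f" "E_norm \<phi> k f < \<infinity>"
  using assms by (auto simp: E_weight_def E_step_def)

lemma E_weightI:
  assumes "entire f" "\<And>k. \<exists>P. E_norm \<phi> k f \<le> ereal P"
  shows "f \<in> E_weight \<phi>"
proof -
  have "E_norm \<phi> k f < \<infinity>" for k
  proof -
    obtain P where "E_norm \<phi> k f \<le> ereal P"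
      using assms(2) by blast
    then show ?thesis by (rule order_le_less_trans) simp
  qed
  with assms(1) show ?thesis by (simp add: E_weight_def E_step_def)
qed

lemma class_A_continuous: "\<phi> \<in> class_A \<Longrightarrow> continuous_on UNIV \<phi>"
  by (simp add: class_A_def)

lemma class_A_bounded:
  assumes "\<phi> \<in> class_A"
  shows "\<exists>M. \<forall>x. norm x \<le> R \<longrightarrow> \<bar>\<phi> x\<bar> \<le> M"
proof -
  have "compact (\<phi> ` cball 0 R)"
    by (rule compact_continuous_image[OF continuous_on_subset[OF class_A_continuous[OF assms]]]) auto
  then have "bounded (\<phi> ` cball 0 R)"
    by (rule compact_imp_bounded)
  then obtain M where M: "\<forall>y\<in>\<phi> ` cball 0 R. norm y \<le> M"
    unfolding bounded_iff by (rule exE)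
  have "\<bar>\<phi> x\<bar> \<le> M" if "norm x \<le> R" for x
    using bspec[OF M imageI, of x] that by simp
  then show ?thesis by (intro exI[of _ M]) simp
qed

lemma norm_le_cpoint: "norm \<xi> \<le> norm (cpoint \<xi> \<eta>)"
proof (rule norm_le_componentwise_cart)
  show "norm (\<xi> $ i) \<le> norm (cpoint \<xi> \<eta> $ i)" for i
  proof -
    have "Re (cpoint \<xi> \<eta> $ i) = \<xi> $ i"
      by (simp add: cpoint_def)
    with abs_Re_le_cmod[of "cpoint \<xi> \<eta> $ i"] show ?thesis by simp
  qed
qed

lemma norm_vec_abs: "norm (\<chi> i. \<bar>\<eta> $ i\<bar>) = norm (\<eta> :: real ^ 'n)"
  by (simp add: norm_vec_def)

text \<open>The index \<open>2 * CARD('n)\<close> is the exponent of \<open>decay\<close> on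
  \<open>real ^ 'n\<close>: that many powers of \<open>1 + norm z\<close> buy integrability over a
  horizontal slice.\<close>

lemma E_norm_strip:
  fixes \<phi> :: "real ^ 'n \<Rightarrow> real"
  assumes "E_norm \<phi> (2 * CARD('n)) f \<le> ereal P"
  shows "cmod (f (cpoint \<xi> \<eta>)) \<le> P * exp (\<phi> (\<chi> i. \<bar>\<eta> $ i\<bar>)) * decay \<xi>"
proof -
  let ?k = "2 * CARD('n)"
  have "cmod (f (cpoint \<xi> \<eta>)) * (1 + norm \<xi>) ^ ?k \<le> cmod (f (cpoint \<xi> \<eta>)) * (1 + norm (cpoint \<xi> \<eta>)) ^ ?k"
    by (intro mult_left_mono power_mono add_left_mono norm_le_cpoint) auto
  also have "\<dots> \<le> P * exp (\<phi> (\<chi> i. \<bar>\<eta> $ i\<bar>))"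
    using assms[unfolded E_norm_le_iff, rule_format, of "cpoint \<xi> \<eta>"] by (simp add: cpoint_def)
  finally show ?thesis
    by (simp add: decay_def pos_le_divide_eq add_pos_nonneg)
qed

text \<open>On a bounded tube \<open>\<phi>\<close> is bounded, and the exponential has modulus
  \<open>exp (x \<bullet> \<eta>)\<close>, at most \<open>exp (norm x * R)\<close>.\<close>

lemma E_strip_decay:
  fixes \<phi> :: "real ^ 'n \<Rightarrow> real"
  assumes \<phi>: "\<phi> \<in> class_A" and f: "f \<in> E_weight \<phi>"
  shows "strip_decay (\<lambda>z. f z * exp (- \<i> * cdot x z))"
  unfolding strip_decay_def
proof
  fix R
  obtain P where P: "0 \<le> P" "E_norm \<phi> (2 * CARD('n)) f = ereal P"
    using E_weightD(2)[OF f] by (rule E_norm_finite)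
  obtain M where M: "\<And>x. norm x \<le> R \<Longrightarrow> \<phi> x \<le> M"
    using class_A_bounded[OF \<phi>, of R] by (meson abs_le_D1)
  show "\<exists>C. \<forall>\<xi> \<eta>. norm \<eta> \<le> R \<longrightarrow> cmod (f (cpoint \<xi> \<eta>) * exp (- \<i> * cdot x (cpoint \<xi> \<eta>))) \<le> C * decay \<xi>"
  proof (intro exI allI impI)
    fix \<xi> \<eta> :: "real ^ 'n" assume \<eta>: "norm \<eta> \<le> R"
    have "x \<bullet> \<eta> \<le> norm x * norm \<eta>" by (rule norm_cauchy_schwarz)
    also have "\<dots> \<le> norm x * R" using \<eta> by (intro mult_left_mono) auto
    finally have 1: "cmod (exp (- \<i> * cdot x (cpoint \<xi> \<eta>))) \<le> exp (norm x * R)"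
      by (simp add: cdot_cpoint)
    have "cmod (f (cpoint \<xi> \<eta>)) \<le> P * exp (\<phi> (\<chi> i. \<bar>\<eta> $ i\<bar>)) * decay \<xi>"
      by (rule E_norm_strip) (simp add: P)
    also have "\<dots> \<le> P * exp M * decay \<xi>"
      using \<eta> by (intro mult_right_mono mult_left_mono P) (auto intro!: M less_imp_le[OF decay_pos] simp: norm_vec_abs)
    finally have "cmod (f (cpoint \<xi> \<eta>)) * cmod (exp (- \<i> * cdot x (cpoint \<xi> \<eta>))) \<le> (P * exp M * decay \<xi>) * exp (norm x * R)"
      using 1 by (intro mult_mono) (auto intro!: mult_nonneg_nonneg P less_imp_le[OF decay_pos])
    then show "cmod (f (cpoint \<xi> \<eta>) * exp (- \<i> * cdot x (cpoint \<xi> \<eta>))) \<le> (P * exp M * exp (norm x * R)) * decay \<xi>"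
      by (simp add: norm_mult mult_ac)
  qed
qed

lemma entire_mult_exp_cdot: "entire f \<Longrightarrow> entire (\<lambda>z. f z * exp (- \<i> * cdot x z))"
  by (intro entire_mult entire_exp entire_const entire_cdot)

lemma fourier_integrand_eq:
  "fourier_integrand f x \<xi> = f (cpoint \<xi> 0) * exp (- \<i> * cdot x (cpoint \<xi> 0))"
proof -
  have "(\<chi> i. complex_of_real (\<xi> $ i)) = cpoint \<xi> 0"
    by (simp add: cpoint_def vec_eq_iff)
  then show ?thesis by (simp add: fourier_integrand_def cdot_cpoint)
qed

lemma integrable_fourier_integrand:
  assumes "\<phi> \<in> class_A" "f \<in> E_weight \<phi>"
  shows "integrable lborel (fourier_integrand f x)"
  unfolding fourier_integrand_eq[abs_def]
  by (rule strip_decay_integrable[OF entire_mult_exp_cdot[OF E_weightD(1)[OF assms(2)]] E_strip_decay[OF assms]])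

lemma fourier_shift:
  assumes "\<phi> \<in> class_A" "f \<in> E_weight \<phi>"
  shows "fourier f x = (\<integral>\<xi>. f (cpoint \<xi> \<eta>) * exp (- \<i> * cdot x (cpoint \<xi> \<eta>)) \<partial>lborel)"
  unfolding fourier_def fourier_integrand_eq
  by (rule integral_strip_shift[OF entire_mult_exp_cdot[OF E_weightD(1)[OF assms(2)]] E_strip_decay[OF assms], symmetric])

lemma norm_fourier_integrand: "cmod (fourier_integrand f x \<xi>) = cmod (f (cpoint \<xi> 0))"
  by (simp add: fourier_integrand_eq norm_mult cdot_cpoint)

lemma integrable_norm_real_restriction:
  assumes "\<phi> \<in> class_A" "f \<in> E_weight \<phi>"
  shows "integrable lborel (\<lambda>\<xi>. cmod (f (cpoint \<xi> 0)))"
  using integrable_norm[OF integrable_fourier_integrand[OF assms, of 0]]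
  by (simp add: norm_fourier_integrand)

lemma fourier_continuous:
  assumes "\<phi> \<in> class_A" "f \<in> E_weight \<phi>"
  shows "continuous_on UNIV (fourier f)"
  unfolding continuous_on_sequentially fourier_def
proof (intro allI ballI impI, elim conjE)
  fix X and a :: "real ^ 'a" assume "X \<longlonglongrightarrow> a"
  then have "(\<lambda>n. fourier_integrand f (X n) \<xi>) \<longlonglongrightarrow> fourier_integrand f a \<xi>" for \<xi>
    unfolding fourier_integrand_def by (intro tendsto_intros)
  then show "((\<lambda>x. integral\<^sup>L lborel (fourier_integrand f x)) \<circ> X) \<longlonglongrightarrow> integral\<^sup>L lborel (fourier_integrand f a)"
    unfolding o_def
    by (intro integral_dominated_convergence[where w = "\<lambda>\<xi>. cmod (f (cpoint \<xi> 0))"] always_eventually allI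
        integrable_norm_real_restriction[OF assms] borel_measurable_integrable integrable_fourier_integrand[OF assms])
      (auto simp: norm_fourier_integrand)
qed

section \<open>Derivatives of the transform\<close>

definition mult_coord :: "'n \<Rightarrow> (complex ^ 'n \<Rightarrow> complex) \<Rightarrow> complex ^ 'n \<Rightarrow> complex" where
  "mult_coord i f z = - \<i> * z $ i * f z"

text \<open>The factor \<open>- \<i> * z $ i\<close> is what a partial derivative in
  \<open>x $ i\<close> pulls out of the exponential kernel; it consumes one power of
  \<open>1 + norm z\<close>.\<close>

lemma E_norm_mult_coord: "E_norm \<phi> k (mult_coord i f) \<le> E_norm \<phi> (Suc k) f"
  unfolding E_norm_def
proof (rule SUP_mono)
  fix z :: "complex ^ 'a"
  have "cmod (z $ i) * (cmod (f z) * (1 + norm z) ^ k) \<le> (1 + norm z) * (cmod (f z) * (1 + norm z) ^ k)"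
    using Finite_Cartesian_Product.norm_nth_le[of z i]
    by (intro mult_right_mono mult_nonneg_nonneg zero_le_power) auto
  then have "cmod (mult_coord i f z) * (1 + norm z) ^ k \<le> cmod (f z) * (1 + norm z) ^ Suc k"
    by (simp add: mult_coord_def norm_mult mult_ac)
  then show "\<exists>z'\<in>UNIV. ereal (cmod (mult_coord i f z) * (1 + norm z) ^ k / exp (\<phi> (\<chi> i. \<bar>Im (z $ i)\<bar>)))
      \<le> ereal (cmod (f z') * (1 + norm z') ^ Suc k / exp (\<phi> (\<chi> i. \<bar>Im (z' $ i)\<bar>)))"
    by (intro bexI[of _ z]) (auto intro: divide_right_mono)
qed

lemma E_weight_mult_coord:
  assumes "f \<in> E_weight \<phi>"
  shows "mult_coord i f \<in> E_weight \<phi>"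
proof -
  have "entire (mult_coord i f)"
    unfolding mult_coord_def[abs_def]
    by (intro entire_mult entire_const entire_component E_weightD(1)[OF assms])
  moreover have "E_norm \<phi> k (mult_coord i f) < \<infinity>" for k
    using E_norm_mult_coord E_weightD(2)[OF assms] by (rule order_le_less_trans)
  ultimately show ?thesis by (simp add: E_weight_def E_step_def)
qed

lemma cpoint_0_nth: "cpoint \<xi> 0 $ i = of_real (\<xi> $ i)"
  by (simp add: cpoint_def)

text \<open>The modulus of the differentiated integrand does not depend on \<open>t\<close>, because
  the exponential has modulus 1 at real points; hence it is its own majorant.\<close>

lemma fourier_has_partial:
  assumes "\<phi> \<in> class_A" "f \<in> E_weight \<phi>"
  shows "((\<lambda>t. fourier f (x + t *\<^sub>R axis i 1)) has_vector_derivative fourier (mult_coord i f) x) (at 0)"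
proof -
  let ?G' = "\<lambda>t \<xi>. fourier_integrand (mult_coord i f) (x + t *\<^sub>R axis i 1) \<xi>"
  have "((\<lambda>t. \<integral>\<xi>. fourier_integrand f (x + t *\<^sub>R axis i 1) \<xi> \<partial>lborel)
      has_vector_derivative (\<integral>\<xi>. ?G' 0 \<xi> \<partial>lborel)) (at 0)"
  proof (rule has_vector_derivative_integral(1)[OF zero_less_one, where B = "\<lambda>\<xi>. cmod (mult_coord i f (cpoint \<xi> 0))"])
    fix \<xi> and t :: real
    show "integrable lborel (fourier_integrand f (x + t *\<^sub>R axis i 1))"
      by (rule integrable_fourier_integrand[OF assms])
    have "((\<lambda>t. f (cpoint \<xi> 0) * exp (- \<i> * of_real (x \<bullet> \<xi> + t * \<xi> $ i))) has_vector_derivative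
        f (cpoint \<xi> 0) * (exp (- \<i> * of_real (x \<bullet> \<xi> + t * \<xi> $ i)) * (- \<i> * of_real (\<xi> $ i)))) (at t)"
    proof (rule has_vector_derivative_mult_right)
      have "((\<lambda>t. - \<i> * of_real (x \<bullet> \<xi> + t * \<xi> $ i)) has_vector_derivative - \<i> * of_real (\<xi> $ i)) (at t)"
        unfolding has_vector_derivative_def
        by (auto intro!: derivative_eq_intros simp: scaleR_conv_of_real mult_ac)
      from field_vector_diff_chain_at[OF this DERIV_exp]
      show "((\<lambda>t. exp (- \<i> * of_real (x \<bullet> \<xi> + t * \<xi> $ i))) has_vector_derivative
          exp (- \<i> * of_real (x \<bullet> \<xi> + t * \<xi> $ i)) * (- \<i> * of_real (\<xi> $ i))) (at t)"
        by (simp add: o_def mult.commute)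
    qed
    then show "((\<lambda>t. fourier_integrand f (x + t *\<^sub>R axis i 1) \<xi>) has_vector_derivative ?G' t \<xi>) (at t)"
      by (simp add: fourier_integrand_eq mult_coord_def cdot_cpoint cpoint_0_nth inner_add_left inner_axis' mult_ac)
    show "cmod (?G' t \<xi>) \<le> cmod (mult_coord i f (cpoint \<xi> 0))"
      by (simp add: norm_fourier_integrand)
  qed (rule integrable_norm_real_restriction[OF assms(1) E_weight_mult_coord[OF assms(2)]])
  then show ?thesis by (simp add: fourier_def)
qed

lemma partial_fourier:
  assumes "\<phi> \<in> class_A" "f \<in> E_weight \<phi>"
  shows "has_partial i (fourier f) x" "partial i (fourier f) = fourier (mult_coord i f)"
  using fourier_has_partial[OF assms]
  by (auto simp: has_partial_def partial_def fun_eq_iff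
      intro: differentiableI_vector vector_derivative_at)

lemma C_diff_fourier:
  assumes "\<phi> \<in> class_A" "f \<in> E_weight \<phi>"
  shows "C_diff m (fourier f)"
  using assms(2)
  by (induction m arbitrary: f)
     (auto simp: partial_fourier[OF assms(1)] fourier_continuous[OF assms(1)] E_weight_mult_coord)

lemma mult_coord_funpow:
  assumes \<phi>: "\<phi> \<in> class_A" and f: "f \<in> E_weight \<phi>"
  shows "(mult_coord i ^^ a) f \<in> E_weight \<phi>"
    and "(partial i ^^ a) (fourier f) = fourier ((mult_coord i ^^ a) f)"
    and "E_norm \<phi> k ((mult_coord i ^^ a) f) \<le> E_norm \<phi> (k + a) f"
proof -
  show *: "(mult_coord i ^^ a) f \<in> E_weight \<phi>" for a
    by (induction a) (auto simp: E_weight_mult_coord f)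
  show "(partial i ^^ a) (fourier f) = fourier ((mult_coord i ^^ a) f)"
    by (induction a) (auto simp: partial_fourier[OF \<phi> *])
  show "E_norm \<phi> k ((mult_coord i ^^ a) f) \<le> E_norm \<phi> (k + a) f"
  proof (induction a arbitrary: k)
    case (Suc a)
    have "E_norm \<phi> k ((mult_coord i ^^ Suc a) f) \<le> E_norm \<phi> (Suc k) ((mult_coord i ^^ a) f)"
      by (simp add: E_norm_mult_coord)
    also have "\<dots> \<le> E_norm \<phi> (Suc k + a) f" by (rule Suc)
    finally show ?case by simp
  qed simp
qed

text \<open>The three claims share one induction over an arbitrary list: the next partial
  derivatives can be computed only once the function built so far is known to lie in
  \<open>E_weight \<phi>\<close>. The norm indices add up along the list.\<close>

lemma mult_coord_foldr:
  assumes \<phi>: "\<phi> \<in> class_A" and f: "f \<in> E_weight \<phi>"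
  shows "foldr (\<lambda>i. mult_coord i ^^ \<alpha> i) is f \<in> E_weight \<phi> \<and>
    foldr (\<lambda>i. partial i ^^ \<alpha> i) is (fourier f) = fourier (foldr (\<lambda>i. mult_coord i ^^ \<alpha> i) is f) \<and>
    E_norm \<phi> k (foldr (\<lambda>i. mult_coord i ^^ \<alpha> i) is f) \<le> E_norm \<phi> (k + sum_list (map \<alpha> is)) f"
proof (induction "is" arbitrary: k)
  case Nil
  then show ?case using f by simp
next
  case (Cons i "is")
  let ?g = "foldr (\<lambda>i. mult_coord i ^^ \<alpha> i) is f"
  have g: "?g \<in> E_weight \<phi>" and eq: "foldr (\<lambda>i. partial i ^^ \<alpha> i) is (fourier f) = fourier ?g"
    and le: "E_norm \<phi> k ?g \<le> E_norm \<phi> (k + sum_list (map \<alpha> is)) f" for k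
    using Cons.IH by auto
  have "E_norm \<phi> k ((mult_coord i ^^ \<alpha> i) ?g) \<le> E_norm \<phi> (k + \<alpha> i) ?g"
    by (rule mult_coord_funpow[OF \<phi> g])
  also have "\<dots> \<le> E_norm \<phi> (k + \<alpha> i + sum_list (map \<alpha> is)) f" by (rule le)
  finally show ?case
    using mult_coord_funpow(1,2)[OF \<phi> g] by (simp add: eq add.assoc)
qed

lemma coordinates: "distinct (coordinates :: 'n::finite list)" "set (coordinates :: 'n list) = UNIV"
proof -
  have "\<exists>is :: 'n list. distinct is \<and> set is = UNIV"
    using finite_distinct_list[of "UNIV :: 'n set"] by auto
  from someI_ex[OF this] show "distinct (coordinates :: 'n list)" "set (coordinates :: 'n list) = UNIV"
    by (simp_all add: coordinates_def)
qed

lemma E_norm_mono: "k \<le> l \<Longrightarrow> E_norm \<phi> k f \<le> E_norm \<phi> l f"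
  unfolding E_norm_def by (intro SUP_mono') (auto intro!: divide_right_mono mult_left_mono power_increasing)

text \<open>Derivatives of a transform are transforms of members of the same step, so only
  transforms themselves remain to be bounded; the price is \<open>m\<close> further powers of
  \<open>1 + norm z\<close>.\<close>

lemma multi_deriv_fourier:
  fixes \<alpha> :: "'n::finite \<Rightarrow> nat"
  assumes \<phi>: "\<phi> \<in> class_A" and f: "f \<in> E_weight \<phi>" and \<alpha>: "(\<Sum>i\<in>UNIV. \<alpha> i) \<le> m"
  obtains g where "g \<in> E_weight \<phi>" "multi_deriv \<alpha> (fourier f) = fourier g" "E_norm \<phi> k g \<le> E_norm \<phi> (k + m) f"
proof
  let ?g = "foldr (\<lambda>i. mult_coord i ^^ \<alpha> i) coordinates f"
  note * = mult_coord_foldr[OF \<phi> f, of \<alpha> coordinates]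
  show "?g \<in> E_weight \<phi>" "multi_deriv \<alpha> (fourier f) = fourier ?g"
    using * by (auto simp: multi_deriv_def)
  have "sum_list (map \<alpha> coordinates) = (\<Sum>i\<in>UNIV. \<alpha> i)"
    by (simp add: sum_list_distinct_conv_sum_set[OF coordinates(1)] coordinates(2))
  then have "E_norm \<phi> k ?g \<le> E_norm \<phi> (k + (\<Sum>i\<in>UNIV. \<alpha> i)) f"
    using * by simp
  also have "\<dots> \<le> E_norm \<phi> (k + m) f"
    using \<alpha> by (intro E_norm_mono) simp
  finally show "E_norm \<phi> k ?g \<le> E_norm \<phi> (k + m) f" .
qed

text \<open>The contour is shifted to the imaginary parts \<open>- sgn (x\<^sub>i) * t\<^sub>i\<close>.\<close>

lemma norm_fourier_le:
  fixes \<phi> :: "real ^ 'n \<Rightarrow> real"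
  assumes \<phi>: "\<phi> \<in> class_A" and f: "f \<in> E_weight \<phi>"
    and P: "E_norm \<phi> (2 * CARD('n)) f \<le> ereal P" and t: "\<And>i. 0 \<le> t $ i"
  shows "cmod (fourier f x) \<le> P * integral\<^sup>L lborel (decay :: real ^ 'n \<Rightarrow> real) * exp (\<phi> t - (\<Sum>i\<in>UNIV. \<bar>x $ i\<bar> * t $ i))"
proof -
  \<comment> \<open>At \<open>x $ i = 0\<close> the value \<open>- (t $ i)\<close>, rather than 0,
    preserves \<open>\<bar>\<eta> $ i\<bar> = t $ i\<close>, so that the weight is evaluated exactly
    at \<open>t\<close>.\<close>
  define \<eta> :: "real ^ 'n" where "\<eta> = (\<chi> i. if 0 \<le> x $ i then - (t $ i) else t $ i)"
  have abs_\<eta>: "(\<chi> i. \<bar>\<eta> $ i\<bar>) = t"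
    using t by (simp add: \<eta>_def vec_eq_iff)
  have inner_\<eta>: "x \<bullet> \<eta> = - (\<Sum>i\<in>UNIV. \<bar>x $ i\<bar> * t $ i)"
    by (auto simp: \<eta>_def inner_vec_def sum_negf[symmetric] intro!: sum.cong)
  have "cmod (f (cpoint \<xi> \<eta>) * exp (- \<i> * cdot x (cpoint \<xi> \<eta>)))
      \<le> (P * exp (\<phi> t - (\<Sum>i\<in>UNIV. \<bar>x $ i\<bar> * t $ i))) * decay \<xi>" for \<xi>
  proof -
    have "cmod (f (cpoint \<xi> \<eta>)) \<le> P * exp (\<phi> t) * decay \<xi>"
      using E_norm_strip[OF P, of \<xi> \<eta>] by (simp add: abs_\<eta>)
    then have "cmod (f (cpoint \<xi> \<eta>)) * exp (x \<bullet> \<eta>) \<le> P * exp (\<phi> t) * decay \<xi> * exp (x \<bullet> \<eta>)"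
      by (rule mult_right_mono) simp
    moreover have "cmod (exp (- \<i> * cdot x (cpoint \<xi> \<eta>))) = exp (x \<bullet> \<eta>)"
      by (simp add: cdot_cpoint)
    moreover have "exp (\<phi> t - (\<Sum>i\<in>UNIV. \<bar>x $ i\<bar> * t $ i)) = exp (\<phi> t) * exp (x \<bullet> \<eta>)"
      by (simp add: inner_\<eta> exp_add[symmetric])
    ultimately show ?thesis
      by (simp only: norm_mult mult_ac)
  qed
  then have "cmod (\<integral>\<xi>. f (cpoint \<xi> \<eta>) * exp (- \<i> * cdot x (cpoint \<xi> \<eta>)) \<partial>lborel)
      \<le> (P * exp (\<phi> t - (\<Sum>i\<in>UNIV. \<bar>x $ i\<bar> * t $ i))) * integral\<^sup>L lborel (decay :: real ^ 'n \<Rightarrow> real)"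
    by (rule integral_decay_bound)
  then show ?thesis
    by (simp add: fourier_shift[OF \<phi> f, of x \<eta>] mult_ac)
qed

text \<open>Minimising the right-hand side over \<open>y\<close> produces the conjugate. As
  \<open>real_of_ereal\<close> sends infinite values to 0, the conjugate must first be seen to be
  finite: the hypothesis for positive \<open>L\<close> caps it from above, the choice
  \<open>y = 0\<close> from below.\<close>

lemma le_exp_neg_conj_weight:
  assumes "0 \<le> L" "0 \<le> K" and le: "\<And>y. L \<le> K * exp (exp_weight \<phi> y - b \<bullet> y)"
  shows "L \<le> K * exp (- real_of_ereal (conj_weight \<phi> b))"
proof (cases "L = 0")
  case False
  with assms(1) have L: "0 < L" by simp
  with le[of 0] have "K \<noteq> 0" by auto
  with assms(2) have K: "0 < K" by simp
  have "b \<bullet> y - exp_weight \<phi> y \<le> ln (K / L)" for y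
  proof -
    have "exp (b \<bullet> y - exp_weight \<phi> y) \<le> K / L"
      using le[of y] L by (simp add: exp_diff field_simps)
    then show ?thesis using L K by (simp add: ln_ge_iff)
  qed
  then have up: "conj_weight \<phi> b \<le> ereal (ln (K / L))"
    by (simp add: young_fenchel_def SUP_le_iff)
  moreover have "ereal (b \<bullet> 0 - exp_weight \<phi> 0) \<le> conj_weight \<phi> b"
    unfolding young_fenchel_def by (rule SUP_upper2[of 0]) auto
  ultimately obtain r where "conj_weight \<phi> b = ereal r" "r \<le> ln (K / L)"
    by (cases "conj_weight \<phi> b") auto
  then show ?thesis
    using L K by (simp add: exp_minus field_simps ln_ge_iff)
qed (simp add: assms)

text \<open>A single term of the exponential series at \<open>a * exp y\<close> trades the power of
  \<open>a\<close> for a factorial, with \<open>y\<close> left free for the minimisation.\<close>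

lemma power_mult_exp_neg_le:
  assumes "0 \<le> a"
  shows "a ^ k * exp (- (a * exp y)) \<le> fact k * exp (- (real k * y))"
proof -
  have "(a * exp y) ^ k / fact k \<le> exp (a * exp y)"
    by (rule power_div_fact_le_exp) (use assms in simp)
  then show ?thesis
    by (simp add: power_mult_distrib exp_of_nat_mult exp_of_nat2_mult exp_minus field_simps)
qed

text \<open>The index splits into \<open>2 * CARD('n)\<close> powers for integrability on the
  shifted contour and \<open>m\<close> for the derivatives.\<close>

lemma G_norm_fourier:
  fixes \<phi> :: "real ^ 'n \<Rightarrow> real"
  assumes \<phi>: "\<phi> \<in> class_A" and f: "f \<in> E_weight \<phi>" and P: "E_norm \<phi> (2 * CARD('n) + m) f \<le> ereal P"
  shows "G_norm (conj_weight \<phi>) m (fourier f) \<le> ereal (integral\<^sup>L lborel (decay :: real ^ 'n \<Rightarrow> real) * P)"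
proof -
  define D where "D = integral\<^sup>L lborel (decay :: real ^ 'n \<Rightarrow> real)"
  have D: "0 \<le> D"
    unfolding D_def by (intro integral_nonneg_AE) (simp add: less_imp_le[OF decay_pos])
  have P_nonneg: "0 \<le> P"
    using order_trans[OF E_norm_nonneg P] by simp
  have "cmod (of_real (\<Prod>i\<in>UNIV. x $ i ^ \<beta> i) * multi_deriv \<alpha> (fourier f) x)
      \<le> (D * P) * ((\<Prod>i\<in>UNIV. fact (\<beta> i)) * exp (- real_of_ereal (conj_weight \<phi> (multi_vec \<beta>))))"
    if \<alpha>: "(\<Sum>i\<in>UNIV. \<alpha> i) \<le> m" for x \<alpha> \<beta>
  proof -
    obtain g where g: "g \<in> E_weight \<phi>" "multi_deriv \<alpha> (fourier f) = fourier g"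
      and "E_norm \<phi> (2 * CARD('n)) g \<le> E_norm \<phi> (2 * CARD('n) + m) f"
      using multi_deriv_fourier[OF \<phi> f \<alpha>] by metis
    then have gP: "E_norm \<phi> (2 * CARD('n)) g \<le> ereal P"
      using P by (metis order_trans)
    have "cmod (of_real (\<Prod>i\<in>UNIV. x $ i ^ \<beta> i) * fourier g x)
        \<le> (D * P * (\<Prod>i\<in>UNIV. fact (\<beta> i))) * exp (exp_weight \<phi> y - multi_vec \<beta> \<bullet> y)" for y
    proof -
      \<comment> \<open>Parametrising the heights of the contour by their logarithms identifies
        \<open>\<phi> ?t\<close> with \<open>exp_weight \<phi> y\<close>, the function that is
        conjugated.\<close>
      let ?t = "(\<chi> i. exp (y $ i)) :: real ^ 'n"
      have "(\<Prod>i\<in>UNIV. \<bar>x $ i\<bar> ^ \<beta> i) * exp (- (\<Sum>i\<in>UNIV. \<bar>x $ i\<bar> * ?t $ i))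
          = (\<Prod>i\<in>UNIV. \<bar>x $ i\<bar> ^ \<beta> i * exp (- (\<bar>x $ i\<bar> * exp (y $ i))))"
        by (simp add: prod.distrib exp_sum sum_negf[symmetric])
      also have "\<dots> \<le> (\<Prod>i\<in>UNIV. fact (\<beta> i) * exp (- (real (\<beta> i) * y $ i)))"
        by (intro prod_mono conjI power_mult_exp_neg_le) auto
      also have "\<dots> = (\<Prod>i\<in>UNIV. fact (\<beta> i)) * exp (- (multi_vec \<beta> \<bullet> y))"
        by (simp add: prod.distrib exp_sum sum_negf[symmetric] inner_vec_def multi_vec_def)
      finally have *: "(\<Prod>i\<in>UNIV. \<bar>x $ i\<bar> ^ \<beta> i) * exp (- (\<Sum>i\<in>UNIV. \<bar>x $ i\<bar> * ?t $ i))
          \<le> (\<Prod>i\<in>UNIV. fact (\<beta> i)) * exp (- (multi_vec \<beta> \<bullet> y))" .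
      have "cmod (of_real (\<Prod>i\<in>UNIV. x $ i ^ \<beta> i) * fourier g x)
          = (\<Prod>i\<in>UNIV. \<bar>x $ i\<bar> ^ \<beta> i) * cmod (fourier g x)"
        by (simp add: norm_mult abs_prod power_abs flip: of_real_prod of_real_power)
      also have "\<dots> \<le> (\<Prod>i\<in>UNIV. \<bar>x $ i\<bar> ^ \<beta> i) * (P * D * exp (\<phi> ?t - (\<Sum>i\<in>UNIV. \<bar>x $ i\<bar> * ?t $ i)))"
        unfolding D_def by (intro mult_left_mono norm_fourier_le[OF \<phi> g(1) gP] prod_nonneg) auto
      also have "\<dots> = (P * D * exp (\<phi> ?t)) * ((\<Prod>i\<in>UNIV. \<bar>x $ i\<bar> ^ \<beta> i) * exp (- (\<Sum>i\<in>UNIV. \<bar>x $ i\<bar> * ?t $ i)))"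
        by (simp add: exp_diff exp_minus field_simps)
      also have "\<dots> \<le> (P * D * exp (\<phi> ?t)) * ((\<Prod>i\<in>UNIV. fact (\<beta> i)) * exp (- (multi_vec \<beta> \<bullet> y)))"
        by (intro mult_left_mono * mult_nonneg_nonneg P_nonneg D) auto
      also have "\<dots> = (D * P * (\<Prod>i\<in>UNIV. fact (\<beta> i))) * exp (exp_weight \<phi> y - multi_vec \<beta> \<bullet> y)"
        by (simp add: exp_weight_def exp_diff exp_minus field_simps)
      finally show ?thesis .
    qed
    then have "cmod (of_real (\<Prod>i\<in>UNIV. x $ i ^ \<beta> i) * fourier g x)
        \<le> (D * P * (\<Prod>i\<in>UNIV. fact (\<beta> i))) * exp (- real_of_ereal (conj_weight \<phi> (multi_vec \<beta>)))"
      by (intro le_exp_neg_conj_weight) (auto intro!: mult_nonneg_nonneg D P_nonneg prod_nonneg)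
    then show ?thesis by (simp add: g(2) mult.assoc)
  qed
  then show ?thesis
    by (auto simp: G_norm_def SUP_le_iff pos_divide_le_eq prod_pos D_def)
qed

lemma fourier_in_G_weight:
  assumes \<phi>: "\<phi> \<in> class_A" and f: "f \<in> E_weight \<phi>"
  shows "fourier f \<in> G_weight (conj_weight \<phi>)"
proof -
  have "G_norm (conj_weight \<phi>) m (fourier f) < \<infinity>" for m
  proof -
    obtain P where "E_norm \<phi> (2 * CARD('a) + m) f = ereal P"
      using E_norm_finite[OF E_weightD(2)[OF f]] by metis
    then have "G_norm (conj_weight \<phi>) m (fourier f) \<le> ereal (integral\<^sup>L lborel (decay :: real ^ 'a \<Rightarrow> real) * P)"
      by (intro G_norm_fourier[OF \<phi> f]) simp
    then show ?thesis by (rule order_le_less_trans) simp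
  qed
  then show ?thesis
    using C_diff_fourier[OF \<phi> f] by (auto simp: G_weight_def G_step_def)
qed

section \<open>From smooth functions to entire functions\<close>

definition smooth :: "(real ^ 'n \<Rightarrow> complex) \<Rightarrow> bool" where
  "smooth g \<longleftrightarrow> (\<forall>m. C_diff m g)"

lemma smooth_continuous: "smooth g \<Longrightarrow> continuous_on UNIV g"
  unfolding smooth_def using C_diff.simps(1) by blast

lemma smooth_has_partial: "smooth g \<Longrightarrow> has_partial i g x"
  unfolding smooth_def using C_diff.simps(2) by blast

lemma smooth_partial: "smooth g \<Longrightarrow> smooth (partial i g)"
  unfolding smooth_def using C_diff.simps(2) by blast

lemma smooth_partial_funpow: "smooth g \<Longrightarrow> smooth ((partial i ^^ k) g)"
  by (induction k) (auto intro: smooth_partial)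

lemma has_partial_has_vector_derivative:
  "has_partial i g x \<Longrightarrow> ((\<lambda>t. g (x + t *\<^sub>R axis i 1)) has_vector_derivative partial i g x) (at 0)"
  unfolding has_partial_def partial_def by (simp add: vector_derivative_works)

lemma foldr_funpow_single:
  "distinct is \<Longrightarrow> foldr (\<lambda>i. F i ^^ (if i = j then k else 0)) is g = (if j \<in> set is then (F j ^^ k) g else g)"
  by (induction "is") auto

lemma multi_deriv_single: "multi_deriv (\<lambda>i. if i = j then k else 0) g = (partial j ^^ k) g"
  by (simp add: multi_deriv_def foldr_funpow_single coordinates)

lemma G_norm_le_iff:
  "G_norm h m g \<le> ereal N \<longleftrightarrow> (\<forall>x \<alpha> \<beta>. (\<Sum>i\<in>UNIV. \<alpha> i) \<le> m \<longrightarrow>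
    cmod (of_real (\<Prod>i\<in>UNIV. x $ i ^ \<beta> i) * multi_deriv \<alpha> g x)
      \<le> N * ((\<Prod>i\<in>UNIV. fact (\<beta> i)) * exp (- real_of_ereal (h (multi_vec \<beta>)))))"
  by (auto simp: G_norm_def SUP_le_iff pos_divide_le_eq prod_pos)

lemma G_norm_nonneg: "0 \<le> G_norm h m g"
  unfolding G_norm_def
  by (rule SUP_upper2[of "(undefined, \<lambda>_. 0, undefined)"]) (auto intro!: divide_nonneg_nonneg mult_nonneg_nonneg prod_nonneg)

lemma G_weightD:
  assumes "g \<in> G_weight h"
  shows "smooth g" "G_norm h m g < \<infinity>"
  using assms by (auto simp: G_weight_def G_step_def smooth_def)

lemma G_norm_finite:
  assumes "G_norm h m g < \<infinity>"
  obtains N where "0 \<le> N" "G_norm h m g = ereal N"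
  using assms G_norm_nonneg[of h m g] by (cases "G_norm h m g") auto

text \<open>Superlinear growth gives any slope \<open>K\<close> outside a ball, and compactness
  bounds \<open>\<phi>\<close> inside. The radius is at least 1 so that the norm can be cleared from
  the denominator.\<close>

lemma class_A_lower:
  assumes \<phi>: "\<phi> \<in> class_A"
  shows "\<exists>C. \<forall>x. K * norm x - C \<le> \<phi> x"
proof -
  have "filterlim (\<lambda>x. \<phi> x / norm x) at_top at_infinity"
    using \<phi> by (simp add: class_A_def)
  then have "eventually (\<lambda>x. K \<le> \<phi> x / norm x) at_infinity"
    by (simp add: filterlim_at_top)
  then obtain b where b: "\<And>x. b \<le> norm x \<Longrightarrow> K \<le> \<phi> x / norm x"
    unfolding eventually_at_infinity by blast
  define R where "R = max b 1"
  obtain M where M: "\<And>x. norm x \<le> R \<Longrightarrow> \<bar>\<phi> x\<bar> \<le> M"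
    using class_A_bounded[OF \<phi>] by blast
  have "K * norm x - (\<bar>K\<bar> * R + \<bar>M\<bar>) \<le> \<phi> x" for x
  proof (cases "norm x \<le> R")
    case True
    have "K * norm x \<le> \<bar>K\<bar> * R"
      using True by (intro mult_mono) auto
    with M[OF True] show ?thesis by linarith
  next
    case False
    then have "0 < norm x" "K \<le> \<phi> x / norm x"
      by (auto simp: R_def intro: b)
    then have "K * norm x \<le> \<phi> x"
      by (simp add: pos_le_divide_eq)
    moreover have "0 \<le> \<bar>K\<bar> * R" by (simp add: R_def)
    ultimately show ?thesis by linarith
  qed
  then show ?thesis by blast
qed

text \<open>Young's inequality, once the conjugate is known to be finite. For this,
  \<open>\<beta> i * y $ i\<close> is at most \<open>ln (fact (\<beta> i)) + exp (y $ i)\<close>,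
  and the exponentials add up to at most \<open>CARD('n)\<close> times the norm of their vector;
  growth of \<open>\<phi>\<close> with slope \<open>real CARD('n)\<close> absorbs them.\<close>

lemma conj_weight_ge:
  fixes \<phi> :: "real ^ 'n \<Rightarrow> real"
  assumes \<phi>: "\<phi> \<in> class_A"
  shows "multi_vec \<beta> \<bullet> y - exp_weight \<phi> y \<le> real_of_ereal (conj_weight \<phi> (multi_vec \<beta>))"
proof -
  obtain C where C: "\<And>x. real CARD('n) * norm x - C \<le> \<phi> x"
    using class_A_lower[OF \<phi>] by blast
  have "multi_vec \<beta> \<bullet> y - exp_weight \<phi> y \<le> (\<Sum>i\<in>UNIV. ln (fact (\<beta> i))) + C" for y
  proof -
    let ?t = "(\<chi> i. exp (y $ i)) :: real ^ 'n"
    have "multi_vec \<beta> \<bullet> y = (\<Sum>i\<in>UNIV. real (\<beta> i) * y $ i)"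
      by (simp add: multi_vec_def inner_vec_def)
    also have "\<dots> \<le> (\<Sum>i\<in>UNIV. ln (fact (\<beta> i)) + ?t $ i)"
    proof (rule sum_mono)
      fix i
      have "exp (y $ i) ^ \<beta> i / fact (\<beta> i) \<le> exp (exp (y $ i))"
        by (rule power_div_fact_le_exp) simp
      then have "exp (real (\<beta> i) * y $ i) \<le> exp (ln (fact (\<beta> i)) + exp (y $ i))"
        by (simp add: exp_add exp_of_nat_mult exp_of_nat2_mult field_simps)
      then show "real (\<beta> i) * y $ i \<le> ln (fact (\<beta> i)) + ?t $ i"
        by simp
    qed
    also have "\<dots> = (\<Sum>i\<in>UNIV. ln (fact (\<beta> i))) + (\<Sum>i\<in>UNIV. ?t $ i)"
      by (rule sum.distrib)
    also have "(\<Sum>i\<in>UNIV. ?t $ i) \<le> (\<Sum>i\<in>(UNIV::'n set). norm ?t)"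
      by (intro sum_mono order_trans[OF abs_ge_self component_le_norm_cart])
    also have "\<dots> = real CARD('n) * norm ?t" by simp
    also have "\<dots> \<le> \<phi> ?t + C" using C[of ?t] by simp
    finally show ?thesis by (simp add: exp_weight_def)
  qed
  then have "conj_weight \<phi> (multi_vec \<beta>) \<le> ereal ((\<Sum>i\<in>UNIV. ln (fact (\<beta> i))) + C)"
    by (simp add: young_fenchel_def SUP_le_iff)
  moreover have le: "ereal (multi_vec \<beta> \<bullet> y - exp_weight \<phi> y) \<le> conj_weight \<phi> (multi_vec \<beta>)" for y
    unfolding young_fenchel_def by (rule SUP_upper2[of y]) auto
  ultimately show ?thesis
    using le[of y] by (cases "conj_weight \<phi> (multi_vec \<beta>)") auto
qed

text \<open>Since \<open>exp a = (\<Sum>k. 2\<^sup>-\<^sup>k * ((2 * a)\<^sup>k / fact k))\<close>, some term of the exponential series at \<open>2 * a\<close>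
  is at least \<open>exp a / 2\<close>. This replaces a summation over all multi-indices.\<close>

lemma exp_le_twice_term:
  assumes "0 \<le> (a::real)"
  shows "\<exists>k. exp a \<le> 2 * ((2 * a) ^ k / fact k)"
proof (rule ccontr)
  assume "\<not> ?thesis"
  then have *: "2 * ((2 * a) ^ k / fact k) < exp a" for k
    by (simp add: not_le)
  have "a ^ k /\<^sub>R fact k < exp a / 2 * (1 / 2) ^ k" for k
    using *[of k] by (simp add: power_mult_distrib field_simps)
  moreover have "summable (\<lambda>k. a ^ k /\<^sub>R fact k)" by (rule summable_exp_generic)
  moreover have sums: "(\<lambda>k. exp a / 2 * (1 / 2) ^ k) sums (exp a / 2 * 2)"
    using sums_mult[OF geometric_sums[of "1 / 2 :: real"], of "exp a / 2"] by simp
  \<comment> \<open>Terms strictly below those of the geometric series would give a strictly smaller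
    sum, yet both sums equal \<open>exp a\<close>.\<close>
  ultimately have "0 < (\<Sum>k. exp a / 2 * (1 / 2) ^ k - a ^ k /\<^sub>R fact k)"
    by (intro suminf_pos summable_diff sums_summable[OF sums]) (simp_all only: diff_gt_0_iff_gt)
  also have "\<dots> = (\<Sum>k. exp a / 2 * (1 / 2) ^ k) - (\<Sum>k. a ^ k /\<^sub>R fact k)"
    by (intro suminf_diff[symmetric] sums_summable[OF sums] summable_exp_generic)
  also have "\<dots> = 0" using sums_unique[OF sums] by (simp add: exp_def)
  finally show False by simp
qed

text \<open>The multi-index \<open>\<beta>\<close> depends on \<open>x\<close> and \<open>s\<close>
  and is chosen coordinate by coordinate; each choice loses a factor 2, whence
  \<open>2 ^ CARD('n)\<close>.\<close>

lemma G_norm_decay: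
  fixes \<phi> :: "real ^ 'n \<Rightarrow> real"
  assumes \<phi>: "\<phi> \<in> class_A" and N: "G_norm (conj_weight \<phi>) m g \<le> ereal N"
    and \<alpha>: "(\<Sum>i\<in>UNIV. \<alpha> i) \<le> m" and s: "\<And>i. 0 < s $ i"
  shows "cmod (multi_deriv \<alpha> g x) * exp (\<Sum>i\<in>UNIV. \<bar>x $ i\<bar> * s $ i) \<le> 2 ^ CARD('n) * N * exp (\<phi> (2 *\<^sub>R s))"
proof -
  have N_nonneg: "0 \<le> N" using order_trans[OF G_norm_nonneg N] by simp
  have "\<exists>k. exp (\<bar>x $ i\<bar> * s $ i) \<le> 2 * ((2 * (\<bar>x $ i\<bar> * s $ i)) ^ k / fact k)" for i
    by (rule exp_le_twice_term) (use s[of i] in simp)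
  then obtain \<beta> where \<beta>: "\<And>i. exp (\<bar>x $ i\<bar> * s $ i) \<le> 2 * ((2 * (\<bar>x $ i\<bar> * s $ i)) ^ \<beta> i / fact (\<beta> i))"
    by metis
  \<comment> \<open>The argument \<open>2 * a\<close> in \<open>exp_le_twice_term\<close> dictates
    \<open>exp (y $ i) = 2 * s $ i\<close>. Then \<open>exp (multi_vec \<beta> \<bullet> y)\<close>
    from the series cancels its inverse from Young's inequality, and \<open>\<phi>\<close> is left
    at \<open>2 *\<^sub>R s\<close>.\<close>
  define y :: "real ^ 'n" where "y = (\<chi> i. ln (2 * s $ i))"
  have exp_y: "exp (y $ i) = 2 * s $ i" for i
    using s[of i] by (simp add: y_def)
  have weight_y: "exp_weight \<phi> y = \<phi> (2 *\<^sub>R s)"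
    by (simp add: exp_weight_def exp_y scaleR_vec_def)
  have "exp (multi_vec \<beta> \<bullet> y) = (\<Prod>i\<in>UNIV. exp (y $ i) ^ \<beta> i)"
    by (simp add: inner_vec_def multi_vec_def exp_sum exp_of_nat_mult)
  then have inner_y: "exp (multi_vec \<beta> \<bullet> y) = (\<Prod>i\<in>UNIV. (2 * s $ i) ^ \<beta> i)"
    by (simp add: exp_y)
  have "exp (\<Sum>i\<in>UNIV. \<bar>x $ i\<bar> * s $ i) = (\<Prod>i\<in>UNIV. exp (\<bar>x $ i\<bar> * s $ i))"
    by (simp add: exp_sum)
  also have "\<dots> \<le> (\<Prod>i\<in>UNIV. 2 * (\<bar>x $ i\<bar> ^ \<beta> i * (2 * s $ i) ^ \<beta> i / fact (\<beta> i)))"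
    using \<beta> by (intro prod_mono conjI) (auto simp: power_mult_distrib mult_ac)
  also have "\<dots> = 2 ^ CARD('n) * ((\<Prod>i\<in>UNIV. \<bar>x $ i\<bar> ^ \<beta> i) * exp (multi_vec \<beta> \<bullet> y) / (\<Prod>i\<in>UNIV. fact (\<beta> i)))"
    by (simp add: prod.distrib prod_dividef inner_y)
  finally have e: "exp (\<Sum>i\<in>UNIV. \<bar>x $ i\<bar> * s $ i)
      \<le> 2 ^ CARD('n) * ((\<Prod>i\<in>UNIV. \<bar>x $ i\<bar> ^ \<beta> i) * exp (multi_vec \<beta> \<bullet> y) / (\<Prod>i\<in>UNIV. fact (\<beta> i)))" .
  let ?F = "(\<Prod>i\<in>UNIV. fact (\<beta> i)) :: real"
  have F: "0 < ?F" by (simp add: prod_pos)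
  have "cmod (multi_deriv \<alpha> g x) * (\<Prod>i\<in>UNIV. \<bar>x $ i\<bar> ^ \<beta> i)
      = cmod (of_real (\<Prod>i\<in>UNIV. x $ i ^ \<beta> i) * multi_deriv \<alpha> g x)"
    by (simp add: norm_mult abs_prod power_abs flip: of_real_prod of_real_power)
  also have "\<dots> \<le> N * (?F * exp (- real_of_ereal (conj_weight \<phi> (multi_vec \<beta>))))"
    using N \<alpha> unfolding G_norm_le_iff by blast
  also have "\<dots> \<le> N * (?F * exp (exp_weight \<phi> y - multi_vec \<beta> \<bullet> y))"
    using conj_weight_ge[OF \<phi>, of \<beta> y] F by (intro mult_left_mono N_nonneg) auto
  finally have b: "cmod (multi_deriv \<alpha> g x) * (\<Prod>i\<in>UNIV. \<bar>x $ i\<bar> ^ \<beta> i)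
      \<le> N * (?F * exp (exp_weight \<phi> y - multi_vec \<beta> \<bullet> y))" .
  have "cmod (multi_deriv \<alpha> g x) * exp (\<Sum>i\<in>UNIV. \<bar>x $ i\<bar> * s $ i)
      \<le> cmod (multi_deriv \<alpha> g x) * (2 ^ CARD('n) * ((\<Prod>i\<in>UNIV. \<bar>x $ i\<bar> ^ \<beta> i) * exp (multi_vec \<beta> \<bullet> y) / ?F))"
    by (intro mult_left_mono e) simp
  also have "\<dots> = (cmod (multi_deriv \<alpha> g x) * (\<Prod>i\<in>UNIV. \<bar>x $ i\<bar> ^ \<beta> i)) * (2 ^ CARD('n) * exp (multi_vec \<beta> \<bullet> y) / ?F)"
    by simp
  also have "\<dots> \<le> (N * (?F * exp (exp_weight \<phi> y - multi_vec \<beta> \<bullet> y))) * (2 ^ CARD('n) * exp (multi_vec \<beta> \<bullet> y) / ?F)"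
    using F by (intro mult_right_mono b) auto
  also have "\<dots> = 2 ^ CARD('n) * N * exp (\<phi> (2 *\<^sub>R s))"
    using F by (simp add: exp_diff weight_y)
  finally show ?thesis .
qed

text \<open>One constant serves all orders, functions, multi-indices and heights \<open>t\<close>;
  continuity of the inverse depends on this uniformity. Adding 1 to each coordinate also meets the
  strict positivity required by \<open>G_norm_decay\<close> when some \<open>t $ i\<close> is 0. In
  the application \<open>\<phi>'\<close> is the weight two indices above
  \<open>\<phi>\<close>.\<close>

lemma G_norm_decay_shift:
  fixes \<phi> :: "real ^ 'n \<Rightarrow> real"
  assumes \<phi>: "\<phi> \<in> class_A"
    and le: "\<And>t. (\<And>i. 0 \<le> t $ i) \<Longrightarrow> \<phi> (2 *\<^sub>R (t + (\<chi> i. 1))) \<le> \<phi>' t + K"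
  shows "\<exists>C>0. \<forall>m g N (\<alpha> :: 'n \<Rightarrow> nat) t x. G_norm (conj_weight \<phi>) m g \<le> ereal N \<longrightarrow> (\<Sum>i\<in>UNIV. \<alpha> i) \<le> m \<longrightarrow> (\<forall>i. 0 \<le> t $ i) \<longrightarrow>
    cmod (multi_deriv \<alpha> g x) * exp (\<Sum>i\<in>UNIV. \<bar>x $ i\<bar> * t $ i) \<le> C * N * exp (\<phi>' t) * decay x"
proof -
  obtain C where C: "C > 0" "\<And>x :: real ^ 'n. exp (- norm x) \<le> C * decay x"
    using exp_neg_norm_le_decay by blast
  show ?thesis
  proof (intro exI[of _ "2 ^ CARD('n) * exp K * C"] conjI allI impI)
    show "0 < 2 ^ CARD('n) * exp K * C" using C by simp
    fix m g N and \<alpha> :: "'n \<Rightarrow> nat" and t x :: "real ^ 'n"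
    assume N: "G_norm (conj_weight \<phi>) m g \<le> ereal N" and \<alpha>: "(\<Sum>i\<in>UNIV. \<alpha> i) \<le> m" and t: "\<forall>i. 0 \<le> t $ i"
    have N_nonneg: "0 \<le> N" using order_trans[OF G_norm_nonneg N] by simp
    let ?s = "t + (\<chi> i. 1)"
    let ?S = "\<Sum>i\<in>UNIV. \<bar>x $ i\<bar> * t $ i"
    have "norm x \<le> (\<Sum>i\<in>UNIV. \<bar>x $ i\<bar>)" by (rule norm_le_l1_cart)
    then have "norm x + ?S \<le> (\<Sum>i\<in>UNIV. \<bar>x $ i\<bar> * ?s $ i)"
      by (simp add: distrib_left sum.distrib)
    then have "cmod (multi_deriv \<alpha> g x) * exp (norm x + ?S)
        \<le> cmod (multi_deriv \<alpha> g x) * exp (\<Sum>i\<in>UNIV. \<bar>x $ i\<bar> * ?s $ i)"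
      by (intro mult_left_mono) auto
    also have "\<dots> \<le> 2 ^ CARD('n) * N * exp (\<phi> (2 *\<^sub>R ?s))"
      by (rule G_norm_decay[OF \<phi> N \<alpha>]) (use t in \<open>simp add: add_nonneg_pos\<close>)
    also have "\<dots> \<le> 2 ^ CARD('n) * N * exp (\<phi>' t + K)"
      using le[of t] t by (intro mult_left_mono mult_nonneg_nonneg N_nonneg) auto
    finally have "cmod (multi_deriv \<alpha> g x) * exp (norm x + ?S) \<le> 2 ^ CARD('n) * N * exp (\<phi>' t + K)" .
    then have "cmod (multi_deriv \<alpha> g x) * exp ?S \<le> (2 ^ CARD('n) * N * exp (\<phi>' t + K)) * exp (- norm x)"
      by (simp add: exp_add exp_minus field_simps)
    also have "\<dots> \<le> (2 ^ CARD('n) * N * exp (\<phi>' t + K)) * (C * decay x)"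
      by (intro mult_left_mono C mult_nonneg_nonneg N_nonneg) auto
    finally show "cmod (multi_deriv \<alpha> g x) * exp ?S \<le> 2 ^ CARD('n) * exp K * C * N * exp (\<phi>' t) * decay x"
      by (simp add: exp_add mult_ac)
  qed
qed

section \<open>Fourier-Laplace integrals of functions with superexponential decay\<close>

definition exp_decay :: "(real ^ 'n \<Rightarrow> complex) \<Rightarrow> bool" where
  "exp_decay u \<longleftrightarrow> continuous_on UNIV u \<and> (\<forall>R. \<exists>C. \<forall>x. cmod (u x) * exp (R * norm x) \<le> C * decay x)"

text \<open>The inverse Fourier transform without its normalising constant, taken at complex
  points.\<close>

definition laplace :: "(real ^ 'n \<Rightarrow> complex) \<Rightarrow> complex ^ 'n \<Rightarrow> complex" where
  "laplace u z = (\<integral>x. u x * exp (\<i> * cdot x z) \<partial>lborel)"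

lemma exp_decay_times:
  assumes u: "exp_decay u" and p: "\<And>x. cmod (p x) \<le> K * exp (R * norm x)"
  shows "\<exists>C. \<forall>x. cmod (u x * p x) \<le> C * decay x"
proof -
  obtain C where C: "\<And>x. cmod (u x) * exp (R * norm x) \<le> C * decay x"
    using u unfolding exp_decay_def by blast
  have K: "0 \<le> K"
    using order_trans[OF norm_ge_zero p[of 0]] by simp
  have "cmod (u x * p x) \<le> (K * C) * decay x" for x
  proof -
    have "cmod (u x * p x) \<le> cmod (u x) * (K * exp (R * norm x))"
      unfolding norm_mult by (intro mult_left_mono p) simp
    also have "\<dots> = K * (cmod (u x) * exp (R * norm x))" by simp
    also have "\<dots> \<le> K * (C * decay x)" by (intro mult_left_mono C K)
    finally show ?thesis by (simp add: mult.assoc)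
  qed
  then show ?thesis by blast
qed

lemma exp_decay_integrable:
  assumes u: "exp_decay u" and cont: "continuous_on UNIV p" and p: "\<And>x. cmod (p x) \<le> K * exp (R * norm x)"
  shows "integrable lborel (\<lambda>x. u x * p x)"
proof -
  obtain C where "\<And>x. cmod (u x * p x) \<le> C * decay x"
    using exp_decay_times[OF u p] by blast
  moreover have "(\<lambda>x. u x * p x) \<in> borel_measurable borel"
    using u cont by (intro borel_measurable_continuous_onI continuous_on_mult) (auto simp: exp_decay_def)
  ultimately show ?thesis by (intro integrable_decay_bound)
qed

lemma norm_cdot_le: "cmod (cdot x z) \<le> real CARD('n) * norm (z :: complex ^ 'n) * norm x"
proof -
  have "cmod (cdot x z) \<le> (\<Sum>i\<in>UNIV. cmod (of_real (x $ i) * z $ i))"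
    unfolding cdot_def by (rule norm_sum)
  also have "\<dots> \<le> (\<Sum>i\<in>(UNIV :: 'n set). norm x * norm z)"
    unfolding norm_mult norm_of_real
    by (intro sum_mono mult_mono component_le_norm_cart Finite_Cartesian_Product.norm_nth_le) auto
  also have "\<dots> = real CARD('n) * norm z * norm x" by simp
  finally show ?thesis .
qed

lemma cdot_add_right: "cdot x (z + w) = cdot x z + cdot x w"
  by (simp add: cdot_def distrib_left sum.distrib)

lemma cdot_scale_right: "cdot x (c *s z) = c * cdot x z"
  by (simp add: cdot_def sum_distrib_left mult.left_commute)

lemma cdot_scaleR_right: "cdot x (c *\<^sub>R z) = c *\<^sub>R cdot x z"
  by (simp add: cdot_def scaleR_sum_right)

lemma cdot_add_axis: "cdot (x + t *\<^sub>R axis j 1) z = cdot x z + of_real t * z $ j"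
proof -
  have "cdot (x + t *\<^sub>R axis j 1) z = (\<Sum>i\<in>UNIV. of_real (x $ i) * z $ i + (if i = j then of_real t * z $ i else 0))"
    unfolding cdot_def by (rule sum.cong) (auto simp: axis_def distrib_right)
  then show ?thesis by (simp add: sum.distrib cdot_def)
qed

lemma continuous_on_cdot: "continuous_on S (\<lambda>x. cdot x z)"
  unfolding cdot_def by (intro continuous_intros)

lemma norm_exp_cdot_le:
  "cmod (exp (\<i> * cdot x z)) \<le> exp (real CARD('n) * norm (z :: complex ^ 'n) * norm x)"
proof -
  have "cmod (exp (\<i> * cdot x z)) \<le> exp (cmod (\<i> * cdot x z))" by (rule norm_exp)
  also have "\<dots> \<le> exp (real CARD('n) * norm z * norm x)"
    using norm_cdot_le[of x z] by (simp add: norm_mult)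
  finally show ?thesis .
qed

lemma laplace_integrable: "exp_decay u \<Longrightarrow> integrable lborel (\<lambda>x. u x * exp (\<i> * cdot x z))"
  by (rule exp_decay_integrable[where K = 1 and R = "real CARD('a) * norm z" for z :: "complex ^ 'a"])
     (auto intro!: continuous_intros continuous_on_cdot norm_exp_cdot_le simp del: norm_exp_eq_Re)

text \<open>The Taylor remainder of the exponential is integrated directly, which leaves an error of
  order \<open>(norm v)\<^sup>2\<close>. Complex homogeneity of the candidate derivative
  \<open>D z\<close> is visible from its formula.\<close>

lemma entire_laplace:
  fixes u :: "real ^ 'n \<Rightarrow> complex"
  assumes u: "exp_decay u"
  shows "entire (laplace u)"
proof -
  define c where "c = real CARD('n)"
  define D where "D z v = (\<integral>x. u x * (\<i> * cdot x v * exp (\<i> * cdot x z)) \<partial>lborel)" for z v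
  have c: "0 \<le> c" by (simp add: c_def)
  have le_exp: "a \<le> exp a" for a :: real
    using exp_ge_add_one_self[of a] by linarith
  have bound_D: "cmod (\<i> * cdot x v * exp (\<i> * cdot x z)) \<le> 1 * exp ((c * norm v + c * norm z) * norm x)"
    for x and v z :: "complex ^ 'n"
  proof -
    have "cmod (\<i> * cdot x v) \<le> exp (c * norm v * norm x)"
      using norm_cdot_le[of x v] le_exp[of "c * norm v * norm x"] by (simp add: norm_mult c_def)
    then have "cmod (\<i> * cdot x v * exp (\<i> * cdot x z)) \<le> exp (c * norm v * norm x) * exp (c * norm z * norm x)"
      unfolding norm_mult[of _ "exp _"] using norm_exp_cdot_le[of x z] by (intro mult_mono) (auto simp: c_def)
    then show ?thesis by (simp add: exp_add[symmetric] distrib_right)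
  qed
  have int_D: "integrable lborel (\<lambda>x. u x * (\<i> * cdot x v * exp (\<i> * cdot x z)))" for z v
    by (rule exp_decay_integrable[OF u _ bound_D]) (auto intro!: continuous_intros continuous_on_cdot)
  have D_scale: "D z (a *s v) = a * D z v" for z a v
  proof -
    have "D z (a *s v) = (\<integral>x. a * (u x * (\<i> * cdot x v * exp (\<i> * cdot x z))) \<partial>lborel)"
      by (simp add: D_def cdot_scale_right mult_ac)
    then show ?thesis by (simp add: D_def)
  qed
  have "(laplace u has_derivative D z) (at z)" for z
  proof -
    \<comment> \<open>For \<open>norm v \<le> 1\<close>, the \<open>2 * c\<close> in the exponent
      collects one \<open>c\<close> from the exponential in the Taylor remainder and one from
      replacing \<open>(c * norm x)\<^sup>2\<close> by \<open>2 * exp (c * norm x)\<close>.\<close>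
    define B where "B x = cmod (u x) * (2 * exp ((2 * c + c * norm z) * norm x))" for x
    have int_B: "integrable lborel B"
    proof -
      have "integrable lborel (\<lambda>x. u x * of_real (2 * exp ((2 * c + c * norm z) * norm x)))"
        by (rule exp_decay_integrable[OF u]) (auto intro!: continuous_intros)
      from integrable_norm[OF this] show ?thesis by (simp add: B_def[abs_def] norm_mult)
    qed
    show ?thesis
    proof (rule has_derivativeI_sandwich[OF zero_less_one])
      have "linear (D z)"
      proof (rule linearI)
        show "D z (v + w) = D z v + D z w" for v w
          unfolding D_def using int_D
          by (subst Bochner_Integration.integral_add[symmetric])
             (auto simp: cdot_add_right algebra_simps simp del: Bochner_Integration.integral_add)
        show "D z (r *\<^sub>R v) = r *\<^sub>R D z v" for r v
          unfolding D_def by (subst integral_scaleR_right[symmetric]) (simp add: cdot_scaleR_right)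
      qed
      then show "bounded_linear (D z)" by (simp add: linear_conv_bounded_linear)
    next
      fix y assume "y \<noteq> z" "dist y z < 1"
      define v where "v = y - z"
      have v: "v \<noteq> 0" "norm v \<le> 1"
        using \<open>y \<noteq> z\<close> \<open>dist y z < 1\<close> by (auto simp: v_def dist_norm)
      have y: "y = z + v" by (simp add: v_def)
      let ?r = "\<lambda>x. u x * (exp (\<i> * cdot x z) * (exp (\<i> * cdot x v) - 1 - \<i> * cdot x v))"
      have r_eq: "?r x = u x * exp (\<i> * cdot x y) - u x * exp (\<i> * cdot x z)
          - u x * (\<i> * cdot x v * exp (\<i> * cdot x z))" for x
        by (simp add: y cdot_add_right exp_add algebra_simps)
      have r_le: "cmod (?r x) \<le> (norm v)\<^sup>2 * B x" for x
      proof -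
        let ?w = "\<i> * cdot x v" and ?a = "c * norm x"
        have w: "cmod ?w \<le> ?a * norm v"
          using norm_cdot_le[of x v] by (simp add: norm_mult c_def mult_ac)
        also have "\<dots> \<le> ?a * 1"
          using v c by (intro mult_left_mono) auto
        finally have w1: "cmod ?w \<le> ?a" by simp
        have "?a ^ 2 / fact 2 \<le> exp ?a"
          using c by (intro power_div_fact_le_exp) simp
        then have a2: "?a\<^sup>2 \<le> 2 * exp ?a" by simp
        have "cmod (exp ?w - 1 - ?w) \<le> exp (cmod ?w) * (cmod ?w)\<^sup>2"
          using Taylor_exp_field[of ?w 1] by (simp add: power2_eq_square algebra_simps)
        also have "\<dots> \<le> exp ?a * (?a * norm v)\<^sup>2"
          using w w1 by (intro mult_mono power_mono) auto
        also have "\<dots> = (norm v)\<^sup>2 * (exp ?a * ?a\<^sup>2)"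
          by (simp add: power_mult_distrib)
        also have "\<dots> \<le> (norm v)\<^sup>2 * (exp ?a * (2 * exp ?a))"
          by (intro mult_left_mono a2) auto
        finally have e: "cmod (exp ?w - 1 - ?w) \<le> (norm v)\<^sup>2 * (exp ?a * (2 * exp ?a))" .
        have "cmod (?r x) = cmod (u x) * (cmod (exp (\<i> * cdot x z)) * cmod (exp ?w - 1 - ?w))"
          by (simp only: norm_mult)
        also have "\<dots> \<le> cmod (u x) * (exp (c * norm z * norm x) * ((norm v)\<^sup>2 * (exp ?a * (2 * exp ?a))))"
          using norm_exp_cdot_le[of x z] e by (intro mult_left_mono mult_mono) (auto simp: c_def)
        also have "\<dots> = (norm v)\<^sup>2 * B x"
        proof -
          have "exp ((2 * c + c * norm z) * norm x) = exp ?a * exp ?a * exp (c * norm z * norm x)"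
            by (simp add: exp_add[symmetric] algebra_simps)
          then show ?thesis unfolding B_def by (simp only: mult_ac)
        qed
        finally show ?thesis .
      qed
      have "laplace u y - laplace u z - D z (y - z) = (\<integral>x. ?r x \<partial>lborel)"
        unfolding r_eq laplace_def D_def v_def[symmetric]
        using laplace_integrable[OF u] int_D by simp
      also have "cmod \<dots> \<le> (\<integral>x. cmod (?r x) \<partial>lborel)"
        by (rule integral_norm_bound)
      also have "\<dots> \<le> (\<integral>x. (norm v)\<^sup>2 * B x \<partial>lborel)"
        using int_B r_le by (intro integral_mono') (auto intro: order_trans[OF norm_ge_zero])
      finally have "cmod (laplace u y - laplace u z - D z (y - z)) \<le> (norm v)\<^sup>2 * integral\<^sup>L lborel B"
        by simp
      then show "norm (laplace u y - laplace u z - D z (y - z)) / norm (y - z) \<le> norm (y - z) * integral\<^sup>L lborel B"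
        using v(1) unfolding v_def[symmetric] by (simp add: pos_divide_le_eq power2_eq_square mult_ac)
    next
      show "((\<lambda>y. norm (y - z) * integral\<^sup>L lborel B) \<longlongrightarrow> 0) (at z)"
        by (auto intro!: tendsto_eq_intros)
    qed
  qed
  then show ?thesis using D_scale by (rule entireI)
qed

text \<open>The derivative of \<open>u x * exp (\<i> * cdot x z)\<close> in direction
  \<open>axis j 1\<close> integrates to zero; the product rule splits it into the two
  transforms.\<close>

lemma laplace_by_parts:
  fixes u u' :: "real ^ 'n \<Rightarrow> complex"
  assumes u: "exp_decay u" and u': "exp_decay u'"
    and deriv: "\<And>x. ((\<lambda>t. u (x + t *\<^sub>R axis j 1)) has_vector_derivative u' x) (at 0)"
  shows "z $ j * laplace u z = \<i> * laplace u' z"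
proof -
  let ?e = "\<lambda>x. exp (\<i> * cdot x z)"
  let ?h' = "\<lambda>x. u' x * ?e x + (\<i> * z $ j) * (u x * ?e x)"
  obtain C where C: "\<And>x. cmod (u x * ?e x) \<le> C * decay x"
    using exp_decay_times[OF u, of ?e 1 "real CARD('n) * norm z"] norm_exp_cdot_le[of _ z] by (auto simp del: norm_exp_eq_Re)
  obtain C' where C': "\<And>x. cmod (u' x * ?e x) \<le> C' * decay x"
    using exp_decay_times[OF u', of ?e 1 "real CARD('n) * norm z"] norm_exp_cdot_le[of _ z] by (auto simp del: norm_exp_eq_Re)
  define E where "E = C' + cmod (z $ j) * C"
  have E: "cmod (?h' x) \<le> E * decay x" for x
  proof -
    have "cmod (?h' x) \<le> cmod (u' x * ?e x) + cmod (z $ j) * cmod (u x * ?e x)"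
      by (rule order_trans[OF norm_triangle_ineq]) (simp add: norm_mult del: norm_exp_eq_Re)
    also have "\<dots> \<le> C' * decay x + cmod (z $ j) * (C * decay x)"
      by (intro add_mono mult_left_mono C C') simp
    finally show ?thesis by (simp add: E_def algebra_simps)
  qed
  have "(\<integral>x. ?h' x \<partial>lborel) = 0"
  proof (rule integral_directional_derivative_eq_0(1)[OF laplace_integrable[OF u, of z], where v = "axis j 1"])
    fix x
    have e: "((\<lambda>t. exp (\<i> * cdot (x + t *\<^sub>R axis j 1) z)) has_vector_derivative (\<i> * z $ j) * ?e x) (at 0)"
    proof -
      have "((\<lambda>t. \<i> * (cdot x z + of_real t * z $ j)) has_vector_derivative \<i> * z $ j) (at 0)"
        unfolding has_vector_derivative_def
        by (auto intro!: derivative_eq_intros simp: scaleR_conv_of_real mult_ac)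
      from field_vector_diff_chain_at[OF this DERIV_exp]
      show ?thesis by (simp add: o_def cdot_add_axis)
    qed
    show "((\<lambda>t. u (x + t *\<^sub>R axis j 1) * exp (\<i> * cdot (x + t *\<^sub>R axis j 1) z)) has_vector_derivative ?h' x) (at 0)"
      using has_vector_derivative_mult[OF deriv[of x] e] by (simp add: algebra_simps)
    show "cmod (?h' (x + t *\<^sub>R axis j 1)) \<le> \<bar>E\<bar> * (1 + norm (axis j (1::real))) ^ (2 * DIM(real ^ 'n)) * decay x"
      if "\<bar>t\<bar> < 1" for t
      by (rule order_trans[OF E decay_shift_scaled]) (use that in simp)
  qed (intro integrable_mult_right integrable_decay)
  then have "laplace u' z + (\<i> * z $ j) * laplace u z = 0"
    unfolding laplace_def using laplace_integrable[OF u, of z] laplace_integrable[OF u', of z] by simp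
  then have "\<i> * (laplace u' z + (\<i> * z $ j) * laplace u z) = 0" by simp
  then show ?thesis by (simp add: algebra_simps)
qed

lemma G_weight_exp_decay:
  fixes \<phi> :: "real ^ 'n \<Rightarrow> real"
  assumes \<phi>: "\<phi> \<in> class_A"
    and le: "\<And>t. (\<And>i. 0 \<le> t $ i) \<Longrightarrow> \<phi> (2 *\<^sub>R (t + (\<chi> i. 1))) \<le> \<phi>' t + K"
    and g: "g \<in> G_weight (conj_weight \<phi>)"
  shows "exp_decay ((partial j ^^ k) g)"
  unfolding exp_decay_def
proof (intro conjI allI)
  show "continuous_on UNIV ((partial j ^^ k) g)"
    by (intro smooth_continuous smooth_partial_funpow G_weightD(1)[OF g])
  fix R
  obtain N where N: "G_norm (conj_weight \<phi>) k g = ereal N"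
    using G_norm_finite[OF G_weightD(2)[OF g]] by metis
  obtain C where C: "\<forall>m g N (\<alpha> :: 'n \<Rightarrow> nat) t x. G_norm (conj_weight \<phi>) m g \<le> ereal N \<longrightarrow> (\<Sum>i\<in>UNIV. \<alpha> i) \<le> m \<longrightarrow> (\<forall>i. 0 \<le> t $ i) \<longrightarrow>
      cmod (multi_deriv \<alpha> g x) * exp (\<Sum>i\<in>UNIV. \<bar>x $ i\<bar> * t $ i) \<le> C * N * exp (\<phi>' t) * decay x"
    using G_norm_decay_shift[OF \<phi> le] by blast
  \<comment> \<open>Equal coordinates suffice because the sum of the
    \<open>\<bar>x $ i\<bar>\<close> dominates the Euclidean norm.\<close>
  let ?t = "(\<chi> i. \<bar>R\<bar>) :: real ^ 'n"
  have "cmod ((partial j ^^ k) g x) * exp (R * norm x) \<le> C * N * exp (\<phi>' ?t) * decay x" for x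
  proof -
    have "norm x \<le> (\<Sum>i\<in>UNIV. \<bar>x $ i\<bar>)" by (rule norm_le_l1_cart)
    then have "\<bar>R\<bar> * norm x \<le> \<bar>R\<bar> * (\<Sum>i\<in>UNIV. \<bar>x $ i\<bar>)"
      by (rule mult_left_mono) simp
    moreover have "R * norm x \<le> \<bar>R\<bar> * norm x" by (rule mult_right_mono) auto
    ultimately have "R * norm x \<le> (\<Sum>i\<in>UNIV. \<bar>x $ i\<bar> * ?t $ i)"
      by (simp add: sum_distrib_left mult.commute)
    then have "cmod ((partial j ^^ k) g x) * exp (R * norm x)
        \<le> cmod ((partial j ^^ k) g x) * exp (\<Sum>i\<in>UNIV. \<bar>x $ i\<bar> * ?t $ i)"
      by (intro mult_left_mono) auto
    also have "\<dots> \<le> C * N * exp (\<phi>' ?t) * decay x"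
      using C[rule_format, of k g N "\<lambda>i. if i = j then k else 0" ?t x] N
      by (simp add: multi_deriv_single)
    finally show ?thesis .
  qed
  then show "\<exists>C. \<forall>x. cmod ((partial j ^^ k) g x) * exp (R * norm x) \<le> C * decay x" by blast
qed

text \<open>The signs of the products \<open>x $ i * Im (z $ i)\<close> are given up; this fits
  weights that depend on the \<open>\<bar>Im (z $ i)\<bar>\<close> only.\<close>

lemma norm_laplace_le:
  fixes u :: "real ^ 'n \<Rightarrow> complex"
  assumes "\<And>x. cmod (u x) * exp (\<Sum>i\<in>UNIV. \<bar>x $ i\<bar> * \<bar>Im (z $ i)\<bar>) \<le> B * decay x"
  shows "cmod (laplace u z) \<le> B * integral\<^sup>L lborel (decay :: real ^ 'n \<Rightarrow> real)"
  unfolding laplace_def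
proof (rule integral_decay_bound)
  fix x :: "real ^ 'n"
  have "Re (\<i> * cdot x z) = (\<Sum>i\<in>UNIV. - (x $ i * Im (z $ i)))"
    by (simp add: cdot_def sum_negf)
  also have "\<dots> \<le> (\<Sum>i\<in>UNIV. \<bar>x $ i\<bar> * \<bar>Im (z $ i)\<bar>)"
    by (intro sum_mono) (metis abs_ge_minus_self abs_mult)
  finally have "cmod (u x * exp (\<i> * cdot x z)) \<le> cmod (u x) * exp (\<Sum>i\<in>UNIV. \<bar>x $ i\<bar> * \<bar>Im (z $ i)\<bar>)"
    unfolding norm_mult[of "u x"] norm_exp_eq_Re by (intro mult_left_mono) auto
  also have "\<dots> \<le> B * decay x" by (rule assms)
  finally show "cmod (u x * exp (\<i> * cdot x z)) \<le> B * decay x" .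
qed

text \<open>The largest coordinate controls the norm up to the factor \<open>CARD('n)\<close>. Since
  only pure powers of coordinates occur on the right, integration by parts has to produce only pure
  derivatives.\<close>

lemma one_plus_norm_power_le:
  fixes z :: "complex ^ 'n"
  shows "(1 + norm z) ^ k \<le> (1 + real CARD('n)) ^ k * (1 + (\<Sum>j\<in>UNIV. cmod (z $ j) ^ k))"
proof -
  define M where "M = Max (range (\<lambda>j. cmod (z $ j)))"
  have M: "cmod (z $ i) \<le> M" for i
    unfolding M_def by (intro Max_ge) auto
  have "M \<in> range (\<lambda>j. cmod (z $ j))"
    unfolding M_def by (intro Max_in) auto
  then obtain j where j: "M = cmod (z $ j)" by blast
  have "norm z \<le> (\<Sum>i\<in>UNIV. cmod (z $ i))"
    by (simp add: norm_vec_def L2_set_le_sum)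
  also have "\<dots> \<le> (\<Sum>i\<in>(UNIV::'n set). M)" by (intro sum_mono M)
  also have "\<dots> = real CARD('n) * M" by simp
  also have "\<dots> \<le> real CARD('n) * max 1 M" by (intro mult_left_mono) auto
  finally have "1 + norm z \<le> (1 + real CARD('n)) * max 1 M"
    unfolding distrib_right mult_1 by linarith
  then have "(1 + norm z) ^ k \<le> ((1 + real CARD('n)) * max 1 M) ^ k"
    by (intro power_mono) auto
  also have "\<dots> = (1 + real CARD('n)) ^ k * max 1 M ^ k" by (rule power_mult_distrib)
  also have "max 1 M ^ k \<le> 1 + M ^ k"
    using j by (cases "1 \<le> M") (auto simp: max_def)
  also have "M ^ k \<le> (\<Sum>j\<in>UNIV. cmod (z $ j) ^ k)"
    unfolding j by (rule member_le_sum) auto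
  finally show ?thesis by (simp add: mult_left_mono)
qed

lemma laplace_partial_funpow:
  assumes smooth: "smooth g" and decay: "\<And>k. exp_decay ((partial j ^^ k) g)"
  shows "(z $ j) ^ k * laplace g z = \<i> ^ k * laplace ((partial j ^^ k) g) z"
proof (induction k)
  case (Suc k)
  have "z $ j * laplace ((partial j ^^ k) g) z = \<i> * laplace ((partial j ^^ Suc k) g) z"
  proof (rule laplace_by_parts[OF decay decay])
    show "((\<lambda>t. (partial j ^^ k) g (x + t *\<^sub>R axis j 1)) has_vector_derivative (partial j ^^ Suc k) g x) (at 0)" for x
      using has_partial_has_vector_derivative[OF smooth_has_partial[OF smooth_partial_funpow[OF smooth]]] by simp
  qed
  note step = this
  have "(z $ j) ^ Suc k * laplace g z = z $ j * (\<i> ^ k * laplace ((partial j ^^ k) g) z)"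
    by (simp only: power_Suc mult.assoc Suc.IH)
  also have "\<dots> = \<i> ^ k * (\<i> * laplace ((partial j ^^ Suc k) g) z)"
    unfolding step[symmetric] by (rule mult.left_commute)
  finally show ?case by (simp only: power_Suc mult_ac)
qed simp

lemma E_norm_laplace:
  fixes \<phi> :: "real ^ 'n \<Rightarrow> real"
  assumes \<phi>: "\<phi> \<in> class_A"
    and le: "\<And>t. (\<And>i. 0 \<le> t $ i) \<Longrightarrow> \<phi> (2 *\<^sub>R (t + (\<chi> i. 1))) \<le> \<phi>' t + K"
  shows "\<exists>C>0. \<forall>g\<in>G_weight (conj_weight \<phi>). \<forall>N. G_norm (conj_weight \<phi>) k g \<le> ereal N \<longrightarrow>
    E_norm \<phi>' k (laplace g) \<le> ereal (C * N)"
proof -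
  define D where "D = integral\<^sup>L lborel (decay :: real ^ 'n \<Rightarrow> real)"
  have D: "0 \<le> D"
    unfolding D_def by (intro integral_nonneg_AE) (simp add: less_imp_le[OF decay_pos])
  obtain C where C: "C > 0" "\<forall>m g N (\<alpha> :: 'n \<Rightarrow> nat) t x. G_norm (conj_weight \<phi>) m g \<le> ereal N \<longrightarrow> (\<Sum>i\<in>UNIV. \<alpha> i) \<le> m \<longrightarrow> (\<forall>i. 0 \<le> t $ i) \<longrightarrow>
      cmod (multi_deriv \<alpha> g x) * exp (\<Sum>i\<in>UNIV. \<bar>x $ i\<bar> * t $ i) \<le> C * N * exp (\<phi>' t) * decay x"
    using G_norm_decay_shift[OF \<phi> le] by blast
  let ?n = "real CARD('n)"
  show ?thesis
  \<comment> \<open>The power \<open>(1 + ?n) ^ k\<close> comes from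
    \<open>one_plus_norm_power_le\<close>; the further \<open>1 + ?n\<close> counts the transforms
    to be bounded, one without derivatives and one per coordinate. \<open>D + 1\<close> replaces
    \<open>D\<close>, known here only to be nonnegative, to make the constant strictly
    positive.\<close>
  proof (intro exI[of _ "(1 + ?n) ^ k * (1 + ?n) * C * (D + 1)"] conjI ballI allI impI)
    show "0 < (1 + ?n) ^ k * (1 + ?n) * C * (D + 1)"
      using C D by (intro mult_pos_pos zero_less_power) auto
    fix g N assume g: "g \<in> G_weight (conj_weight \<phi>)" and N: "G_norm (conj_weight \<phi>) k g \<le> ereal N"
    have N_nonneg: "0 \<le> N" using order_trans[OF G_norm_nonneg N] by simp
    note decay = G_weight_exp_decay[OF \<phi> le g]
    show "E_norm \<phi>' k (laplace g) \<le> ereal ((1 + ?n) ^ k * (1 + ?n) * C * (D + 1) * N)"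
      unfolding E_norm_le_iff
    proof
      fix z :: "complex ^ 'n"
      let ?t = "(\<chi> i. \<bar>Im (z $ i)\<bar>) :: real ^ 'n"
      let ?B = "C * N * exp (\<phi>' ?t) * D"
      have le_B: "cmod (laplace ((partial j ^^ l) g) z) \<le> ?B" if "l \<le> k" for j l
        unfolding D_def
      proof (rule norm_laplace_le)
        show "cmod ((partial j ^^ l) g x) * exp (\<Sum>i\<in>UNIV. \<bar>x $ i\<bar> * \<bar>Im (z $ i)\<bar>) \<le> C * N * exp (\<phi>' ?t) * decay x" for x
          using C(2)[rule_format, of k g N "\<lambda>i. if i = j then l else 0" ?t x] N that
          by (simp add: multi_deriv_single)
      qed
      have pow: "cmod (z $ j) ^ k * cmod (laplace g z) \<le> ?B" for j
      proof -
        have "cmod (z $ j) ^ k * cmod (laplace g z) = cmod (laplace ((partial j ^^ k) g) z)"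
          using arg_cong[OF laplace_partial_funpow[OF G_weightD(1)[OF g] decay, of z j k], of cmod]
          by (simp add: norm_mult norm_power)
        then show ?thesis using le_B[of k j] by simp
      qed
      have "cmod (laplace g z) * (1 + norm z) ^ k
          \<le> cmod (laplace g z) * ((1 + ?n) ^ k * (1 + (\<Sum>j\<in>UNIV. cmod (z $ j) ^ k)))"
        by (intro mult_left_mono one_plus_norm_power_le) simp
      also have "\<dots> = (1 + ?n) ^ k * (cmod (laplace g z) + (\<Sum>j\<in>UNIV. cmod (z $ j) ^ k * cmod (laplace g z)))"
        by (simp add: sum_distrib_left sum_distrib_right algebra_simps)
      also have "\<dots> \<le> (1 + ?n) ^ k * (?B + (\<Sum>j\<in>(UNIV :: 'n set). ?B))"
        using le_B[of 0] by (intro mult_left_mono add_mono sum_mono pow) auto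
      also have "\<dots> = (1 + ?n) ^ k * (1 + ?n) * C * D * N * exp (\<phi>' ?t)"
        by (simp add: algebra_simps)
      also have "\<dots> \<le> (1 + ?n) ^ k * (1 + ?n) * C * (D + 1) * N * exp (\<phi>' ?t)"
        using C(1) N_nonneg D by (intro mult_right_mono mult_left_mono) auto
      finally show "cmod (laplace g z) * (1 + norm z) ^ k
          \<le> (1 + ?n) ^ k * (1 + ?n) * C * (D + 1) * N * exp (\<phi>' ?t)" .
    qed
  qed
qed

lemma laplace_in_E_weight:
  fixes \<phi> :: "real ^ 'n \<Rightarrow> real"
  assumes \<phi>: "\<phi> \<in> class_A"
    and le: "\<And>t. (\<And>i. 0 \<le> t $ i) \<Longrightarrow> \<phi> (2 *\<^sub>R (t + (\<chi> i. 1))) \<le> \<phi>' t + K"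
    and g: "g \<in> G_weight (conj_weight \<phi>)"
  shows "laplace g \<in> E_weight \<phi>'"
proof (rule E_weightI)
  show "entire (laplace g)"
    using entire_laplace G_weight_exp_decay[OF \<phi> le g, where k = 0] by simp
  fix k
  obtain N where "G_norm (conj_weight \<phi>) k g = ereal N"
    using G_norm_finite[OF G_weightD(2)[OF g]] by metis
  then show "\<exists>P. E_norm \<phi>' k (laplace g) \<le> ereal P"
    using E_norm_laplace[OF \<phi> le, of k] g by (metis order_refl)
qed

text \<open>Write \<open>z\<close> as \<open>a + \<i> b\<close> with real vectors \<open>a\<close>
  and \<open>b\<close>. The slice \<open>a + w b\<close> consists of real points for real
  \<open>w\<close> and reaches \<open>z\<close> at \<open>w = \<i>\<close>, so the one-variable
  identity theorem applies.\<close>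

lemma entire_eq_if_eq_on_reals:
  fixes f g :: "complex ^ 'n \<Rightarrow> complex"
  assumes "entire f" "entire g" and eq: "\<And>\<xi>. f (cpoint \<xi> 0) = g (cpoint \<xi> 0)"
  shows "f = g"
proof (rule ext)
  fix z
  define a b :: "real ^ 'n" where "a = (\<chi> i. Re (z $ i))" and "b = (\<chi> i. Im (z $ i))"
  define d where "d w = f (cpoint a 0 + w *s cpoint b 0) - g (cpoint a 0 + w *s cpoint b 0)" for w
  have "d \<i> = 0"
  proof (rule analytic_continuation[where f = d and w = \<i> and S = UNIV and U = \<real> and \<xi> = 0])
    show "d holomorphic_on UNIV"
      unfolding d_def[abs_def] by (intro holomorphic_on_diff slice_holomorphic assms)
    show "(0 :: complex) islimpt \<real>"
      unfolding islimpt_approachable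
    proof (intro allI impI)
      fix e :: real assume "0 < e"
      then show "\<exists>x'\<in>\<real>. x' \<noteq> 0 \<and> dist x' (0 :: complex) < e"
        by (intro bexI[of _ "of_real (e / 2)"]) (auto simp: norm_divide)
    qed
    show "d w = 0" if "w \<in> \<real>" for w
    proof -
      have "Im w = 0" using that by (simp add: complex_is_Real_iff)
      then show ?thesis unfolding d_def cpoint_add_scale by (simp add: eq)
    qed
  qed auto
  moreover have "cpoint a 0 + \<i> *s cpoint b 0 = z"
    unfolding cpoint_add_scale by (simp add: a_def b_def cpoint_Re_Im)
  ultimately show "f z = g z" by (simp add: d_def)
qed

section \<open>The two inversion identities\<close>

lemma decay_le_1: "decay x \<le> 1"
  by (simp add: decay_def divide_le_eq_1_pos add_pos_nonneg)

lemma exp_decay_bounded: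
  assumes "exp_decay u"
  obtains M where "\<And>x. cmod (u x) \<le> M"
proof -
  obtain C where C: "\<And>x. cmod (u x) * exp (0 * norm x) \<le> C * decay x"
    using assms unfolding exp_decay_def by blast
  have "cmod (u x) \<le> \<bar>C\<bar>" for x
  proof -
    have "C * decay x \<le> \<bar>C\<bar> * decay x" by (rule mult_right_mono) (auto intro: less_imp_le[OF decay_pos])
    also have "\<dots> \<le> \<bar>C\<bar> * 1" by (intro mult_left_mono decay_le_1) auto
    finally show ?thesis using C[of x] by simp
  qed
  then show thesis by (rule that)
qed

lemma laplace_cpoint: "laplace u (cpoint \<xi> 0) = (\<integral>x. u x * exp (\<i> * of_real (x \<bullet> \<xi>)) \<partial>lborel)"
  by (simp add: laplace_def cdot_cpoint)

text \<open>Inversion is available with the opposite order of signs in the exponents; the reflection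
  \<open>\<xi> \<mapsto> - \<xi>\<close> matches them. The integrability of the transform that it
  demands comes from \<open>laplace g\<close> lying in \<open>E_weight \<phi>\<close>.\<close>

lemma fourier_laplace:
  fixes g :: "real ^ 'n \<Rightarrow> complex"
  assumes g: "exp_decay g" and \<phi>: "\<phi> \<in> class_A" and L: "laplace g \<in> E_weight \<phi>"
  shows "fourier (laplace g) x = of_real ((gauss_mass TYPE(real ^ 'n))\<^sup>2) * g x"
proof -
  let ?U = "\<lambda>\<xi>. \<integral>y. g y * exp (- \<i> * of_real (y \<bullet> \<xi>)) \<partial>lborel"
  have U: "?U \<xi> = laplace g (cpoint (- \<xi>) 0)" for \<xi>
    by (simp add: laplace_cpoint)
  have int_L: "integrable lborel (\<lambda>\<xi>. laplace g (cpoint \<xi> 0))"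
    using integrable_fourier_integrand[OF \<phi> L, of 0] by (simp add: fourier_integrand_eq[abs_def] cdot_cpoint)
  have int_g: "integrable lborel g"
    using laplace_integrable[OF g, of 0] by (simp add: cdot_def)
  obtain M where M: "\<And>x. cmod (g x) \<le> M"
    using exp_decay_bounded[OF g] by blast
  have "integrable lborel ?U"
    using integrable_rescale[OF _ int_L, of "-1" 0] unfolding U by simp
  then have inv: "(\<integral>\<xi>. ?U \<xi> * exp (\<i> * of_real (x \<bullet> \<xi>)) \<partial>lborel) = of_real ((gauss_mass TYPE(real ^ 'n))\<^sup>2) * g x"
    using g by (intro fourier_inversion[OF _ M int_g]) (simp_all add: exp_decay_def)
  have "fourier (laplace g) x = (\<integral>\<xi>. laplace g (cpoint \<xi> 0) * exp (- \<i> * of_real (x \<bullet> \<xi>)) \<partial>lborel)"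
    by (simp add: fourier_def fourier_integrand_eq cdot_cpoint)
  also have "\<dots> = (\<integral>\<xi>. laplace g (cpoint (- \<xi>) 0) * exp (- \<i> * of_real (x \<bullet> (- \<xi>))) \<partial>lborel)"
    using int_L by (intro integral_reflect[symmetric]) auto
  also have "\<dots> = of_real ((gauss_mass TYPE(real ^ 'n))\<^sup>2) * g x"
    unfolding inv[symmetric] U by simp
  finally show ?thesis .
qed

text \<open>Inversion yields equality at real points; it extends to all points because both sides
  are entire.\<close>

lemma laplace_fourier:
  fixes f :: "complex ^ 'n \<Rightarrow> complex"
  assumes \<phi>: "\<phi> \<in> class_A" and f: "f \<in> E_weight \<phi>" and F: "exp_decay (fourier f)"
  shows "laplace (fourier f) = (\<lambda>z. of_real ((gauss_mass TYPE(real ^ 'n))\<^sup>2) * f z)"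
proof (rule entire_eq_if_eq_on_reals)
  show "entire (laplace (fourier f))" by (rule entire_laplace[OF F])
  show "entire (\<lambda>z. of_real ((gauss_mass TYPE(real ^ 'n))\<^sup>2) * f z)"
    by (intro entire_mult entire_const E_weightD(1)[OF f])
  fix x :: "real ^ 'n"
  have U: "fourier f \<xi> = (\<integral>y. f (cpoint y 0) * exp (- \<i> * of_real (y \<bullet> \<xi>)) \<partial>lborel)" for \<xi>
    by (simp add: fourier_def fourier_integrand_eq cdot_cpoint inner_commute)
  obtain P where P: "0 \<le> P" "E_norm \<phi> (2 * CARD('n)) f = ereal P"
    using E_weightD(2)[OF f] by (rule E_norm_finite)
  have bound: "cmod (f (cpoint \<xi> 0)) \<le> P * exp (\<phi> 0)" for \<xi>
  proof -
    have "cmod (f (cpoint \<xi> 0)) \<le> P * exp (\<phi> (\<chi> i. \<bar>0 $ i\<bar>)) * decay \<xi>"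
      by (rule E_norm_strip) (simp add: P)
    also have "\<dots> \<le> P * exp (\<phi> (\<chi> i. \<bar>0 $ i\<bar>)) * 1"
      by (intro mult_left_mono decay_le_1 mult_nonneg_nonneg P) auto
    finally show ?thesis by (simp add: zero_vec_def)
  qed
  have "integrable lborel (\<lambda>\<xi>. f (cpoint \<xi> 0))"
    using integrable_fourier_integrand[OF \<phi> f, of 0] by (simp add: fourier_integrand_eq[abs_def] cdot_cpoint)
  moreover have "integrable lborel (fourier f)"
    using laplace_integrable[OF F, of 0] by (simp add: cdot_def)
  ultimately have "(\<integral>\<xi>. fourier f \<xi> * exp (\<i> * of_real (x \<bullet> \<xi>)) \<partial>lborel)
      = of_real ((gauss_mass TYPE(real ^ 'n))\<^sup>2) * f (cpoint x 0)"
    unfolding U[abs_def]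
    by (intro fourier_inversion[OF entire_cpoint_continuous[OF E_weightD(1)[OF f]] bound])
  then show "laplace (fourier f) (cpoint x 0) = of_real ((gauss_mass TYPE(real ^ 'n))\<^sup>2) * f (cpoint x 0)"
    by (simp add: laplace_cpoint inner_commute)
qed

section \<open>Inductive limit topologies\<close>

text \<open>A property stable under binary intersections and supersets has to be checked only on the
  generators through the point. This extracts zero neighbourhoods from topologies given by a
  subbase.\<close>

lemma generate_topology_on_point:
  assumes "generate_topology_on S U" "x \<in> U"
    and basis: "\<And>s. s \<in> S \<Longrightarrow> x \<in> s \<Longrightarrow> P s"
    and Int: "\<And>A B. P A \<Longrightarrow> P B \<Longrightarrow> P (A \<inter> B)"
    and mono: "\<And>A B. P A \<Longrightarrow> A \<subseteq> B \<Longrightarrow> P B"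
  shows "P U"
  using assms(1,2)
proof (induction rule: generate_topology_on.induct)
  case (UN K)
  then obtain k where "k \<in> K" "P k" by blast
  then show ?case using mono[of k "\<Union>K"] by blast
qed (auto intro: basis Int)

text \<open>A single ball is enough, without finite intersections, because the families considered
  are directed.\<close>

definition seminorm_nbhd ::
  "('a \<Rightarrow> complex) set \<Rightarrow> (('a \<Rightarrow> complex) \<Rightarrow> ereal) set \<Rightarrow> ('a \<Rightarrow> complex) set \<Rightarrow> bool" where
  "seminorm_nbhd X P V \<longleftrightarrow> (\<exists>p\<in>P. \<exists>e>0. {f \<in> X. p f < ereal e} \<subseteq> V)"

text \<open>The seminorms are written with \<open>\<lambda>x. g x - f x\<close> as in \<open>seminorm_topology\<close>, so that \<open>\<lambda>x. 0 - f x\<close>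
  below is the difference of zero and \<open>f\<close>.\<close>

locale seminorm_family =
  fixes X :: "('a \<Rightarrow> complex) set" and P :: "(('a \<Rightarrow> complex) \<Rightarrow> ereal) set"
  assumes zero_mem: "(\<lambda>_. 0) \<in> X"
    and nonempty: "P \<noteq> {}"
    and zero: "p \<in> P \<Longrightarrow> p (\<lambda>_. 0) = 0"
    and nonneg: "p \<in> P \<Longrightarrow> 0 \<le> p f"
    and triangle: "p \<in> P \<Longrightarrow> f \<in> X \<Longrightarrow> g \<in> X \<Longrightarrow> p (\<lambda>x. g x - f x) \<le> p g + p (\<lambda>x. 0 - f x)"
    and directed: "p \<in> P \<Longrightarrow> q \<in> P \<Longrightarrow> \<exists>r\<in>P. \<forall>f. p f \<le> r f \<and> q f \<le> r f"
begin

lemma seminorm_nbhd_mono: "seminorm_nbhd X P A \<Longrightarrow> A \<subseteq> B \<Longrightarrow> seminorm_nbhd X P B"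
  unfolding seminorm_nbhd_def by (meson order_trans)

lemma seminorm_nbhd_Int:
  assumes "seminorm_nbhd X P A" "seminorm_nbhd X P B"
  shows "seminorm_nbhd X P (A \<inter> B)"
proof -
  obtain p d where p: "p \<in> P" "d > 0" "{f \<in> X. p f < ereal d} \<subseteq> A"
    using assms(1) unfolding seminorm_nbhd_def by blast
  obtain q e where q: "q \<in> P" "e > 0" "{f \<in> X. q f < ereal e} \<subseteq> B"
    using assms(2) unfolding seminorm_nbhd_def by blast
  obtain r where r: "r \<in> P" "\<And>f. p f \<le> r f" "\<And>f. q f \<le> r f"
    using directed[OF p(1) q(1)] by blast
  have "{f \<in> X. r f < ereal (min d e)} \<subseteq> A \<inter> B"
  proof
    fix f assume f: "f \<in> {f \<in> X. r f < ereal (min d e)}"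
    then have "r f < ereal d" "r f < ereal e"
      by (auto elim: order_less_le_trans)
    then have "p f < ereal d" "q f < ereal e"
      using r by (auto intro: order_le_less_trans)
    then show "f \<in> A \<inter> B" using f p(3) q(3) by auto
  qed
  moreover have "0 < min d e" using p q by simp
  ultimately show ?thesis
    using r(1) unfolding seminorm_nbhd_def by (intro bexI[of _ r] exI[of _ "min d e"] conjI)
qed

lemma openin_seminorm_nbhd:
  assumes "openin (seminorm_topology X P) U" "(\<lambda>_. 0) \<in> U"
  shows "seminorm_nbhd X P U"
proof (rule generate_topology_on_point[where P = "seminorm_nbhd X P", OF _ assms(2) _ seminorm_nbhd_Int seminorm_nbhd_mono])
  show "generate_topology_on {{g \<in> X. p (\<lambda>x. g x - f x) < ereal r} | p f r. p \<in> P \<and> f \<in> X} U"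
    using assms(1) unfolding seminorm_topology_def by (rule openin_topology_generated_by)
  fix s assume "s \<in> {{g \<in> X. p (\<lambda>x. g x - f x) < ereal r} | p f r. p \<in> P \<and> f \<in> X}" and 0: "(\<lambda>_. 0) \<in> s"
  then obtain p f r where s: "s = {g \<in> X. p (\<lambda>x. g x - f x) < ereal r}" and p: "p \<in> P" and f: "f \<in> X"
    by blast
  have lt: "p (\<lambda>x. 0 - f x) < ereal r" using 0 by (simp add: s)
  with nonneg[OF p, of "\<lambda>x. 0 - f x"] obtain c where c: "p (\<lambda>x. 0 - f x) = ereal c" "c < r"
    by (cases "p (\<lambda>x. 0 - f x)") auto
  \<comment> \<open>The generator is centred at \<open>f\<close>, not at zero; the triangle
    inequality leaves the radius \<open>r - c\<close>, where \<open>c\<close> is the distance from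
    \<open>f\<close> to zero.\<close>
  have "{g \<in> X. p g < ereal (r - c)} \<subseteq> s"
  proof
    fix g assume g: "g \<in> {g \<in> X. p g < ereal (r - c)}"
    then have "p (\<lambda>x. g x - f x) \<le> p g + ereal c"
      using triangle[OF p f] c by simp
    also have "\<dots> < ereal (r - c) + ereal c"
      using g nonneg[OF p, of g] by (cases "p g") auto
    finally show "g \<in> s" using g by (simp add: s)
  qed
  then show "seminorm_nbhd X P s"
    using p c unfolding seminorm_nbhd_def by (intro bexI[of _ p] exI[of _ "r - c"] conjI) auto
qed

lemma openin_seminorm_ball:
  assumes "p \<in> P"
  shows "openin (seminorm_topology X P) {f \<in> X. p f < ereal e}"
proof -
  have "{f \<in> X. p f < ereal e} = {g \<in> X. p (\<lambda>x. g x - (\<lambda>_. 0) x) < ereal e}" by simp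
  then show ?thesis
    unfolding seminorm_topology_def openin_topology_generated_by_iff
    using assms zero_mem by (intro generate_topology_on.Basis CollectI exI conjI refl)
qed

lemma zero_neighbourhood_iff: "zero_neighbourhood (seminorm_topology X P) V \<longleftrightarrow> seminorm_nbhd X P V"
proof
  assume "zero_neighbourhood (seminorm_topology X P) V"
  then obtain W where "openin (seminorm_topology X P) W" "(\<lambda>_. 0) \<in> W" "W \<subseteq> V"
    unfolding zero_neighbourhood_def by (elim exE conjE)
  then show "seminorm_nbhd X P V"
    by (intro seminorm_nbhd_mono[OF openin_seminorm_nbhd])
next
  assume "seminorm_nbhd X P V"
  then obtain p e where "p \<in> P" "e > 0" "{f \<in> X. p f < ereal e} \<subseteq> V"
    unfolding seminorm_nbhd_def by blast
  then show "zero_neighbourhood (seminorm_topology X P) V"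
    unfolding zero_neighbourhood_def
    by (intro exI[of _ "{f \<in> X. p f < ereal e}"]) (auto simp: zero zero_mem openin_seminorm_ball)
qed

lemma topspace_seminorm:
  assumes "\<And>p f. p \<in> P \<Longrightarrow> f \<in> X \<Longrightarrow> p f < \<infinity>"
  shows "topspace (seminorm_topology X P) = X"
proof
  show "topspace (seminorm_topology X P) \<subseteq> X"
    unfolding seminorm_topology_def topology_generated_by_topspace by (rule Union_least) (elim CollectE exE conjE, erule ssubst, rule Collect_restrict)
  show "X \<subseteq> topspace (seminorm_topology X P)"
  proof
    fix f assume f: "f \<in> X"
    obtain p where p: "p \<in> P" using nonempty by blast
    obtain c where "p f = ereal c"
      using assms[OF p f] nonneg[OF p, of f] by (cases "p f") simp_all
    then have "p f < ereal (c + 1)" by simp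
    with f have "f \<in> {f \<in> X. p f < ereal (c + 1)}" by simp
    with openin_subset[OF openin_seminorm_ball[OF p, of "c + 1"]]
    show "f \<in> topspace (seminorm_topology X P)" by (rule subsetD)
  qed
qed

end

section \<open>Zero neighbourhoods in the steps of both scales\<close>

lemma E_norm_zero: "E_norm \<phi> k (\<lambda>_. 0) = 0"
  by (simp add: E_norm_def)

lemma E_norm_triangle: "E_norm \<phi> k (\<lambda>z. g z - f z) \<le> E_norm \<phi> k g + E_norm \<phi> k (\<lambda>z. 0 - f z)"
  unfolding E_norm_def[of _ _ "\<lambda>z. g z - f z"]
proof (rule SUP_least)
  fix z :: "complex ^ 'a"
  let ?w = "\<lambda>c. c * (1 + norm z) ^ k / exp (\<phi> (\<chi> i. \<bar>Im (z $ i)\<bar>))"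
  have "cmod (g z - f z) \<le> cmod (g z) + cmod (0 - f z)"
    using norm_triangle_ineq4[of "g z" "f z"] by simp
  then have "?w (cmod (g z - f z)) \<le> ?w (cmod (g z) + cmod (0 - f z))"
    by (intro divide_right_mono mult_right_mono) auto
  also have "\<dots> = ?w (cmod (g z)) + ?w (cmod (0 - f z))"
    by (simp add: distrib_right add_divide_distrib)
  finally have "ereal (?w (cmod (g z - f z))) \<le> ereal (?w (cmod (g z))) + ereal (?w (cmod (0 - f z)))"
    by simp
  also have "\<dots> \<le> E_norm \<phi> k g + E_norm \<phi> k (\<lambda>z. 0 - f z)"
    unfolding E_norm_def by (intro add_mono SUP_upper2[OF UNIV_I order_refl])
  finally show "ereal (?w (cmod (g z - f z))) \<le> E_norm \<phi> k g + E_norm \<phi> k (\<lambda>z. 0 - f z)" .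
qed

lemma zero_mem_E_step: "(\<lambda>_. 0) \<in> E_step \<phi> k"
  by (simp add: E_step_def entire_const E_norm_zero)

lemma E_step_seminorm_family: "seminorm_family (E_step \<phi> k) {E_norm \<phi> k}"
  by unfold_locales (auto simp: zero_mem_E_step E_norm_zero E_norm_nonneg intro: E_norm_triangle[simplified])

lemma E_weight_seminorm_family: "seminorm_family (E_weight \<phi>) (range (E_norm \<phi>))"
proof unfold_locales
  fix p q assume "p \<in> range (E_norm \<phi>)" "q \<in> range (E_norm \<phi>)"
  then obtain k l where "p = E_norm \<phi> k" "q = E_norm \<phi> l" by blast
  then show "\<exists>r\<in>range (E_norm \<phi>). \<forall>f. p f \<le> r f \<and> q f \<le> r f"
    by (intro bexI[of _ "E_norm \<phi> (max k l)"]) (auto intro: E_norm_mono)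
qed (auto simp: E_weight_def zero_mem_E_step E_norm_zero E_norm_nonneg intro: E_norm_triangle[simplified])

lemma topspace_E_step: "topspace (seminorm_topology (E_step \<phi> k) {E_norm \<phi> k}) = E_step \<phi> k"
  by (rule seminorm_family.topspace_seminorm[OF E_step_seminorm_family]) (auto simp: E_step_def)

lemma topspace_E_weight: "topspace (E_weight_topology \<phi>) = E_weight \<phi>"
proof
  show "topspace (E_weight_topology \<phi>) \<subseteq> E_weight \<phi>"
    by (auto simp: E_weight_topology_def projective_limit_topology_def topspace_E_step E_weight_def)
  have "openin (seminorm_topology (E_step \<phi> 0) {E_norm \<phi> 0}) (E_step \<phi> 0)"
    using openin_topspace[of "seminorm_topology (E_step \<phi> 0) {E_norm \<phi> 0}"] by (simp add: topspace_E_step)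
  then show "E_weight \<phi> \<subseteq> topspace (E_weight_topology \<phi>)"
    by (auto simp: E_weight_topology_def projective_limit_topology_def topspace_E_step E_weight_def
        intro!: exI[of _ "E_step \<phi> 0 \<inter> (\<Inter>k. E_step \<phi> k)"] exI[of _ 0] exI[of _ "E_step \<phi> 0"])
qed

text \<open>The projective limit of the normed spaces has the same zero neighbourhoods as the family
  of all norms on the intersection. The two scales, although topologised by different constructions,
  can thus both be treated through \<open>seminorm_nbhd\<close>.\<close>

lemma zero_neighbourhood_E_weight:
  "zero_neighbourhood (E_weight_topology \<phi>) V \<longleftrightarrow> seminorm_nbhd (E_weight \<phi>) (range (E_norm \<phi>)) V"
proof
  interpret E: seminorm_family "E_weight \<phi>" "range (E_norm \<phi>)" by (rule E_weight_seminorm_family)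
  let ?T = "\<lambda>k. seminorm_topology (E_step \<phi> k) {E_norm \<phi> k}"
  let ?S = "{U \<inter> (\<Inter>k. topspace (?T k)) | k U. openin (?T k) U}"
  assume "zero_neighbourhood (E_weight_topology \<phi>) V"
  then obtain W where W: "generate_topology_on ?S W" "(\<lambda>_. 0) \<in> W" "W \<subseteq> V"
    unfolding zero_neighbourhood_def E_weight_topology_def projective_limit_topology_def openin_topology_generated_by_iff
    by blast
  have "seminorm_nbhd (E_weight \<phi>) (range (E_norm \<phi>)) W"
  proof (rule generate_topology_on_point[where P = "seminorm_nbhd (E_weight \<phi>) (range (E_norm \<phi>))", OF W(1,2) _ E.seminorm_nbhd_Int E.seminorm_nbhd_mono])
    fix s assume "s \<in> ?S" "(\<lambda>_. 0) \<in> s"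
    then obtain k U where s: "s = U \<inter> E_weight \<phi>" and U: "openin (?T k) U" "(\<lambda>_. 0) \<in> U"
      by (auto simp: topspace_E_step E_weight_def)
    obtain e where "e > 0" "{f \<in> E_step \<phi> k. E_norm \<phi> k f < ereal e} \<subseteq> U"
      using seminorm_family.openin_seminorm_nbhd[OF E_step_seminorm_family U] by (auto simp: seminorm_nbhd_def)
    then have "{f \<in> E_weight \<phi>. E_norm \<phi> k f < ereal e} \<subseteq> s"
      unfolding s by (auto simp: E_weight_def)
    with \<open>e > 0\<close> show "seminorm_nbhd (E_weight \<phi>) (range (E_norm \<phi>)) s"
      unfolding seminorm_nbhd_def by blast
  qed
  then show "seminorm_nbhd (E_weight \<phi>) (range (E_norm \<phi>)) V"
    using W(3) by (rule E.seminorm_nbhd_mono)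
next
  let ?T = "\<lambda>k. seminorm_topology (E_step \<phi> k) {E_norm \<phi> k}"
  assume "seminorm_nbhd (E_weight \<phi>) (range (E_norm \<phi>)) V"
  then obtain k e where e: "e > 0" "{f \<in> E_weight \<phi>. E_norm \<phi> k f < ereal e} \<subseteq> V"
    by (auto simp: seminorm_nbhd_def)
  let ?B = "{f \<in> E_step \<phi> k. E_norm \<phi> k f < ereal e}"
  have "openin (?T k) ?B"
    by (rule seminorm_family.openin_seminorm_ball[OF E_step_seminorm_family]) simp
  then have "openin (E_weight_topology \<phi>) (?B \<inter> (\<Inter>k. topspace (?T k)))"
    unfolding E_weight_topology_def projective_limit_topology_def openin_topology_generated_by_iff
    by (intro generate_topology_on.Basis CollectI exI[of _ k] exI[of _ ?B] conjI) simp_all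
  moreover have "?B \<inter> (\<Inter>k. topspace (?T k)) \<subseteq> V"
    using e(2) by (auto simp: topspace_E_step E_weight_def)
  moreover have "(\<lambda>_. 0) \<in> ?B \<inter> (\<Inter>k. topspace (?T k))"
    using e(1) by (simp add: topspace_E_step zero_mem_E_step E_norm_zero)
  ultimately show "zero_neighbourhood (E_weight_topology \<phi>) V"
    unfolding zero_neighbourhood_def by blast
qed

lemma has_vector_derivative_partial:
  "((\<lambda>t. f (x + t *\<^sub>R axis i 1)) has_vector_derivative D) (at 0) \<Longrightarrow> has_partial i f x \<and> partial i f x = D"
  by (auto simp: has_partial_def partial_def intro: differentiableI_vector vector_derivative_at)

lemma partial_diff:
  assumes "has_partial i f x" "has_partial i g x"
  shows "has_partial i (\<lambda>x. f x - g x) x \<and> partial i (\<lambda>x. f x - g x) x = partial i f x - partial i g x"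
  using assms by (intro has_vector_derivative_partial has_vector_derivative_diff has_partial_has_vector_derivative)

lemma smooth_partial_diff:
  "smooth f \<Longrightarrow> smooth g \<Longrightarrow> partial i (\<lambda>x. f x - g x) = (\<lambda>x. partial i f x - partial i g x)"
  by (rule ext) (intro partial_diff[THEN conjunct2] smooth_has_partial)

lemma partial_funpow_diff:
  "smooth f \<Longrightarrow> smooth g \<Longrightarrow> (partial i ^^ k) (\<lambda>x. f x - g x) = (\<lambda>x. (partial i ^^ k) f x - (partial i ^^ k) g x)"
  by (induction k) (auto simp: smooth_partial_diff smooth_partial_funpow)

text \<open>\<open>partial\<close> is a total function and respects differences only where the
  partial derivatives exist, so smoothness of the intermediate functions is carried along the
  fold.\<close>

lemma foldr_partial_diff:
  assumes "smooth f" "smooth g"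
  shows "foldr (\<lambda>i. partial i ^^ \<alpha> i) is (\<lambda>x. f x - g x)
      = (\<lambda>x. foldr (\<lambda>i. partial i ^^ \<alpha> i) is f x - foldr (\<lambda>i. partial i ^^ \<alpha> i) is g x)"
proof -
  have s: "smooth (foldr (\<lambda>i. partial i ^^ \<alpha> i) is u)" if "smooth u" for "is" u
    using that by (induction "is") (auto intro: smooth_partial_funpow)
  show ?thesis
    by (induction "is") (simp_all add: partial_funpow_diff s assms)
qed

lemma multi_deriv_diff:
  "smooth f \<Longrightarrow> smooth g \<Longrightarrow> multi_deriv \<alpha> (\<lambda>x. f x - g x) x = multi_deriv \<alpha> f x - multi_deriv \<alpha> g x"
  by (simp add: multi_deriv_def foldr_partial_diff)

lemma smooth_zero: "smooth (\<lambda>_ :: real ^ 'n. 0)"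
proof -
  have "has_partial i (\<lambda>_. 0) x \<and> partial i (\<lambda>_. 0) x = 0" for i and x :: "real ^ 'n"
    by (rule has_vector_derivative_partial) simp
  then have p: "has_partial i (\<lambda>_. 0) x" "partial i (\<lambda>_. 0) = (\<lambda>_. 0)" for i and x :: "real ^ 'n"
    by (auto simp: fun_eq_iff)
  have "C_diff m (\<lambda>_ :: real ^ 'n. 0)" for m
    by (induction m) (auto simp: p)
  then show ?thesis by (simp add: smooth_def)
qed

lemma multi_deriv_zero: "multi_deriv \<alpha> (\<lambda>_. 0) x = 0"
  using multi_deriv_diff[OF smooth_zero smooth_zero, of \<alpha> x] by simp

lemma G_norm_zero: "G_norm h m (\<lambda>_. 0) = 0"
proof -
  have "{\<alpha> :: 'a \<Rightarrow> nat. (\<Sum>i\<in>UNIV. \<alpha> i) \<le> m} \<noteq> {}"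
    by (auto intro!: exI[of _ "\<lambda>_. 0"])
  then show ?thesis
    by (simp add: G_norm_def multi_deriv_zero case_prod_unfold)
qed

lemma G_norm_triangle:
  assumes "smooth f" "smooth g"
  shows "G_norm h m (\<lambda>x. g x - f x) \<le> G_norm h m g + G_norm h m (\<lambda>x. 0 - f x)"
  unfolding G_norm_def[of _ _ "\<lambda>x. g x - f x"]
proof (rule SUP_least, clarify)
  fix x :: "real ^ 'a" and \<alpha> \<beta> :: "'a \<Rightarrow> nat" assume \<alpha>: "(\<Sum>i\<in>UNIV. \<alpha> i) \<le> m"
  let ?c = "complex_of_real (\<Prod>i\<in>UNIV. x $ i ^ \<beta> i)"
  let ?w = "(\<Prod>i\<in>UNIV. fact (\<beta> i)) * exp (- real_of_ereal (h (multi_vec \<beta>)))"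
  have w: "0 < ?w" by (simp add: prod_pos)
  have upper: "ereal (cmod (?c * multi_deriv \<alpha> u x) / ?w) \<le> G_norm h m u" for u
    unfolding G_norm_def using \<alpha> by (intro SUP_upper2[of "(x, \<alpha>, \<beta>)"]) auto
  have "multi_deriv \<alpha> (\<lambda>x. g x - f x) x = multi_deriv \<alpha> g x + multi_deriv \<alpha> (\<lambda>x. 0 - f x) x"
    using assms by (simp add: multi_deriv_diff smooth_zero multi_deriv_zero del: diff_0)
  then have "cmod (?c * multi_deriv \<alpha> (\<lambda>x. g x - f x) x)
      \<le> cmod (?c * multi_deriv \<alpha> g x) + cmod (?c * multi_deriv \<alpha> (\<lambda>x. 0 - f x) x)"
    by (simp add: distrib_left norm_triangle_ineq del: diff_0)
  then have "cmod (?c * multi_deriv \<alpha> (\<lambda>x. g x - f x) x) / ?w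
      \<le> (cmod (?c * multi_deriv \<alpha> g x) + cmod (?c * multi_deriv \<alpha> (\<lambda>x. 0 - f x) x)) / ?w"
    using w by (intro divide_right_mono) auto
  then have "ereal (cmod (?c * multi_deriv \<alpha> (\<lambda>x. g x - f x) x) / ?w)
      \<le> ereal (cmod (?c * multi_deriv \<alpha> g x) / ?w) + ereal (cmod (?c * multi_deriv \<alpha> (\<lambda>x. 0 - f x) x) / ?w)"
    unfolding add_divide_distrib plus_ereal.simps ereal_less_eq .
  also have "\<dots> \<le> G_norm h m g + G_norm h m (\<lambda>x. 0 - f x)"
    by (intro add_mono upper)
  finally show "ereal (cmod (?c * multi_deriv \<alpha> (\<lambda>x. g x - f x) x) / ?w) \<le> G_norm h m g + G_norm h m (\<lambda>x. 0 - f x)" .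
qed

lemma G_norm_mono: "m \<le> l \<Longrightarrow> G_norm h m g \<le> G_norm h l g"
  unfolding G_norm_def by (rule SUP_subset_mono) auto

lemma G_weight_seminorm_family: "seminorm_family (G_weight h) (range (G_norm h))"
proof unfold_locales
  show "(\<lambda>_. 0) \<in> G_weight h"
    using smooth_zero by (auto simp: G_weight_def G_step_def smooth_def G_norm_zero)
  fix p q assume "p \<in> range (G_norm h)" "q \<in> range (G_norm h)"
  then obtain k l where "p = G_norm h k" "q = G_norm h l" by blast
  then show "\<exists>r\<in>range (G_norm h). \<forall>f. p f \<le> r f \<and> q f \<le> r f"
    by (intro bexI[of _ "G_norm h (max k l)"]) (auto intro: G_norm_mono)
qed (use G_weightD(1)[of _ h] in \<open>auto simp: G_norm_zero G_norm_nonneg intro: G_norm_triangle[simplified]\<close>)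

lemma topspace_G_weight: "topspace (G_weight_topology h) = G_weight h"
  unfolding G_weight_topology_def
  by (rule seminorm_family.topspace_seminorm[OF G_weight_seminorm_family]) (elim rangeE, simp only: G_weightD(2))

lemma zero_neighbourhood_G_weight:
  "zero_neighbourhood (G_weight_topology h) V \<longleftrightarrow> seminorm_nbhd (G_weight h) (range (G_norm h)) V"
  unfolding G_weight_topology_def
  by (rule seminorm_family.zero_neighbourhood_iff[OF G_weight_seminorm_family])

text \<open>Boundedness is phrased with real bounds \<open>r\<close>, which avoids products with an
  infinite norm. The ball of radius \<open>e / C\<close> is mapped into the ball of radius
  \<open>e\<close>.\<close>

lemma seminorm_nbhd_vimage:
  assumes V: "seminorm_nbhd Y Q V" and F: "\<And>f. f \<in> X \<Longrightarrow> F f \<in> Y"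
    and bound: "\<And>q. q \<in> Q \<Longrightarrow> \<exists>p\<in>P. \<exists>C>0. \<forall>f\<in>X. \<forall>r. p f \<le> ereal r \<longrightarrow> q (F f) \<le> ereal (C * r)"
    and nonneg: "\<And>p f. p \<in> P \<Longrightarrow> 0 \<le> p f"
  shows "seminorm_nbhd X P {f \<in> X. F f \<in> V}"
proof -
  obtain q e where q: "q \<in> Q" "e > 0" "{g \<in> Y. q g < ereal e} \<subseteq> V"
    using V unfolding seminorm_nbhd_def by blast
  obtain p C where p: "p \<in> P" "C > 0" and le: "\<forall>f\<in>X. \<forall>r. p f \<le> ereal r \<longrightarrow> q (F f) \<le> ereal (C * r)"
    using bound[OF q(1)] by blast
  have "{f \<in> X. p f < ereal (e / C)} \<subseteq> {f \<in> X. F f \<in> V}"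
  proof
    fix f assume f: "f \<in> {f \<in> X. p f < ereal (e / C)}"
    then obtain r where r: "p f = ereal r" "r < e / C"
      using nonneg[OF p(1), of f] by (cases "p f") auto
    have "q (F f) \<le> ereal (C * r)" using le f r by simp
    also have "\<dots> < ereal e" using r p(2) by (simp add: pos_less_divide_eq mult.commute)
    finally show "f \<in> {f \<in> X. F f \<in> V}" using f q(3) F by blast
  qed
  moreover have "0 < e / C" using q p by simp
  ultimately show ?thesis using p(1) unfolding seminorm_nbhd_def by blast
qed

section \<open>Linear maps between inductive limits\<close>

definition linear_space :: "('a \<Rightarrow> complex) set \<Rightarrow> bool" where
  "linear_space X \<longleftrightarrow> (\<forall>f\<in>X. \<forall>g\<in>X. \<forall>a b. (\<lambda>x. a * f x + b * g x) \<in> X)"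

lemma lc_limit_open_subset: "lc_limit_open I T U \<Longrightarrow> U \<subseteq> (\<Union>\<nu>\<in>I. topspace (T \<nu>))"
  by (simp add: lc_limit_open_def)

text \<open>The union of the steps is itself a basic zero neighbourhood of the limit and, being
  closed under addition, is open.\<close>

lemma topspace_lc_inductive_limit:
  assumes "linear_space (\<Union>\<nu>\<in>I. topspace (T \<nu>))"
    and "\<And>\<nu>. \<nu> \<in> I \<Longrightarrow> (\<lambda>_. 0) \<in> topspace (T \<nu>)"
  shows "topspace (lc_inductive_limit I T) = (\<Union>\<nu>\<in>I. topspace (T \<nu>))"
proof
  let ?X = "\<Union>\<nu>\<in>I. topspace (T \<nu>)"
  show "topspace (lc_inductive_limit I T) \<subseteq> ?X"
    using openin_topspace[of "lc_inductive_limit I T"] unfolding openin_lc_inductive_limit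
    by (rule lc_limit_open_subset)
  have "lc_limit_nbhd I T ?X"
    unfolding lc_limit_nbhd_def
  proof (intro conjI ballI)
    show "absolutely_convex ?X"
      using assms(1) unfolding absolutely_convex_def linear_space_def by blast
    fix \<nu> assume "\<nu> \<in> I"
    then show "zero_neighbourhood (T \<nu>) (?X \<inter> topspace (T \<nu>))"
      unfolding zero_neighbourhood_def using assms(2) by (intro exI[of _ "topspace (T \<nu>)"]) auto
  qed simp
  moreover have "(\<lambda>x. f x + v x) \<in> ?X" if "f \<in> ?X" "v \<in> ?X" for f v
    using assms(1)[unfolded linear_space_def, rule_format, OF that, of 1 1] by simp
  ultimately have "lc_limit_open I T ?X"
    unfolding lc_limit_open_def by blast
  then show "?X \<subseteq> topspace (lc_inductive_limit I T)"
    using openin_subset[of "lc_inductive_limit I T" ?X] by (simp add: openin_lc_inductive_limit)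
qed

text \<open>The universal property of the limit: preimages of absolutely convex sets under a linear
  map are absolutely convex, so only the traces on the steps matter, and each step needs continuity
  at zero into just one target step.\<close>

lemma continuous_map_lc_inductive_limit:
  assumes X: "linear_space (\<Union>\<nu>\<in>I. topspace (S \<nu>))" "\<And>\<nu>. \<nu> \<in> I \<Longrightarrow> (\<lambda>_. 0) \<in> topspace (S \<nu>)"
    and Y: "linear_space (\<Union>\<mu>\<in>J. topspace (T \<mu>))" "\<And>\<mu>. \<mu> \<in> J \<Longrightarrow> (\<lambda>_. 0) \<in> topspace (T \<mu>)"
    and linear: "\<And>f g a b. f \<in> (\<Union>\<nu>\<in>I. topspace (S \<nu>)) \<Longrightarrow> g \<in> (\<Union>\<nu>\<in>I. topspace (S \<nu>)) \<Longrightarrow>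
        F (\<lambda>x. a * f x + b * g x) = (\<lambda>y. a * F f y + b * F g y)"
    and cont: "\<And>\<nu>. \<nu> \<in> I \<Longrightarrow> \<exists>\<mu>\<in>J. F ` topspace (S \<nu>) \<subseteq> topspace (T \<mu>) \<and>
        (\<forall>V. zero_neighbourhood (T \<mu>) V \<longrightarrow> zero_neighbourhood (S \<nu>) {f \<in> topspace (S \<nu>). F f \<in> V})"
  shows "continuous_map (lc_inductive_limit I S) (lc_inductive_limit J T) F"
proof -
  let ?X = "\<Union>\<nu>\<in>I. topspace (S \<nu>)" and ?Y = "\<Union>\<mu>\<in>J. topspace (T \<mu>)"
  have range: "F ` ?X \<subseteq> ?Y" using cont by blast
  have nbhd: "lc_limit_nbhd I S {f \<in> ?X. F f \<in> V}" if V: "lc_limit_nbhd J T V" for V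
    unfolding lc_limit_nbhd_def
  proof (intro conjI ballI)
    show "absolutely_convex {f \<in> ?X. F f \<in> V}"
      unfolding absolutely_convex_def
    proof (intro ballI allI impI)
      fix f g a b assume f: "f \<in> {f \<in> ?X. F f \<in> V}" and g: "g \<in> {f \<in> ?X. F f \<in> V}" and ab: "cmod a + cmod b \<le> 1"
      then have "(\<lambda>y. a * F f y + b * F g y) \<in> V"
        using V unfolding lc_limit_nbhd_def absolutely_convex_def by blast
      moreover have "F (\<lambda>x. a * f x + b * g x) = (\<lambda>y. a * F f y + b * F g y)"
        using f g by (intro linear) auto
      moreover have "(\<lambda>x. a * f x + b * g x) \<in> ?X"
        using X(1) f g unfolding linear_space_def by blast
      ultimately show "(\<lambda>x. a * f x + b * g x) \<in> {f \<in> ?X. F f \<in> V}" by simp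
    qed
    fix \<nu> assume \<nu>: "\<nu> \<in> I"
    obtain \<mu> where \<mu>: "\<mu> \<in> J" "F ` topspace (S \<nu>) \<subseteq> topspace (T \<mu>)"
      "\<forall>V. zero_neighbourhood (T \<mu>) V \<longrightarrow> zero_neighbourhood (S \<nu>) {f \<in> topspace (S \<nu>). F f \<in> V}"
      using cont[OF \<nu>] by blast
    have "zero_neighbourhood (T \<mu>) (V \<inter> topspace (T \<mu>))"
      using V \<mu>(1) unfolding lc_limit_nbhd_def by blast
    then have "zero_neighbourhood (S \<nu>) {f \<in> topspace (S \<nu>). F f \<in> V \<inter> topspace (T \<mu>)}"
      using \<mu>(3) by blast
    moreover have "{f \<in> topspace (S \<nu>). F f \<in> V \<inter> topspace (T \<mu>)} = {f \<in> ?X. F f \<in> V} \<inter> topspace (S \<nu>)"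
      using \<mu>(2) \<nu> by blast
    ultimately show "zero_neighbourhood (S \<nu>) ({f \<in> ?X. F f \<in> V} \<inter> topspace (S \<nu>))" by simp
  qed blast
  have topX: "topspace (lc_inductive_limit I S) = ?X" and topY: "topspace (lc_inductive_limit J T) = ?Y"
    using X Y by (auto intro!: topspace_lc_inductive_limit)
  show ?thesis
    unfolding continuous_map_def topX topY openin_lc_inductive_limit
  proof (intro conjI allI impI)
    show "F \<in> ?X \<rightarrow> ?Y" using range by blast
    fix U assume U: "lc_limit_open J T U"
    show "lc_limit_open I S {f \<in> ?X. F f \<in> U}"
      unfolding lc_limit_open_def
    proof (intro conjI ballI)
      fix f assume f: "f \<in> {f \<in> ?X. F f \<in> U}"
      then obtain V where V: "lc_limit_nbhd J T V" "\<forall>v\<in>V. (\<lambda>x. F f x + v x) \<in> U"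
        using U unfolding lc_limit_open_def by blast
      have "(\<lambda>x. f x + v x) \<in> {f \<in> ?X. F f \<in> U}" if v: "v \<in> {f \<in> ?X. F f \<in> V}" for v
      proof -
        \<comment> \<open>Additivity carries a neighbourhood of zero to one of \<open>f\<close>, so
          openness of the preimage reduces to behaviour at zero.\<close>
        have "F (\<lambda>x. 1 * f x + 1 * v x) = (\<lambda>y. 1 * F f y + 1 * F v y)"
          using f v by (intro linear) auto
        then have "F (\<lambda>x. f x + v x) \<in> U" using V(2) v by simp
        moreover have "(\<lambda>x. 1 * f x + 1 * v x) \<in> ?X"
          using X(1) f v unfolding linear_space_def by blast
        ultimately show ?thesis by simp
      qed
      then show "\<exists>W. lc_limit_nbhd I S W \<and> (\<forall>v\<in>W. (\<lambda>x. f x + v x) \<in> {f \<in> ?X. F f \<in> U})"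
        using nbhd[OF V(1)] by blast
    qed blast
  qed
qed

section \<open>The isomorphism\<close>

lemma linear_space_E_weight: "linear_space (E_weight \<phi>)"
  unfolding linear_space_def
proof (intro ballI allI)
  fix f g a b assume f: "f \<in> E_weight \<phi>" and g: "g \<in> E_weight \<phi>"
  show "(\<lambda>x. a * f x + b * g x) \<in> E_weight \<phi>"
  proof (rule E_weightI)
    show "entire (\<lambda>x. a * f x + b * g x)"
      by (intro entire_add entire_mult entire_const E_weightD(1)[OF f] E_weightD(1)[OF g])
    fix k
    obtain P where P: "E_norm \<phi> k f = ereal P"
      using E_norm_finite[OF E_weightD(2)[OF f]] by metis
    obtain Q where Q: "E_norm \<phi> k g = ereal Q"
      using E_norm_finite[OF E_weightD(2)[OF g]] by metis
    have "E_norm \<phi> k (\<lambda>x. a * f x + b * g x) \<le> ereal (cmod a * P + cmod b * Q)"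
      unfolding E_norm_le_iff
    proof
      fix z :: "complex ^ 'a"
      let ?e = "exp (\<phi> (\<chi> i. \<bar>Im (z $ i)\<bar>))" and ?n = "(1 + norm z) ^ k"
      have 1: "cmod (f z) * ?n \<le> P * ?e" and 2: "cmod (g z) * ?n \<le> Q * ?e"
        using E_norm_le_iff[of \<phi> k f P] E_norm_le_iff[of \<phi> k g Q] P Q by auto
      have "cmod (a * f z + b * g z) \<le> cmod a * cmod (f z) + cmod b * cmod (g z)"
        by (metis norm_mult norm_triangle_ineq)
      then have "cmod (a * f z + b * g z) * ?n \<le> (cmod a * cmod (f z) + cmod b * cmod (g z)) * ?n"
        by (rule mult_right_mono) simp
      also have "\<dots> = cmod a * (cmod (f z) * ?n) + cmod b * (cmod (g z) * ?n)"
        by (simp add: algebra_simps)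
      also have "\<dots> \<le> cmod a * (P * ?e) + cmod b * (Q * ?e)"
        using 1 2 by (intro add_mono mult_left_mono) auto
      finally show "cmod (a * f z + b * g z) * ?n \<le> (cmod a * P + cmod b * Q) * ?e"
        by (simp add: algebra_simps)
    qed
    then show "\<exists>P. E_norm \<phi> k (\<lambda>x. a * f x + b * g x) \<le> ereal P" by blast
  qed
qed

lemma E_weight_mono:
  assumes "\<And>x. \<phi> x \<le> \<phi>' x + C"
  shows "E_weight \<phi> \<subseteq> E_weight \<phi>'"
proof
  fix f assume f: "f \<in> E_weight \<phi>"
  show "f \<in> E_weight \<phi>'"
  proof (rule E_weightI[OF E_weightD(1)[OF f]])
    fix k
    obtain P where P: "0 \<le> P" "E_norm \<phi> k f = ereal P"
      using E_weightD(2)[OF f] by (rule E_norm_finite)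
    have "cmod (f z) * (1 + norm z) ^ k \<le> (P * exp C) * exp (\<phi>' (\<chi> i. \<bar>Im (z $ i)\<bar>))" for z
    proof -
      let ?t = "\<chi> i. \<bar>Im (z $ i)\<bar>"
      have "cmod (f z) * (1 + norm z) ^ k \<le> P * exp (\<phi> ?t)"
        using E_norm_le_iff[of \<phi> k f P] P by auto
      also have "\<dots> \<le> P * exp (\<phi>' ?t + C)"
        using assms[of ?t] P by (intro mult_left_mono) auto
      finally show ?thesis by (simp add: exp_add mult_ac)
    qed
    then show "\<exists>P. E_norm \<phi>' k f \<le> ereal P"
      by (intro exI[of _ "P * exp C"]) (simp add: E_norm_le_iff)
  qed
qed

text \<open>Two members lie in the common step of index \<open>max \<nu> \<mu>\<close>, where their
  combination can be formed.\<close>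

lemma linear_space_UN_chain:
  assumes "\<And>\<nu>. linear_space (X \<nu>)" and mono: "\<And>\<nu>. 1 \<le> \<nu> \<Longrightarrow> X \<nu> \<subseteq> X (\<nu> + 1)"
  shows "linear_space (\<Union>\<nu>\<in>{1::nat..}. X \<nu>)"
proof -
  have chain: "X \<nu> \<subseteq> X \<mu>" if "1 \<le> \<nu>" "\<nu> \<le> \<mu>" for \<nu> \<mu>
    using that(2)
  proof (induction rule: dec_induct)
    case (step n)
    then show ?case using mono[of n] that(1) by simp
  qed simp
  show ?thesis
    unfolding linear_space_def
  proof (intro ballI allI)
    fix f g a b assume "f \<in> (\<Union>\<nu>\<in>{1..}. X \<nu>)" "g \<in> (\<Union>\<nu>\<in>{1..}. X \<nu>)"
    then obtain \<nu> \<mu> where "1 \<le> \<nu>" "f \<in> X \<nu>" "1 \<le> \<mu>" "g \<in> X \<mu>" by auto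
    then have "f \<in> X (max \<nu> \<mu>)" "g \<in> X (max \<nu> \<mu>)"
      using chain[of \<nu> "max \<nu> \<mu>"] chain[of \<mu> "max \<nu> \<mu>"] by auto
    then have "(\<lambda>x. a * f x + b * g x) \<in> X (max \<nu> \<mu>)"
      using assms(1) unfolding linear_space_def by blast
    then show "(\<lambda>x. a * f x + b * g x) \<in> (\<Union>\<nu>\<in>{1..}. X \<nu>)"
      using \<open>1 \<le> \<nu>\<close> by (intro UN_I[of "max \<nu> \<mu>"]) auto
  qed
qed

lemma fourier_linear:
  assumes "\<And>x. integrable lborel (fourier_integrand f x)" "\<And>x. integrable lborel (fourier_integrand g x)"
  shows "fourier (\<lambda>x. a * f x + b * g x) = (\<lambda>y. a * fourier f y + b * fourier g y)"
proof
  fix x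
  have "fourier_integrand (\<lambda>x. a * f x + b * g x) x \<xi> = a * fourier_integrand f x \<xi> + b * fourier_integrand g x \<xi>" for \<xi>
    by (simp add: fourier_integrand_def algebra_simps)
  then show "fourier (\<lambda>x. a * f x + b * g x) x = a * fourier f x + b * fourier g x"
    using assms by (simp add: fourier_def)
qed

text \<open>The Fourier transformation maps the step with weight \<open>\<phi> \<nu>\<close> into the step with the same index,
  while the inverse transformation raises the index by two.\<close>

theorem theorem3:
  fixes \<phi> :: "nat \<Rightarrow> real ^ 'n \<Rightarrow> real"
  assumes "\<And>m. m \<ge> 1 \<Longrightarrow> \<phi> m \<in> class_A"
    and "\<And>m A. m \<ge> 1 \<Longrightarrow> A > 0 \<Longrightarrow>
      \<exists>C>0. \<forall>x. \<phi> m x + A * ln (1 + norm x) \<le> \<phi> (m + 1) x + C"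
    and "\<And>m. m \<ge> 1 \<Longrightarrow>
      \<exists>K>0. \<forall>x \<xi>. (\<forall>i. 0 \<le> x $ i) \<and> (\<forall>i. 0 \<le> \<xi> $ i \<and> \<xi> $ i \<le> 1) \<longrightarrow>
        \<phi> m (x + \<xi>) \<le> \<phi> (m + 1) x + K"
    and "\<And>m. m \<ge> 1 \<Longrightarrow> \<exists>a>0. \<forall>x. \<phi> m (2 *\<^sub>R x) \<le> \<phi> (m + 1) x + a"
    and "\<And>m. m \<ge> 1 \<Longrightarrow> \<exists>l>0. \<forall>x. 2 * \<phi> m x \<le> \<phi> (m + 1) x + l"
  shows "(\<forall>f \<in> E_space \<phi>. \<forall>x. integrable lborel (fourier_integrand f x)) \<and>
    tvs_isomorphism (E_space \<phi>) (E_topology \<phi>)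
      (G_space (psi_star \<phi>)) (G_topology (psi_star \<phi>)) fourier"
proof -
  note A = assms(1)
  let ?h = "psi_star \<phi>"
  let ?E = "E_space \<phi>" and ?G = "G_space ?h"
  define c where "c = gauss_mass TYPE(real ^ 'n)"
  have c: "0 < c" unfolding c_def by (rule gauss_mass_pos)
  define inv where "inv g = (\<lambda>z. inverse (complex_of_real (c\<^sup>2)) * laplace g z)" for g :: "real ^ 'n \<Rightarrow> complex"
  have h: "?h \<nu> = conj_weight (\<phi> \<nu>)" for \<nu> by (simp add: psi_star_def)
  \<comment> \<open>Condition (iii) is used at \<open>\<nu>\<close>, then condition (ii) at
    \<open>\<nu> + 1\<close> with all coordinates of \<open>\<xi>\<close> equal to 1.\<close>
  have shift: "\<exists>K. \<forall>t. (\<forall>i. 0 \<le> t $ i) \<longrightarrow> \<phi> \<nu> (2 *\<^sub>R (t + (\<chi> i. 1))) \<le> \<phi> (\<nu> + 2) t + K" if \<nu>: "1 \<le> \<nu>" for \<nu>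
  proof -
    obtain a where a: "\<And>x. \<phi> \<nu> (2 *\<^sub>R x) \<le> \<phi> (\<nu> + 1) x + a"
      using assms(4)[OF \<nu>] by blast
    obtain K where K: "\<And>x \<xi>. (\<forall>i. 0 \<le> x $ i) \<and> (\<forall>i. 0 \<le> \<xi> $ i \<and> \<xi> $ i \<le> 1) \<longrightarrow>
        \<phi> (\<nu> + 1) (x + \<xi>) \<le> \<phi> (\<nu> + 2) x + K"
      using assms(3)[of "\<nu> + 1"] by auto
    have "\<phi> \<nu> (2 *\<^sub>R (t + (\<chi> i. 1))) \<le> \<phi> (\<nu> + 2) t + (K + a)" if "\<forall>i. 0 \<le> t $ i" for t
      using a[of "t + (\<chi> i. 1)"] K[of t "\<chi> i. 1"] that by simp
    then show ?thesis by blast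
  qed
  have mono: "E_weight (\<phi> \<nu>) \<subseteq> E_weight (\<phi> (\<nu> + 1))" if \<nu>: "1 \<le> \<nu>" for \<nu>
  proof -
    \<comment> \<open>Condition (i) with \<open>A = 1\<close>: the logarithm is nonnegative, so the
      weights increase up to constants and the steps are nested.\<close>
    obtain C where C: "\<And>x. \<phi> \<nu> x + 1 * ln (1 + norm x) \<le> \<phi> (\<nu> + 1) x + C"
      using assms(2)[OF \<nu> zero_less_one] by blast
    have "\<phi> \<nu> x \<le> \<phi> (\<nu> + 1) x + C" for x
    proof -
      have "0 \<le> ln (1 + norm x)" by simp
      with C[of x] show ?thesis by linarith
    qed
    then show ?thesis by (rule E_weight_mono)
  qed
  have linear_E: "linear_space ?E"
    unfolding E_space_def by (rule linear_space_UN_chain[where X = "\<lambda>\<nu>. E_weight (\<phi> \<nu>)", OF linear_space_E_weight mono])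
  have integrable: "integrable lborel (fourier_integrand f x)" if "f \<in> ?E" for f x
  proof -
    obtain \<nu> where "1 \<le> \<nu>" "f \<in> E_weight (\<phi> \<nu>)" using \<open>f \<in> ?E\<close> by (auto simp: E_space_def)
    then show ?thesis by (intro integrable_fourier_integrand[OF A])
  qed
  have F_linear: "fourier (\<lambda>x. a * f x + b * g x) = (\<lambda>y. a * fourier f y + b * fourier g y)"
    if "f \<in> ?E" "g \<in> ?E" for f g a b
    by (rule fourier_linear) (use that integrable in auto)
  have F_mem: "fourier f \<in> G_weight (?h \<nu>)" if "1 \<le> \<nu>" "f \<in> E_weight (\<phi> \<nu>)" for \<nu> f
    unfolding h by (rule fourier_in_G_weight[OF A[OF that(1)] that(2)])
  have G_decay: "exp_decay g" and laplace_mem: "laplace g \<in> E_weight (\<phi> (\<nu> + 2))"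
    if \<nu>: "1 \<le> \<nu>" and g: "g \<in> G_weight (?h \<nu>)" for \<nu> g
  proof -
    obtain K where K: "\<And>t. (\<And>i. 0 \<le> t $ i) \<Longrightarrow> \<phi> \<nu> (2 *\<^sub>R (t + (\<chi> i. 1))) \<le> \<phi> (\<nu> + 2) t + K"
      using shift[OF \<nu>] by blast
    show "exp_decay g"
      using G_weight_exp_decay[OF A[OF \<nu>] K g[unfolded h], where k = 0] by simp
    show "laplace g \<in> E_weight (\<phi> (\<nu> + 2))"
      by (rule laplace_in_E_weight[OF A[OF \<nu>] K g[unfolded h]])
  qed
  have inv_mem: "inv g \<in> E_weight (\<phi> (\<nu> + 2))" if "1 \<le> \<nu>" "g \<in> G_weight (?h \<nu>)" for \<nu> g
    using linear_space_E_weight[of "\<phi> (\<nu> + 2)", unfolded linear_space_def, rule_format,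
        OF laplace_mem[OF that] laplace_mem[OF that], of "inverse (complex_of_real (c\<^sup>2))" 0]
    by (simp add: inv_def)
  have inv_F: "inv (fourier f) = f" if "f \<in> ?E" for f
  proof -
    obtain \<nu> where \<nu>: "1 \<le> \<nu>" "f \<in> E_weight (\<phi> \<nu>)" using \<open>f \<in> ?E\<close> by (auto simp: E_space_def)
    show ?thesis
      using laplace_fourier[OF A[OF \<nu>(1)] \<nu>(2) G_decay[OF \<nu>(1) F_mem[OF \<nu>]]] c
      by (simp add: inv_def c_def[symmetric] mult.assoc[symmetric])
  qed
  have F_inv: "fourier (inv g) = g" if "g \<in> ?G" for g
  proof
    fix x
    obtain \<nu> where \<nu>: "1 \<le> \<nu>" "g \<in> G_weight (?h \<nu>)" using \<open>g \<in> ?G\<close> by (auto simp: G_space_def)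
    have L: "laplace g \<in> ?E"
      using laplace_mem[OF \<nu>] \<nu>(1) unfolding E_space_def by (intro UN_I[of "\<nu> + 2"]) auto
    have "fourier (inv g) x = inverse (complex_of_real (c\<^sup>2)) * fourier (laplace g) x"
      using F_linear[OF L L, of "inverse (complex_of_real (c\<^sup>2))" 0] by (simp add: inv_def fun_eq_iff)
    also have "\<dots> = g x"
      using fourier_laplace[OF G_decay[OF \<nu>] A laplace_mem[OF \<nu>], of x] c
      by (simp add: c_def[symmetric] mult.assoc[symmetric])
    finally show "fourier (inv g) x = g x" .
  qed
  have F_E: "fourier ` ?E \<subseteq> ?G" using F_mem by (auto simp: E_space_def G_space_def)
  have inv_G: "inv ` ?G \<subseteq> ?E"
  proof
    fix f assume "f \<in> inv ` ?G"
    then obtain g \<nu> where "1 \<le> \<nu>" "g \<in> G_weight (?h \<nu>)" "f = inv g" by (auto simp: G_space_def)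
    then show "f \<in> ?E" using inv_mem unfolding E_space_def by (intro UN_I[of "\<nu> + 2"]) auto
  qed
  \<comment> \<open>Linearity of \<open>inv\<close> and closure of \<open>G_space\<close> under
    combinations are transported from \<open>E_space\<close> through the two inversion identities,
    instead of being computed from derivatives of sums.\<close>
  have inv_linear: "inv (\<lambda>x. a * f x + b * g x) = (\<lambda>y. a * inv f y + b * inv g y)"
    and combo_G: "(\<lambda>x. a * f x + b * g x) \<in> ?G" if "f \<in> ?G" "g \<in> ?G" for f g a b
  proof -
    have mem: "inv f \<in> ?E" "inv g \<in> ?E" using inv_G that by auto
    have combo: "(\<lambda>x. a * inv f x + b * inv g x) \<in> ?E"
      using linear_E mem unfolding linear_space_def by blast
    have eq: "fourier (\<lambda>x. a * inv f x + b * inv g x) = (\<lambda>x. a * f x + b * g x)"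
      using F_linear[OF mem, of a b] F_inv that by simp
    show "inv (\<lambda>x. a * f x + b * g x) = (\<lambda>y. a * inv f y + b * inv g y)"
      using inv_F[OF combo] unfolding eq .
    show "(\<lambda>x. a * f x + b * g x) \<in> ?G"
      using F_E combo unfolding eq[symmetric] by blast
  qed
  have linear_G: "linear_space ?G" using combo_G unfolding linear_space_def by blast
  have E_union: "(\<Union>\<nu>\<in>{1..}. topspace (E_weight_topology (\<phi> \<nu>))) = ?E"
    by (simp add: topspace_E_weight E_space_def)
  have G_union: "(\<Union>\<nu>\<in>{1..}. topspace (G_weight_topology (?h \<nu>))) = ?G"
    by (simp add: topspace_G_weight G_space_def)
  have E_zero: "(\<lambda>_. 0) \<in> topspace (E_weight_topology (\<phi> \<nu>))" for \<nu>
    unfolding topspace_E_weight by (rule seminorm_family.zero_mem[OF E_weight_seminorm_family])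
  have G_zero: "(\<lambda>_. 0) \<in> topspace (G_weight_topology (?h \<nu>))" for \<nu>
    unfolding topspace_G_weight by (rule seminorm_family.zero_mem[OF G_weight_seminorm_family])
  have top_E: "topspace (E_topology \<phi>) = ?E"
    unfolding E_topology_def E_union[symmetric]
    by (rule topspace_lc_inductive_limit) (unfold E_union, rule linear_E, rule E_zero)
  have top_G: "topspace (G_topology ?h) = ?G"
    unfolding G_topology_def G_union[symmetric]
    by (rule topspace_lc_inductive_limit) (unfold G_union, rule linear_G, rule G_zero)
  define D where "D = integral\<^sup>L lborel (decay :: real ^ 'n \<Rightarrow> real)"
  have D: "0 \<le> D"
    unfolding D_def by (intro integral_nonneg_AE) (simp add: less_imp_le[OF decay_pos])
  have cont_F: "continuous_map (E_topology \<phi>) (G_topology ?h) fourier"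
    unfolding E_topology_def G_topology_def
  proof (rule continuous_map_lc_inductive_limit, unfold E_union G_union)
    fix \<nu> :: nat assume "\<nu> \<in> {1..}"
    then have \<nu>: "1 \<le> \<nu>" by simp
    have "zero_neighbourhood (E_weight_topology (\<phi> \<nu>)) {f \<in> E_weight (\<phi> \<nu>). fourier f \<in> V}"
      if "zero_neighbourhood (G_weight_topology (?h \<nu>)) V" for V
      unfolding zero_neighbourhood_E_weight
    proof (rule seminorm_nbhd_vimage[OF that[unfolded zero_neighbourhood_G_weight] F_mem[OF \<nu>]])
      fix q assume "q \<in> range (G_norm (?h \<nu>))"
      then obtain m where q: "q = G_norm (conj_weight (\<phi> \<nu>)) m" by (auto simp: h)
      \<comment> \<open>\<open>D + 1\<close> instead of \<open>D\<close>, because the continuity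
        criterion asks for a strictly positive factor.\<close>
      have "q (fourier f) \<le> ereal ((D + 1) * r)"
        if f: "f \<in> E_weight (\<phi> \<nu>)" and r: "E_norm (\<phi> \<nu>) (2 * CARD('n) + m) f \<le> ereal r" for f r
      proof -
        have "0 \<le> r" using order_trans[OF E_norm_nonneg r] by simp
        have "q (fourier f) \<le> ereal (D * r)"
          unfolding q D_def by (rule G_norm_fourier[OF A[OF \<nu>] f r])
        also have "\<dots> \<le> ereal ((D + 1) * r)" using \<open>0 \<le> r\<close> by (simp add: distrib_right)
        finally show ?thesis .
      qed
      moreover have "0 < D + 1" using D by simp
      ultimately show "\<exists>p\<in>range (E_norm (\<phi> \<nu>)). \<exists>C>0. \<forall>f\<in>E_weight (\<phi> \<nu>). \<forall>r. p f \<le> ereal r \<longrightarrow> q (fourier f) \<le> ereal (C * r)"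
        by (intro bexI[of _ "E_norm (\<phi> \<nu>) (2 * CARD('n) + m)"] exI[of _ "D + 1"]) auto
    qed (auto intro: E_norm_nonneg)
    then show "\<exists>\<mu>\<in>{1..}. fourier ` topspace (E_weight_topology (\<phi> \<nu>)) \<subseteq> topspace (G_weight_topology (?h \<mu>)) \<and>
        (\<forall>V. zero_neighbourhood (G_weight_topology (?h \<mu>)) V \<longrightarrow>
          zero_neighbourhood (E_weight_topology (\<phi> \<nu>)) {f \<in> topspace (E_weight_topology (\<phi> \<nu>)). fourier f \<in> V})"
      using \<nu> F_mem[OF \<nu>] unfolding topspace_E_weight topspace_G_weight by (intro bexI[of _ \<nu>]) auto
  qed (use linear_E linear_G E_zero G_zero F_linear in auto)
  have cont_inv: "continuous_map (G_topology ?h) (E_topology \<phi>) inv"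
    unfolding E_topology_def G_topology_def
  proof (rule continuous_map_lc_inductive_limit, unfold E_union G_union)
    fix \<nu> :: nat assume "\<nu> \<in> {1..}"
    then have \<nu>: "1 \<le> \<nu>" by simp
    have "zero_neighbourhood (G_weight_topology (?h \<nu>)) {g \<in> G_weight (?h \<nu>). inv g \<in> V}"
      if "zero_neighbourhood (E_weight_topology (\<phi> (\<nu> + 2))) V" for V
      unfolding zero_neighbourhood_G_weight
    proof (rule seminorm_nbhd_vimage[OF that[unfolded zero_neighbourhood_E_weight] inv_mem[OF \<nu>]])
      fix q assume "q \<in> range (E_norm (\<phi> (\<nu> + 2)))"
      then obtain k where q: "q = E_norm (\<phi> (\<nu> + 2)) k" by auto
      obtain K where K: "\<And>t. (\<And>i. 0 \<le> t $ i) \<Longrightarrow> \<phi> \<nu> (2 *\<^sub>R (t + (\<chi> i. 1))) \<le> \<phi> (\<nu> + 2) t + K"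
        using shift[OF \<nu>] by blast
      obtain C where C: "C > 0" "\<And>g r. g \<in> G_weight (?h \<nu>) \<Longrightarrow> G_norm (?h \<nu>) k g \<le> ereal r \<Longrightarrow> q (laplace g) \<le> ereal (C * r)"
        using E_norm_laplace[OF A[OF \<nu>] K, of k] unfolding q h by blast
      have "q (inv g) \<le> ereal (C / c\<^sup>2 * r)" if "g \<in> G_weight (?h \<nu>)" "G_norm (?h \<nu>) k g \<le> ereal r" for g r
      proof -
        have le: "cmod (laplace g z) * (1 + norm z) ^ k \<le> C * r * exp (\<phi> (\<nu> + 2) (\<chi> i. \<bar>Im (z $ i)\<bar>))" for z
          using C(2)[OF that] unfolding q E_norm_le_iff by blast
        have eq: "cmod (inv g z) = cmod (laplace g z) / c\<^sup>2" for z
          by (simp add: inv_def norm_mult norm_inverse norm_power divide_inverse mult.commute)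
        show ?thesis
          using divide_right_mono[OF le, of "c\<^sup>2"] unfolding q E_norm_le_iff by (simp add: eq)
      qed
      moreover have "0 < C / c\<^sup>2" using C(1) c by simp
      ultimately show "\<exists>p\<in>range (G_norm (?h \<nu>)). \<exists>C>0. \<forall>g\<in>G_weight (?h \<nu>). \<forall>r. p g \<le> ereal r \<longrightarrow> q (inv g) \<le> ereal (C * r)"
        by (intro bexI[of _ "G_norm (?h \<nu>) k"] exI[of _ "C / c\<^sup>2"]) auto
    qed (auto intro: G_norm_nonneg)
    then show "\<exists>\<mu>\<in>{1..}. inv ` topspace (G_weight_topology (?h \<nu>)) \<subseteq> topspace (E_weight_topology (\<phi> \<mu>)) \<and>
        (\<forall>V. zero_neighbourhood (E_weight_topology (\<phi> \<mu>)) V \<longrightarrow>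
          zero_neighbourhood (G_weight_topology (?h \<nu>)) {g \<in> topspace (G_weight_topology (?h \<nu>)). inv g \<in> V})"
      using inv_mem[OF \<nu>] unfolding topspace_E_weight topspace_G_weight by (intro bexI[of _ "\<nu> + 2"]) auto
  qed (use linear_E linear_G E_zero G_zero inv_linear in auto)
  have bij: "bij_betw fourier ?E ?G"
    by (rule bij_betw_byWitness[of ?E inv]) (use inv_F F_inv F_E inv_G in auto)
  have "homeomorphic_maps (E_topology \<phi>) (G_topology ?h) fourier inv"
    using cont_F cont_inv inv_F F_inv by (simp add: homeomorphic_maps_def top_E top_G)
  then have "homeomorphic_map (E_topology \<phi>) (G_topology ?h) fourier"
    by (rule homeomorphic_maps_imp_map)
  then show ?thesis
    using integrable top_E top_G bij F_linear unfolding tvs_isomorphism_def by blast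
qed

end
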